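(* Let $\mathcal{G}$ be a locally compact étale groupoid with unit space $\mathcal{G}^{(0)}$. For $(T_x)_{x\in\mathcal{G}^{(0)}}\in\prod_{x\in\mathcal{G}^{(0)}}\mathcal{B}(\ell^2(\mathcal{G}_x))$, the following are equivalent: (1) there exists a quasi-local operator $T\in\mathcal{L}(L^2(\mathcal{G}))$ such that $\Phi_x(T)=T_x$ for all $x\in\mathcal{G}^{(0)}$; (2) the map $x\mapsto T_x$ is a continuous section of the operator fibre space $E$ and $(T_x)_{x\in\mathcal{G}^{(0)}}$ is compactly uniformly quasi-local. A similar result holds for compactly supported operators: there exists a compactly supported $T\in\mathcal{L}(L^2(\mathcal{G}))$ with $\Phi_x(T)=T_x$ for all $x$ if and only if $x\mapsto T_x$ is a continuous section of $E$ and there is a compact $K\subseteq\mathcal{G}$ such that $\chi_{A_x}T_x\chi_{B_x}=0$ for any $x\in\mathcal{G}^{(0)}$ and $A_x,B_x\subseteq\mathcal{G}_x$ with $A_x\cap(K\cdot B_x)=\emptyset$ and $(K\cdot A_x)\cap B_x=\emptyset$.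
   Context: Locally compact spaces are assumed Hausdorff. A locally compact étale groupoid $\mathcal{G}$ is a topological groupoid with locally compact topology whose range map $\mathrm{r}$ (hence source map $\mathrm{s}$) is a local homeomorphism; $\mathcal{G}_x=\mathrm{s}^{-1}(x)$ (discrete). For $A,B\subseteq\mathcal{G}$, $A\cdot B=\{\alpha\beta:\alpha\in A,\beta\in B,\mathrm{s}(\alpha)=\mathrm{r}(\beta)\}$. Functions act by pointwise multiplication. $\prod_x$ denotes uniformly norm-bounded families. $L^2(\mathcal{G})$ is the Hilbert $C_0(\mathcal{G}^{(0)})$-module obtained by completing $C_c(\mathcal{G})$ for $\langle\eta,\xi\rangle(x)=\sum_{\gamma\in\mathcal{G}_x}\overline{\eta(\gamma)}\xi(\gamma)$, with $(\xi f)(\gamma)=\xi(\gamma)f(\mathrm{s}(\gamma))$; its elements are regarded as functions in $C_0(\mathcal{G})$. $\mathcal{L}(L^2(\mathcal{G}))$ is the $C^*$-algebra of adjointable operators. The slice $\Phi_x(T)\in\mathcal{B}(\ell^2(\mathcal{G}_x))$ is defined by $\Phi_x(T)(\xi|_{\mathcal{G}_x})=T(\xi)|_{\mathcal{G}_x}$ for $\xi\in L^2(\mathcal{G})$. For $K\subseteq\mathcal{G}$, $f,g\in C_b(\mathcal{G})$ are $K$-separated if $(K\cdot\mathrm{supp}(f))\cap\mathrm{supp}(g)=\emptyset$ and $\mathrm{supp}(f)\cap(K\cdot\mathrm{supp}(g))=\emptyset$. $T$ is compactly supported if there is a compact $K\subseteq\mathcal{G}$ with $gTf=0$ for all $K$-separated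 $f,g\in C_b(\mathcal{G})$. $T$ is quasi-local if for any $\varepsilon>0$ there is a compact $K\subseteq\mathcal{G}$ such that $\|gTf\|<\varepsilon\|g\|_\infty\|f\|_\infty$ (read as $\le$ when $f=0$ or $g=0$) for all $K$-separated $f,g\in C_b(\mathcal{G})$. $E=\bigsqcup_{x\in\mathcal{G}^{(0)}}\mathcal{B}(\ell^2(\mathcal{G}_x))$ with topology: a net $\sigma_{x_i}\in\mathcal{B}(\ell^2(\mathcal{G}_{x_i}))$ converges to $\sigma_x\in\mathcal{B}(\ell^2(\mathcal{G}_x))$ iff $x_i\to x$ and for any $\gamma_i'\to\gamma'$, $\gamma_i''\to\gamma''$ in $\mathcal{G}$ with $\mathrm{s}(\gamma_i')=x_i=\mathrm{s}(\gamma_i'')$, $\langle\delta_{\gamma_i''},\sigma_{x_i}(\delta_{\gamma_i'})\rangle\to\langle\delta_{\gamma''},\sigma_x(\delta_{\gamma'})\rangle$. $(T_x)_x$ is compactly uniformly quasi-local if for any $\varepsilon>0$ there is a compact $K\subseteq\mathcal{G}$ such that for any $x\in\mathcal{G}^{(0)}$ and $A_x,B_x\subseteq\mathcal{G}_x$ with $A_x\cap(K\cdot B_x)=\emptyset$ and $(K\cdot A_x)\cap B_x=\emptyset$ we have $\|\chi_{A_x}T_x\chi_{B_x}\|<\varepsilon$. *)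

theory Defs
  imports "HOL-Analysis.Analysis"
begin

section \<open>Locally compact etale groupoids\<close>

text \<open>
  The underlying set of the groupoid is the whole type \<open>'g\<close>, and its topology is the one of the
  type. Units are arrows, so range and source are maps from \<open>'g\<close> to itself; \<open>gmul G \<alpha> \<beta>\<close> is
  meaningful only if \<open>gsrc G \<alpha> = grng G \<beta>\<close>.
\<close>

record 'g groupoid_data =
  gmul :: "'g \<Rightarrow> 'g \<Rightarrow> 'g"
  ginv :: "'g \<Rightarrow> 'g"
  grng :: "'g \<Rightarrow> 'g"
  gsrc :: "'g \<Rightarrow> 'g"

definition units :: "'g groupoid_data \<Rightarrow> 'g set" where
  "units G = range (gsrc G)"

definition fibre :: "'g groupoid_data \<Rightarrow> 'g \<Rightarrow> 'g set" where
  "fibre G x = {\<gamma>. gsrc G \<gamma> = x}"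

definition set_mul :: "'g groupoid_data \<Rightarrow> 'g set \<Rightarrow> 'g set \<Rightarrow> 'g set" where
  "set_mul G A B = {gmul G \<alpha> \<beta> |\<alpha> \<beta>. \<alpha> \<in> A \<and> \<beta> \<in> B \<and> gsrc G \<alpha> = grng G \<beta>}"

locale groupoid =
  fixes G :: "'g groupoid_data"
  assumes src_src: "gsrc G (gsrc G \<gamma>) = gsrc G \<gamma>"
    and rng_src: "grng G (gsrc G \<gamma>) = gsrc G \<gamma>"
    and src_rng: "gsrc G (grng G \<gamma>) = grng G \<gamma>"
    and rng_rng: "grng G (grng G \<gamma>) = grng G \<gamma>"
    and src_mul: "gsrc G \<alpha> = grng G \<beta> \<Longrightarrow> gsrc G (gmul G \<alpha> \<beta>) = gsrc G \<beta>"
    and rng_mul: "gsrc G \<alpha> = grng G \<beta> \<Longrightarrow> grng G (gmul G \<alpha> \<beta>) = grng G \<alpha>"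
    and mul_assoc: "\<lbrakk>gsrc G \<alpha> = grng G \<beta>; gsrc G \<beta> = grng G \<gamma>\<rbrakk> \<Longrightarrow>
          gmul G (gmul G \<alpha> \<beta>) \<gamma> = gmul G \<alpha> (gmul G \<beta> \<gamma>)"
    and rng_mul_left: "gmul G (grng G \<gamma>) \<gamma> = \<gamma>"
    and src_mul_right: "gmul G \<gamma> (gsrc G \<gamma>) = \<gamma>"
    and src_inv: "gsrc G (ginv G \<gamma>) = grng G \<gamma>"
    and rng_inv: "grng G (ginv G \<gamma>) = gsrc G \<gamma>"
    and inv_mul: "gmul G (ginv G \<gamma>) \<gamma> = gsrc G \<gamma>"
    and mul_inv: "gmul G \<gamma> (ginv G \<gamma>) = grng G \<gamma>"

locale topological_groupoid = groupoid G
  for G :: "'g::topological_space groupoid_data" +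
  assumes continuous_mul:
      "continuous_on {(\<alpha>, \<beta>). gsrc G \<alpha> = grng G \<beta>} (\<lambda>(\<alpha>, \<beta>). gmul G \<alpha> \<beta>)"
    and continuous_inv: "continuous_on UNIV (ginv G)"

locale lc_etale_groupoid = topological_groupoid G
  for G :: "'g::t2_space groupoid_data" +
  assumes locally_compact: "locally_compact_space (euclidean :: 'g topology)"
    and rng_local_homeomorphism:
      "\<exists>U h. open U \<and> \<gamma> \<in> U \<and> openin (top_of_set (units G)) (grng G ` U) \<and>
             homeomorphism U (grng G ` U) (grng G) h"


section \<open>The Hilbert spaces of square summable functions on the fibres\<close>

type_synonym 'g operator = "('g \<Rightarrow> complex) \<Rightarrow> ('g \<Rightarrow> complex)"

definition fibre_inner :: "'g groupoid_data \<Rightarrow> 'g \<Rightarrow> ('g \<Rightarrow> complex) \<Rightarrow> ('g \<Rightarrow> complex) \<Rightarrow> complex" where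
  "fibre_inner G x v w = (\<Sum>\<^sub>\<infinity>\<gamma>\<in>fibre G x. cnj (v \<gamma>) * w \<gamma>)"

definition fibre_norm :: "'g groupoid_data \<Rightarrow> 'g \<Rightarrow> ('g \<Rightarrow> complex) \<Rightarrow> real" where
  "fibre_norm G x v = sqrt (\<Sum>\<^sub>\<infinity>\<gamma>\<in>fibre G x. (cmod (v \<gamma>))\<^sup>2)"

text \<open>Functions on a fibre are represented by their extension by zero to the groupoid.\<close>

definition fibre_l2 :: "'g groupoid_data \<Rightarrow> 'g \<Rightarrow> ('g \<Rightarrow> complex) set" where
  "fibre_l2 G x =
     {v. (\<forall>\<gamma>. \<gamma> \<notin> fibre G x \<longrightarrow> v \<gamma> = 0) \<and> (\<lambda>\<gamma>. (cmod (v \<gamma>))\<^sup>2) summable_on fibre G x}"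

definition fibre_restrict :: "'g groupoid_data \<Rightarrow> 'g \<Rightarrow> ('g \<Rightarrow> complex) \<Rightarrow> ('g \<Rightarrow> complex)" where
  "fibre_restrict G x \<xi> = (\<lambda>\<gamma>. if \<gamma> \<in> fibre G x then \<xi> \<gamma> else 0)"

definition delta :: "'g \<Rightarrow> 'g \<Rightarrow> complex" where
  "delta \<gamma> = indicator {\<gamma>}"

text \<open>
  Operators are extensional functions on their domain, so that two operators are equal as soon
  as they agree on the domain.
\<close>

definition fibre_operators :: "'g groupoid_data \<Rightarrow> 'g \<Rightarrow> 'g operator set" where
  "fibre_operators G x =
     {S \<in> fibre_l2 G x \<rightarrow>\<^sub>E fibre_l2 G x.
        (\<forall>v\<in>fibre_l2 G x. \<forall>w\<in>fibre_l2 G x. S (\<lambda>\<gamma>. v \<gamma> + w \<gamma>) = (\<lambda>\<gamma>. S v \<gamma> + S w \<gamma>)) \<and>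
        (\<forall>c. \<forall>v\<in>fibre_l2 G x. S (\<lambda>\<gamma>. c * v \<gamma>) = (\<lambda>\<gamma>. c * S v \<gamma>)) \<and>
        (\<exists>C. \<forall>v\<in>fibre_l2 G x. fibre_norm G x (S v) \<le> C * fibre_norm G x v)}"

definition op_norm :: "('v \<Rightarrow> real) \<Rightarrow> 'v set \<Rightarrow> ('v \<Rightarrow> 'v) \<Rightarrow> real" where
  "op_norm N V S = (SUP v\<in>{v \<in> V. N v \<le> 1}. N (S v))"

definition fibre_op_norm :: "'g groupoid_data \<Rightarrow> 'g \<Rightarrow> 'g operator \<Rightarrow> real" where
  "fibre_op_norm G x = op_norm (fibre_norm G x) (fibre_l2 G x)"

text \<open>\<open>mult_comp g S f\<close> is the composition \<open>g S f\<close>, where \<open>f\<close> and \<open>g\<close> act by multiplication.\<close>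

definition mult_comp :: "('g \<Rightarrow> complex) \<Rightarrow> 'g operator \<Rightarrow> ('g \<Rightarrow> complex) \<Rightarrow> 'g operator" where
  "mult_comp g S f = (\<lambda>\<xi> \<gamma>. g \<gamma> * S (\<lambda>\<gamma>'. f \<gamma>' * \<xi> \<gamma>') \<gamma>)"

definition bounded_operator_families :: "'g groupoid_data \<Rightarrow> ('g \<Rightarrow> 'g operator) set" where
  "bounded_operator_families G =
     {T. (\<forall>x\<in>units G. T x \<in> fibre_operators G x) \<and>
         (\<exists>C. \<forall>x\<in>units G. fibre_op_norm G x (T x) \<le> C)}"


section \<open>The Hilbert module and its adjointable operators\<close>

definition supp :: "('g::topological_space \<Rightarrow> complex) \<Rightarrow> 'g set" where
  "supp f = closure {\<gamma>. f \<gamma> \<noteq> 0}"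

definition cont_compact_supp :: "('g::topological_space \<Rightarrow> complex) set" where
  "cont_compact_supp = {f. continuous_on UNIV f \<and> compact (supp f)}"

text \<open>As a function of \<open>x\<close>, \<open>module_inner G \<eta> \<xi>\<close> vanishes off the unit space, where fibres are empty.\<close>

definition module_inner :: "'g groupoid_data \<Rightarrow> ('g \<Rightarrow> complex) \<Rightarrow> ('g \<Rightarrow> complex) \<Rightarrow> 'g \<Rightarrow> complex" where
  "module_inner G \<eta> \<xi> = (\<lambda>x. fibre_inner G x \<eta> \<xi>)"

definition module_norm :: "'g groupoid_data \<Rightarrow> ('g \<Rightarrow> complex) \<Rightarrow> real" where
  "module_norm G \<xi> = sqrt (SUP x\<in>units G. cmod (module_inner G \<xi> \<xi> x))"

text \<open>
  The completion of \<open>C\<^sub>c\<close> for \<open>module_norm\<close>, realised as functions: as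
  \<open>\<bar>\<xi> \<gamma>\<bar> \<le> module_norm G \<xi>\<close>, a Cauchy sequence converges pointwise, and the element of
  the completion that it represents is identified with its pointwise limit.
\<close>

definition L2 :: "'g::topological_space groupoid_data \<Rightarrow> ('g \<Rightarrow> complex) set" where
  "L2 G = {\<xi>. \<exists>u :: nat \<Rightarrow> 'g \<Rightarrow> complex.
             (\<forall>n. u n \<in> cont_compact_supp) \<and>
             (\<forall>\<epsilon>>0. \<exists>N. \<forall>m\<ge>N. \<forall>n\<ge>N. module_norm G (\<lambda>\<gamma>. u m \<gamma> - u n \<gamma>) < \<epsilon>) \<and>
             (\<forall>\<gamma>. (\<lambda>n. u n \<gamma>) \<longlonglongrightarrow> \<xi> \<gamma>)}"

definition adjointable :: "'g::topological_space groupoid_data \<Rightarrow> 'g operator set" where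
  "adjointable G =
     {S \<in> L2 G \<rightarrow>\<^sub>E L2 G. \<exists>R \<in> L2 G \<rightarrow>\<^sub>E L2 G.
        \<forall>\<eta>\<in>L2 G. \<forall>\<xi>\<in>L2 G. module_inner G (S \<eta>) \<xi> = module_inner G \<eta> (R \<xi>)}"

definition module_op_norm :: "'g::topological_space groupoid_data \<Rightarrow> 'g operator \<Rightarrow> real" where
  "module_op_norm G = op_norm (module_norm G) (L2 G)"

definition slice :: "'g::topological_space groupoid_data \<Rightarrow> 'g \<Rightarrow> 'g operator \<Rightarrow> 'g operator" where
  "slice G x S =
     (THE R. R \<in> fibre_operators G x \<and>
             (\<forall>\<xi>\<in>L2 G. R (fibre_restrict G x \<xi>) = fibre_restrict G x (S \<xi>)))"


section \<open>Compactly supported and quasi-local operators\<close>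

definition separated ::
  "'g::topological_space groupoid_data \<Rightarrow> 'g set \<Rightarrow> ('g \<Rightarrow>\<^sub>C complex) \<Rightarrow> ('g \<Rightarrow>\<^sub>C complex) \<Rightarrow> bool" where
  "separated G K f g \<longleftrightarrow>
     set_mul G K (supp (apply_bcontfun f)) \<inter> supp (apply_bcontfun g) = {} \<and>
     supp (apply_bcontfun f) \<inter> set_mul G K (supp (apply_bcontfun g)) = {}"

definition compactly_supported :: "'g::topological_space groupoid_data \<Rightarrow> 'g operator \<Rightarrow> bool" where
  "compactly_supported G S \<longleftrightarrow>
     (\<exists>K. compact K \<and>
        (\<forall>f g. separated G K f g \<longrightarrow>
           (\<forall>\<xi>\<in>L2 G. mult_comp (apply_bcontfun g) S (apply_bcontfun f) \<xi> = (\<lambda>\<gamma>. 0))))"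

definition quasi_local :: "'g::topological_space groupoid_data \<Rightarrow> 'g operator \<Rightarrow> bool" where
  "quasi_local G S \<longleftrightarrow>
     (\<forall>\<epsilon>>0. \<exists>K. compact K \<and>
        (\<forall>f g. separated G K f g \<longrightarrow>
           (if f = 0 \<or> g = 0
            then module_op_norm G (mult_comp (apply_bcontfun g) S (apply_bcontfun f)) \<le> \<epsilon> * norm g * norm f
            else module_op_norm G (mult_comp (apply_bcontfun g) S (apply_bcontfun f)) < \<epsilon> * norm g * norm f)))"

definition fibre_separated :: "'g groupoid_data \<Rightarrow> 'g set \<Rightarrow> 'g \<Rightarrow> 'g set \<Rightarrow> 'g set \<Rightarrow> bool" where
  "fibre_separated G K x A B \<longleftrightarrow>
     A \<subseteq> fibre G x \<and> B \<subseteq> fibre G x \<and> A \<inter> set_mul G K B = {} \<and> set_mul G K A \<inter> B = {}"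

definition compactly_uniformly_quasi_local ::
  "'g::topological_space groupoid_data \<Rightarrow> ('g \<Rightarrow> 'g operator) \<Rightarrow> bool" where
  "compactly_uniformly_quasi_local G T \<longleftrightarrow>
     (\<forall>\<epsilon>>0. \<exists>K. compact K \<and>
        (\<forall>x\<in>units G. \<forall>A B. fibre_separated G K x A B \<longrightarrow>
           fibre_op_norm G x (mult_comp (indicator A) (T x) (indicator B)) < \<epsilon>))"


section \<open>The operator fibre space\<close>

definition operator_space :: "'g groupoid_data \<Rightarrow> ('g \<times> 'g operator) set" where
  "operator_space G = (SIGMA x:units G. fibre_operators G x)"

text \<open>
  Convergence of a net \<open>\<sigma>\<close> to \<open>e\<close> in the operator fibre space; nets are rendered as functions
  on a type equipped with a filter.
\<close>

definition operator_space_converges ::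
  "'g::topological_space groupoid_data \<Rightarrow> ('i \<Rightarrow> 'g \<times> 'g operator) \<Rightarrow> 'g \<times> 'g operator \<Rightarrow>
     'i filter \<Rightarrow> bool" where
  "operator_space_converges G \<sigma> e F \<longleftrightarrow>
     e \<in> operator_space G \<and> (\<forall>\<^sub>F i in F. \<sigma> i \<in> operator_space G) \<and>
     ((\<lambda>i. fst (\<sigma> i)) \<longlongrightarrow> fst e) F \<and>
     (\<forall>\<gamma>' \<gamma>'' a b.
        (\<gamma>' \<longlongrightarrow> a) F \<longrightarrow> (\<gamma>'' \<longlongrightarrow> b) F \<longrightarrow>
        (\<forall>\<^sub>F i in F. gsrc G (\<gamma>' i) = fst (\<sigma> i) \<and> fst (\<sigma> i) = gsrc G (\<gamma>'' i)) \<longrightarrow>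
        ((\<lambda>i. fibre_inner G (fst (\<sigma> i)) (delta (\<gamma>'' i)) (snd (\<sigma> i) (delta (\<gamma>' i))))
           \<longlongrightarrow> fibre_inner G (fst e) (delta b) (snd e (delta a))) F)"

text \<open>
  The topology determined by this convergence. Nets indexed by the type of the points suffice,
  as every filter on the space is the image of itself under the identity net;
  \<open>limitin_operator_space\<close> below confirms that nets on any index type converge as prescribed.
\<close>

definition operator_space_topology ::
  "'g::topological_space groupoid_data \<Rightarrow> ('g \<times> 'g operator) topology" where
  "operator_space_topology G = topology (\<lambda>U. U \<subseteq> operator_space G \<and>
     (\<forall>\<sigma> e (F :: ('g \<times> 'g operator) filter).
        e \<in> U \<and> operator_space_converges G \<sigma> e F \<longrightarrow> (\<forall>\<^sub>F i in F. \<sigma> i \<in> U)))"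

lemma openin_operator_space:
  fixes G :: "'g::topological_space groupoid_data"
  shows "openin (operator_space_topology G) U \<longleftrightarrow> U \<subseteq> operator_space G \<and>
     (\<forall>\<sigma> e (F :: ('g \<times> 'g operator) filter).
        e \<in> U \<and> operator_space_converges G \<sigma> e F \<longrightarrow> (\<forall>\<^sub>F i in F. \<sigma> i \<in> U))"
proof -
  let ?P = "\<lambda>U. U \<subseteq> operator_space G \<and>
     (\<forall>\<sigma> e (F :: ('g \<times> 'g operator) filter).
        e \<in> U \<and> operator_space_converges G \<sigma> e F \<longrightarrow> (\<forall>\<^sub>F i in F. \<sigma> i \<in> U))"
  have "?P (S \<inter> T)" if "?P S" "?P T" for S T
    using that by (auto intro: eventually_conj)
  moreover have "?P (\<Union>\<K>)" if K: "\<forall>V\<in>\<K>. ?P V" for \<K>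
  proof (intro conjI allI impI)
    show "\<Union>\<K> \<subseteq> operator_space G" using K by blast
    fix \<sigma> e and F :: "('g \<times> 'g operator) filter"
    assume "e \<in> \<Union>\<K> \<and> operator_space_converges G \<sigma> e F"
    then obtain V where "V \<in> \<K>" "\<forall>\<^sub>F i in F. \<sigma> i \<in> V" using K by blast
    then show "\<forall>\<^sub>F i in F. \<sigma> i \<in> \<Union>\<K>" by (auto elim: eventually_mono)
  qed
  ultimately have "istopology ?P" unfolding istopology_def by blast
  then show ?thesis unfolding operator_space_topology_def by (simp add: topology_inverse')
qed

lemma topspace_operator_space [simp]:
  "topspace (operator_space_topology G) = operator_space G"
proof
  show "topspace (operator_space_topology G) \<subseteq> operator_space G"
    using openin_operator_space[of G "topspace (operator_space_topology G)"] by simp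
  have "openin (operator_space_topology G) (operator_space G)"
    by (auto simp: openin_operator_space operator_space_converges_def)
  then show "operator_space G \<subseteq> topspace (operator_space_topology G)"
    by (rule openin_subset)
qed

lemma operator_space_converges_filtermap:
  assumes "operator_space_converges G \<sigma> e F"
  shows "operator_space_converges G (\<lambda>p. p) e (filtermap \<sigma> F)"
  using assms unfolding operator_space_converges_def
  by (auto simp: eventually_filtermap filterlim_filtermap)

context lc_etale_groupoid
begin

lemma src_local_section:
  obtains U t where "open U" "\<gamma> \<in> U" "openin (top_of_set (units G)) (gsrc G ` U)"
    "continuous_on (gsrc G ` U) t" "\<And>\<beta>. \<beta> \<in> U \<Longrightarrow> t (gsrc G \<beta>) = \<beta>"
proof -
  obtain V h where V: "open V" "ginv G \<gamma> \<in> V" "openin (top_of_set (units G)) (grng G ` V)"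
    "homeomorphism V (grng G ` V) (grng G) h"
    using rng_local_homeomorphism[of "ginv G \<gamma>"] by blast
  have inv_inv: "ginv G (ginv G \<beta>) = \<beta>" for \<beta>
    by (metis inv_mul mul_assoc rng_inv rng_mul_left src_inv src_mul_right)
  define U where "U = ginv G -` V"
  have UV: "gsrc G ` U = grng G ` V"
  proof -
    have "V \<subseteq> ginv G ` U" unfolding U_def
      by (metis image_eqI inv_inv subsetI vimageI)
    then have "ginv G ` U = V" by (auto simp: U_def)
    then have "grng G ` V = (\<lambda>\<beta>. grng G (ginv G \<beta>)) ` U" by auto
    then show ?thesis by (simp add: rng_inv)
  qed
  show thesis
  proof
    show "open U" unfolding U_def using continuous_inv V(1) by (rule open_vimage[rotated])
    show "\<gamma> \<in> U" using V(2) by (simp add: U_def)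
    show "openin (top_of_set (units G)) (gsrc G ` U)" using V(3) UV by simp
    show "continuous_on (gsrc G ` U) (\<lambda>x. ginv G (h x))"
      unfolding UV using V(4) continuous_inv
      by (auto simp: homeomorphism_def intro: continuous_on_compose2)
    show "ginv G (h (gsrc G \<beta>)) = \<beta>" if "\<beta> \<in> U" for \<beta>
      using that V(4) unfolding U_def homeomorphism_def
      by (metis inv_inv rng_inv vimageE)
  qed
qed

lemma continuous_src: "continuous_on UNIV (gsrc G)"
proof -
  have "continuous_on UNIV ((\<lambda>(\<alpha>, \<beta>). gmul G \<alpha> \<beta>) \<circ> (\<lambda>\<gamma>. (ginv G \<gamma>, \<gamma>)))"
    using continuous_inv
    by (intro continuous_on_compose continuous_on_subset[OF continuous_mul] continuous_intros)
       (auto simp: src_inv)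
  then show ?thesis by (simp add: o_def inv_mul)
qed

theorem limitin_operator_space:
  fixes F :: "'i filter"
  shows "limitin (operator_space_topology G) \<sigma> e F \<longleftrightarrow> operator_space_converges G \<sigma> e F"
proof
  assume c: "operator_space_converges G \<sigma> e F"
  show "limitin (operator_space_topology G) \<sigma> e F"
    unfolding limitin_def
  proof (intro conjI allI impI)
    show "e \<in> topspace (operator_space_topology G)"
      using c by (simp add: operator_space_converges_def)
    fix U assume "openin (operator_space_topology G) U \<and> e \<in> U"
    then have "\<forall>\<^sub>F p in filtermap \<sigma> F. p \<in> U"
      using operator_space_converges_filtermap[OF c] openin_operator_space[of G U] by blast
    then show "\<forall>\<^sub>F i in F. \<sigma> i \<in> U" by (simp add: eventually_filtermap)
  qed
next
  assume l: "limitin (operator_space_topology G) \<sigma> e F"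
  then have e: "e \<in> operator_space G" by (simp add: limitin_def)
  have ev: "\<forall>\<^sub>F i in F. \<sigma> i \<in> U" if "openin (operator_space_topology G) U" "e \<in> U" for U
    using l that by (auto simp: limitin_def)
  have in_E: "\<forall>\<^sub>F i in F. \<sigma> i \<in> operator_space G"
    using ev[of "operator_space G"] e openin_topspace[of "operator_space_topology G"] by simp
  have base: "((\<lambda>i. fst (\<sigma> i)) \<longlongrightarrow> fst e) F"
  proof (rule topological_tendstoI)
    fix W assume W: "open W" "fst e \<in> W"
    have "openin (operator_space_topology G) {p \<in> operator_space G. fst p \<in> W}"
      unfolding openin_operator_space
    proof (intro conjI allI impI)
      fix \<tau> p and H :: "('g \<times> 'g operator) filter"
      assume "p \<in> {p \<in> operator_space G. fst p \<in> W} \<and> operator_space_converges G \<tau> p H"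
      then have "\<forall>\<^sub>F i in H. \<tau> i \<in> operator_space G" "\<forall>\<^sub>F i in H. fst (\<tau> i) \<in> W"
        using W(1) by (auto simp: operator_space_converges_def dest: topological_tendstoD)
      then show "\<forall>\<^sub>F i in H. \<tau> i \<in> {p \<in> operator_space G. fst p \<in> W}"
        by (auto intro: eventually_elim2)
    qed auto
    from ev[OF this] show "\<forall>\<^sub>F i in F. fst (\<sigma> i) \<in> W"
      using e W(2) by (auto elim: eventually_mono)
  qed
  have coeff: "((\<lambda>i. fibre_inner G (fst (\<sigma> i)) (delta (\<gamma>'' i)) (snd (\<sigma> i) (delta (\<gamma>' i))))
           \<longlongrightarrow> fibre_inner G (fst e) (delta b) (snd e (delta a))) F"
    if lim: "(\<gamma>' \<longlongrightarrow> a) F" "(\<gamma>'' \<longlongrightarrow> b) F"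
      and src: "\<forall>\<^sub>F i in F. gsrc G (\<gamma>' i) = fst (\<sigma> i) \<and> fst (\<sigma> i) = gsrc G (\<gamma>'' i)"
    for \<gamma>' \<gamma>'' a b
  proof (cases "F = bot")
    case False
    have src_lim: "gsrc G c = fst e"
      if "(\<gamma> \<longlongrightarrow> c) F" "\<forall>\<^sub>F i in F. gsrc G (\<gamma> i) = fst (\<sigma> i)" for \<gamma> c
    proof -
      have "((\<lambda>i. gsrc G (\<gamma> i)) \<longlongrightarrow> gsrc G c) F"
        using continuous_on_tendsto_compose[OF continuous_src that(1)] by simp
      then have "((\<lambda>i. fst (\<sigma> i)) \<longlongrightarrow> gsrc G c) F"
        using that(2) by (rule Lim_transform_eventually)
      then show ?thesis using base False tendsto_unique by blast
    qed
    have sa: "gsrc G a = fst e" using src by (intro src_lim[OF lim(1)]) (auto elim: eventually_mono)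
    have sb: "gsrc G b = fst e" using src by (intro src_lim[OF lim(2)]) (auto elim: eventually_mono)
    obtain U t where U: "open U" "a \<in> U" "openin (top_of_set (units G)) (gsrc G ` U)"
      "continuous_on (gsrc G ` U) t" "\<And>\<beta>. \<beta> \<in> U \<Longrightarrow> t (gsrc G \<beta>) = \<beta>"
      using src_local_section by blast
    obtain V t' where V: "open V" "b \<in> V" "openin (top_of_set (units G)) (gsrc G ` V)"
      "continuous_on (gsrc G ` V) t'" "\<And>\<beta>. \<beta> \<in> V \<Longrightarrow> t' (gsrc G \<beta>) = \<beta>"
      using src_local_section by blast
    define c where "c p = fibre_inner G (fst p) (delta (t' (fst p))) (snd p (delta (t (fst p))))"
      for p :: "'g \<times> 'g operator"
    obtain WU where WU: "open WU" "gsrc G ` U = units G \<inter> WU"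
      using U(3) by (auto simp: openin_open)
    obtain WV where WV: "open WV" "gsrc G ` V = units G \<inter> WV"
      using V(3) by (auto simp: openin_open)
    show ?thesis
    proof (rule topological_tendstoI)
      fix W :: "complex set"
      assume W: "open W" "fibre_inner G (fst e) (delta b) (snd e (delta a)) \<in> W"
      define N where "N = {p \<in> operator_space G. fst p \<in> gsrc G ` U \<and> fst p \<in> gsrc G ` V \<and> c p \<in> W}"
      have "openin (operator_space_topology G) N"
        unfolding openin_operator_space
      proof (intro conjI allI impI)
        show "N \<subseteq> operator_space G" by (auto simp: N_def)
        fix \<tau> p and H :: "('g \<times> 'g operator) filter"
        assume as: "p \<in> N \<and> operator_space_converges G \<tau> p H"
        then have \<tau>E: "\<forall>\<^sub>F i in H. \<tau> i \<in> operator_space G"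
          and fs: "((\<lambda>i. fst (\<tau> i)) \<longlongrightarrow> fst p) H"
          by (auto simp: operator_space_converges_def)
        have pU: "fst p \<in> gsrc G ` U" and pV: "fst p \<in> gsrc G ` V" and pW: "c p \<in> W"
          using as by (auto simp: N_def)
        have "\<forall>\<^sub>F i in H. fst (\<tau> i) \<in> WU" "\<forall>\<^sub>F i in H. fst (\<tau> i) \<in> WV"
          using topological_tendstoD[OF fs] WU WV pU pV by auto
        with \<tau>E have inU: "\<forall>\<^sub>F i in H. fst (\<tau> i) \<in> gsrc G ` U"
          and inV: "\<forall>\<^sub>F i in H. fst (\<tau> i) \<in> gsrc G ` V"
          unfolding WU WV by (auto simp: operator_space_def elim: eventually_elim2)
        have "((\<lambda>i. t (fst (\<tau> i))) \<longlongrightarrow> t (fst p)) H"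
          using continuous_on_tendsto_compose[OF U(4) fs pU inU] .
        moreover have "((\<lambda>i. t' (fst (\<tau> i))) \<longlongrightarrow> t' (fst p)) H"
          using continuous_on_tendsto_compose[OF V(4) fs pV inV] .
        moreover have "\<forall>\<^sub>F i in H. gsrc G (t (fst (\<tau> i))) = fst (\<tau> i) \<and>
            fst (\<tau> i) = gsrc G (t' (fst (\<tau> i)))"
          using inU inV by eventually_elim (auto simp: U(5) V(5) image_iff; metis U(5) V(5))
        ultimately have "((\<lambda>i. c (\<tau> i)) \<longlongrightarrow> c p) H"
          using as unfolding operator_space_converges_def c_def by blast
        then have "\<forall>\<^sub>F i in H. c (\<tau> i) \<in> W" using W(1) pW by (rule topological_tendstoD)
        with \<tau>E inU inV show "\<forall>\<^sub>F i in H. \<tau> i \<in> N"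
          by eventually_elim (simp add: N_def)
      qed
      moreover have "fst e \<in> gsrc G ` U" "fst e \<in> gsrc G ` V"
        using sa sb U(2) V(2) by force+
      then have "e \<in> N"
        using e W(2) U(5)[OF U(2)] V(5)[OF V(2)] sa sb by (simp add: N_def c_def)
      ultimately have "\<forall>\<^sub>F i in F. \<sigma> i \<in> N" by (rule ev)
      moreover have "\<forall>\<^sub>F i in F. \<gamma>' i \<in> U" "\<forall>\<^sub>F i in F. \<gamma>'' i \<in> V"
        using topological_tendstoD lim U(1,2) V(1,2) by blast+
      ultimately show "\<forall>\<^sub>F i in F. fibre_inner G (fst (\<sigma> i)) (delta (\<gamma>'' i)) (snd (\<sigma> i) (delta (\<gamma>' i))) \<in> W"
        using src
      proof eventually_elim
        case (elim i)
        then have "t (fst (\<sigma> i)) = \<gamma>' i" "t' (fst (\<sigma> i)) = \<gamma>'' i"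
          using U(5)[of "\<gamma>' i"] V(5)[of "\<gamma>'' i"] by auto
        with elim show ?case by (simp add: N_def c_def)
      qed
    qed
  qed simp
  show "operator_space_converges G \<sigma> e F"
    unfolding operator_space_converges_def using e in_E base coeff by blast
qed

end

definition continuous_section ::
  "'g::topological_space groupoid_data \<Rightarrow> ('g \<Rightarrow> 'g operator) \<Rightarrow> bool" where
  "continuous_section G T \<longleftrightarrow>
     continuous_map (top_of_set (units G)) (operator_space_topology G) (\<lambda>x. (x, T x))"

end

theory Submission
  imports Defs
begin

text \<open>
  An adjointable operator \<open>S\<close> is recovered from its slices by \<open>(S \<xi>)(\<gamma>) = (T\<^sub>x \<xi>|\<^sub>x)(\<gamma>)\<close>,
  \<open>x = s(\<gamma>)\<close>, so the question is which families \<open>T\<close> this formula turns into operators on the module.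
  Everything rests on lifting a finitely supported vector on a fibre to \<open>C\<^sub>c\<close> without increasing its norm,
  by means of bump functions supported on disjoint bisections.

  Given \<open>S\<close>, applying it to such lifts yields the slices (boundedness is a gliding hump argument)
  and the continuity of the matrix coefficients, while finite separated subsets of a fibre
  have separated neighbourhoods, so quasi-locality passes to finite sections and then to the limit.
  Conversely, for \<open>\<xi>\<close> in \<open>C\<^sub>c\<close> supported on a bisection, the function \<open>\<gamma> \<mapsto> (T\<^sub>x \<xi>|\<^sub>x)(\<gamma>)\<close> is a single matrix
  coefficient times a function of \<open>s(\<gamma>)\<close>, hence continuous; quasi-locality of the family makes it small
  off a compact set, hence an element of the module. The adjoint family satisfies the same
  hypotheses and gives the adjoint.
\<close>

section \<open>Square summable functions on a fibre\<close>

text \<open>\<open>adjointable\<close> demands neither linearity nor boundedness, and a supremum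
  over an unbounded set is unspecified, so \<open>op_norm\<close> and \<open>module_norm\<close> say
  nothing until a bound is at hand. Two devices deal with this. Distances in the module are
  expressed by \<open>fibrewise_close\<close>, a bound fibre by fibre, in which membership in
  \<open>L2 G\<close> becomes approximability by \<open>C\<^sub>c\<close>. And facts about an
  operator S with adjoint A are drawn from the identity
  \<open>S \<xi> \<gamma> = \<langle>A h, \<xi>\<rangle>\<close>, with h a lift of the point mass at
  \<gamma>: it yields homogeneity and dependence on one fibre alone.

  The two equivalences share the construction of S, because both conditions on the family imply
  \<open>small_off_compact\<close>. This condition is symmetric in the two subsets of a fibre, so it
  survives the passage to adjoints with the same compact set K. Compactness of K is used twice: the
  complement of K is open, which gives separated neighbourhoods of points, and the product of K with
  a compact support is compact, which gives the region outside of which functions can be cut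
  off.\<close>

definition square_summable :: "'g groupoid_data \<Rightarrow> 'g \<Rightarrow> ('g \<Rightarrow> complex) \<Rightarrow> bool" where
  "square_summable G x v \<longleftrightarrow> (\<lambda>\<gamma>. (cmod (v \<gamma>))\<^sup>2) summable_on fibre G x"

definition on_set :: "'g set \<Rightarrow> ('g \<Rightarrow> complex) \<Rightarrow> 'g \<Rightarrow> complex" where
  "on_set F v = (\<lambda>\<gamma>. if \<gamma> \<in> F then v \<gamma> else 0)"

lemma fibre_norm_nonneg [simp]: "0 \<le> fibre_norm G x v"
  unfolding fibre_norm_def by (simp add: infsum_nonneg)

text \<open>Finite sections carry the whole norm. With \<open>L2_set_le_fibre_norm\<close> as its
  converse, this transports the triangle inequality of \<open>L2_set\<close> to infinite fibres and
  lets bounds survive pointwise limits (\<open>fibre_norm_limit\<close>).\<close>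

lemma square_summable_boundI:
  assumes "0 \<le> M" "\<And>F. finite F \<Longrightarrow> F \<subseteq> fibre G x \<Longrightarrow> L2_set (\<lambda>\<gamma>. cmod (v \<gamma>)) F \<le> M"
  shows "square_summable G x v" "fibre_norm G x v \<le> M"
proof -
  have *: "(\<Sum>\<gamma>\<in>F. (cmod (v \<gamma>))\<^sup>2) \<le> M\<^sup>2" if "finite F" "F \<subseteq> fibre G x" for F
    using assms(2)[OF that] unfolding L2_set_def by (simp add: real_sqrt_le_iff' assms(1) real_le_lsqrt sum_nonneg sqrt_le_D)
  show s: "square_summable G x v"
    unfolding square_summable_def
    by (rule nonneg_bdd_above_summable_on) (auto intro!: bdd_aboveI[of _ "M\<^sup>2"] *)
  have "(\<Sum>\<^sub>\<infinity>\<gamma>\<in>fibre G x. (cmod (v \<gamma>))\<^sup>2) \<le> M\<^sup>2"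
    using s unfolding square_summable_def by (rule infsum_le_finite_sums) (use * in auto)
  then show "fibre_norm G x v \<le> M"
    unfolding fibre_norm_def by (simp add: assms(1) real_le_lsqrt infsum_nonneg)
qed

lemma L2_set_le_fibre_norm:
  assumes "square_summable G x v" "finite F" "F \<subseteq> fibre G x"
  shows "L2_set (\<lambda>\<gamma>. cmod (v \<gamma>)) F \<le> fibre_norm G x v"
  unfolding L2_set_def fibre_norm_def real_sqrt_le_iff
  using assms unfolding square_summable_def by (intro finite_sum_le_infsum) auto

lemma fibre_norm_mono:
  assumes "square_summable G x w" "\<And>\<gamma>. \<gamma> \<in> fibre G x \<Longrightarrow> cmod (v \<gamma>) \<le> cmod (w \<gamma>)"
  shows "square_summable G x v" "fibre_norm G x v \<le> fibre_norm G x w"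
proof -
  have "L2_set (\<lambda>\<gamma>. cmod (v \<gamma>)) F \<le> fibre_norm G x w" if "finite F" "F \<subseteq> fibre G x" for F
    using L2_set_mono[of F "\<lambda>\<gamma>. cmod (v \<gamma>)" "\<lambda>\<gamma>. cmod (w \<gamma>)"] assms that
      L2_set_le_fibre_norm[OF assms(1) that]
    by (smt (verit) norm_ge_zero subsetD)
  note bound = this
  show "square_summable G x v" by (rule square_summable_boundI(1)[OF fibre_norm_nonneg bound])
  show "fibre_norm G x v \<le> fibre_norm G x w" by (rule square_summable_boundI(2)[OF fibre_norm_nonneg bound])
qed

lemma square_summable_cong:
  assumes "\<And>\<gamma>. \<gamma> \<in> fibre G x \<Longrightarrow> v \<gamma> = w \<gamma>"
  shows "square_summable G x v \<longleftrightarrow> square_summable G x w"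
  unfolding square_summable_def using assms by (intro summable_on_cong) auto

lemma fibre_norm_cong:
  assumes "\<And>\<gamma>. \<gamma> \<in> fibre G x \<Longrightarrow> v \<gamma> = w \<gamma>"
  shows "fibre_norm G x v = fibre_norm G x w"
  unfolding fibre_norm_def using assms by (intro arg_cong[of _ _ sqrt] infsum_cong) auto

lemma fibre_inner_cong:
  assumes "\<And>\<gamma>. \<gamma> \<in> fibre G x \<Longrightarrow> v \<gamma> = v' \<gamma>" "\<And>\<gamma>. \<gamma> \<in> fibre G x \<Longrightarrow> w \<gamma> = w' \<gamma>"
  shows "fibre_inner G x v w = fibre_inner G x v' w'"
  unfolding fibre_inner_def using assms by (intro infsum_cong) auto

lemma square_summable_zero [simp]: "square_summable G x (\<lambda>\<gamma>. 0)"
  by (simp add: square_summable_def)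

lemma fibre_norm_zero [simp]: "fibre_norm G x (\<lambda>\<gamma>. 0) = 0"
  by (simp add: fibre_norm_def)

lemma square_summable_add:
  assumes "square_summable G x v" "square_summable G x w"
  shows "square_summable G x (\<lambda>\<gamma>. v \<gamma> + w \<gamma>)"
    and "fibre_norm G x (\<lambda>\<gamma>. v \<gamma> + w \<gamma>) \<le> fibre_norm G x v + fibre_norm G x w"
proof -
  have "L2_set (\<lambda>\<gamma>. cmod (v \<gamma> + w \<gamma>)) F \<le> fibre_norm G x v + fibre_norm G x w"
    if F: "finite F" "F \<subseteq> fibre G x" for F
  proof -
    have "L2_set (\<lambda>\<gamma>. cmod (v \<gamma> + w \<gamma>)) F \<le> L2_set (\<lambda>\<gamma>. cmod (v \<gamma>) + cmod (w \<gamma>)) F"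
      by (intro L2_set_mono) (auto simp: norm_triangle_ineq)
    also have "\<dots> \<le> L2_set (\<lambda>\<gamma>. cmod (v \<gamma>)) F + L2_set (\<lambda>\<gamma>. cmod (w \<gamma>)) F"
      by (rule L2_set_triangle_ineq)
    also have "\<dots> \<le> fibre_norm G x v + fibre_norm G x w"
      using assms F by (intro add_mono L2_set_le_fibre_norm)
    finally show ?thesis .
  qed
  note bound = this
  have nonneg: "0 \<le> fibre_norm G x v + fibre_norm G x w" by simp
  show "square_summable G x (\<lambda>\<gamma>. v \<gamma> + w \<gamma>)"
    by (rule square_summable_boundI(1)[OF nonneg bound])
  show "fibre_norm G x (\<lambda>\<gamma>. v \<gamma> + w \<gamma>) \<le> fibre_norm G x v + fibre_norm G x w"
    by (rule square_summable_boundI(2)[OF nonneg bound])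
qed

lemma square_summable_scale: "square_summable G x v \<Longrightarrow> square_summable G x (\<lambda>\<gamma>. c * v \<gamma>)"
  unfolding square_summable_def by (auto simp: norm_mult power_mult_distrib summable_on_cmult_right)

lemma fibre_norm_scale: "fibre_norm G x (\<lambda>\<gamma>. c * v \<gamma>) = cmod c * fibre_norm G x v"
  unfolding fibre_norm_def
  by (simp add: norm_mult power_mult_distrib infsum_cmult_right' real_sqrt_mult)

lemma square_summable_diff:
  assumes "square_summable G x v" "square_summable G x w"
  shows "square_summable G x (\<lambda>\<gamma>. v \<gamma> - w \<gamma>)"
    and "fibre_norm G x (\<lambda>\<gamma>. v \<gamma> - w \<gamma>) \<le> fibre_norm G x v + fibre_norm G x w"
  using square_summable_add[OF assms(1) square_summable_scale[OF assms(2), of "-1"]]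
    fibre_norm_scale[of G x "-1" w] by simp_all

lemma cmod_le_fibre_norm:
  assumes "square_summable G x v" "\<gamma> \<in> fibre G x"
  shows "cmod (v \<gamma>) \<le> fibre_norm G x v"
  using L2_set_le_fibre_norm[OF assms(1), of "{\<gamma>}"] assms(2) by simp

lemma square_summable_mult:
  assumes "square_summable G x v" "\<And>\<gamma>. \<gamma> \<in> fibre G x \<Longrightarrow> cmod (f \<gamma>) \<le> c"
  shows "square_summable G x (\<lambda>\<gamma>. f \<gamma> * v \<gamma>)"
    and "0 \<le> c \<Longrightarrow> fibre_norm G x (\<lambda>\<gamma>. f \<gamma> * v \<gamma>) \<le> c * fibre_norm G x v"
proof -
  have *: "cmod (f \<gamma> * v \<gamma>) \<le> cmod (of_real c * v \<gamma>)" if "\<gamma> \<in> fibre G x" for \<gamma>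
    using assms(2)[OF that] order_trans[OF norm_ge_zero assms(2)[OF that]]
    by (simp add: norm_mult mult_right_mono)
  show "square_summable G x (\<lambda>\<gamma>. f \<gamma> * v \<gamma>)"
    by (rule fibre_norm_mono(1)[OF square_summable_scale[OF assms(1), of "of_real c"] *])
  show "fibre_norm G x (\<lambda>\<gamma>. f \<gamma> * v \<gamma>) \<le> c * fibre_norm G x v" if "0 \<le> c"
    using fibre_norm_mono(2)[OF square_summable_scale[OF assms(1), of "of_real c"] *] that
    by (simp add: fibre_norm_scale)
qed

lemma fibre_inner_summable:
  assumes "square_summable G x v" "square_summable G x w"
  shows "(\<lambda>\<gamma>. cnj (v \<gamma>) * w \<gamma>) summable_on fibre G x"
    and "cmod (fibre_inner G x v w) \<le> fibre_norm G x v * fibre_norm G x w"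
proof -
  have *: "(\<Sum>\<gamma>\<in>F. cmod (cnj (v \<gamma>) * w \<gamma>)) \<le> fibre_norm G x v * fibre_norm G x w"
    if F: "finite F" "F \<subseteq> fibre G x" for F
  proof -
    have "(\<Sum>\<gamma>\<in>F. cmod (cnj (v \<gamma>) * w \<gamma>)) = (\<Sum>\<gamma>\<in>F. \<bar>cmod (v \<gamma>)\<bar> * \<bar>cmod (w \<gamma>)\<bar>)"
      by (simp add: norm_mult)
    also have "\<dots> \<le> L2_set (\<lambda>\<gamma>. cmod (v \<gamma>)) F * L2_set (\<lambda>\<gamma>. cmod (w \<gamma>)) F"
      by (rule L2_set_mult_ineq)
    also have "\<dots> \<le> fibre_norm G x v * fibre_norm G x w"
      using assms F by (intro mult_mono L2_set_le_fibre_norm) auto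
    finally show ?thesis .
  qed
  have a: "(\<lambda>\<gamma>. cmod (cnj (v \<gamma>) * w \<gamma>)) summable_on fibre G x"
    by (rule nonneg_bdd_above_summable_on) (auto intro!: bdd_aboveI2 *)
  then show "(\<lambda>\<gamma>. cnj (v \<gamma>) * w \<gamma>) summable_on fibre G x"
    by (rule abs_summable_summable)
  have "cmod (fibre_inner G x v w) \<le> (\<Sum>\<^sub>\<infinity>\<gamma>\<in>fibre G x. cmod (cnj (v \<gamma>) * w \<gamma>))"
    unfolding fibre_inner_def using a by (rule norm_infsum_bound)
  also have "\<dots> \<le> fibre_norm G x v * fibre_norm G x w"
    using a by (rule infsum_le_finite_sums) (rule *)
  finally show "cmod (fibre_inner G x v w) \<le> fibre_norm G x v * fibre_norm G x w" .
qed

section \<open>Inner products and vectors on a fibre\<close>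

lemma fibre_inner_add_right:
  assumes "square_summable G x v" "square_summable G x w" "square_summable G x w'"
  shows "fibre_inner G x v (\<lambda>\<gamma>. w \<gamma> + w' \<gamma>) = fibre_inner G x v w + fibre_inner G x v w'"
  unfolding fibre_inner_def using assms
  by (simp add: distrib_left infsum_add fibre_inner_summable)

lemma fibre_inner_scale_right:
  "fibre_inner G x v (\<lambda>\<gamma>. c * w \<gamma>) = c * fibre_inner G x v w"
  unfolding fibre_inner_def by (simp add: mult.left_commute infsum_cmult_right')

lemma cnj_fibre_inner: "cnj (fibre_inner G x v w) = fibre_inner G x w v"
  unfolding fibre_inner_def infsum_cnj[symmetric] by (simp add: mult.commute)

text \<open>True without summability: an infinite sum without a value is 0 by convention, and taking
  real parts shows that the complex and the real sum fail together. Hence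
  \<open>module_norm_eq\<close> holds for every function.\<close>

lemma fibre_inner_self: "fibre_inner G x v v = of_real ((fibre_norm G x v)\<^sup>2)"
proof -
  have "fibre_inner G x v v = (\<Sum>\<^sub>\<infinity>\<gamma>\<in>fibre G x. complex_of_real ((cmod (v \<gamma>))\<^sup>2))"
    unfolding fibre_inner_def by (intro infsum_cong) (metis complex_norm_square mult.commute)
  also have "\<dots> = of_real (\<Sum>\<^sub>\<infinity>\<gamma>\<in>fibre G x. (cmod (v \<gamma>))\<^sup>2)"
  proof (cases "(\<lambda>\<gamma>. (cmod (v \<gamma>))\<^sup>2) summable_on fibre G x")
    case True
    from has_sum_of_real[OF has_sum_infsum[OF True], where 'a = complex] show ?thesis by (rule infsumI)
  next
    case False
    have "\<not> (\<lambda>\<gamma>. complex_of_real ((cmod (v \<gamma>))\<^sup>2)) summable_on fibre G x"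
    proof
      assume "(\<lambda>\<gamma>. complex_of_real ((cmod (v \<gamma>))\<^sup>2)) summable_on fibre G x"
      from summable_on_Re[OF this] False show False by simp
    qed
    from infsum_not_exists[OF this] infsum_not_exists[OF False] show ?thesis by (simp only: of_real_0)
  qed
  also have "\<dots> = of_real ((fibre_norm G x v)\<^sup>2)"
    by (simp add: fibre_norm_def infsum_nonneg)
  finally show ?thesis .
qed

lemma fibre_inner_delta [simp]: "\<gamma> \<in> fibre G x \<Longrightarrow> fibre_inner G x (delta \<gamma>) w = w \<gamma>"
proof -
  assume "\<gamma> \<in> fibre G x"
  have "fibre_inner G x (delta \<gamma>) w = (\<Sum>\<^sub>\<infinity>\<beta>\<in>{\<gamma>}. w \<beta>)"
    unfolding fibre_inner_def using \<open>\<gamma> \<in> fibre G x\<close>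
    by (intro infsum_cong_neutral) (auto simp: delta_def)
  then show ?thesis by simp
qed

lemma fibre_norm_finite_support:
  assumes "finite F" "F \<subseteq> fibre G x" "\<And>\<gamma>. \<gamma> \<in> fibre G x - F \<Longrightarrow> v \<gamma> = 0"
  shows "square_summable G x v" "fibre_norm G x v = L2_set (\<lambda>\<gamma>. cmod (v \<gamma>)) F"
proof -
  have "((\<lambda>\<gamma>. (cmod (v \<gamma>))\<^sup>2) has_sum (\<Sum>\<gamma>\<in>F. (cmod (v \<gamma>))\<^sup>2)) (fibre G x)"
    using assms by (subst has_sum_cong_neutral[where T = F and g = "\<lambda>\<gamma>. (cmod (v \<gamma>))\<^sup>2"]) auto
  then show "square_summable G x v" "fibre_norm G x v = L2_set (\<lambda>\<gamma>. cmod (v \<gamma>)) F"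
    by (auto simp: square_summable_def fibre_norm_def L2_set_def infsumI has_sum_imp_summable)
qed

lemma fibre_l2_iff: "v \<in> fibre_l2 G x \<longleftrightarrow> (\<forall>\<gamma>. \<gamma> \<notin> fibre G x \<longrightarrow> v \<gamma> = 0) \<and> square_summable G x v"
  by (simp add: fibre_l2_def square_summable_def)

lemma fibre_l2D:
  assumes "v \<in> fibre_l2 G x"
  shows "square_summable G x v" "\<gamma> \<notin> fibre G x \<Longrightarrow> v \<gamma> = 0"
  using assms by (auto simp: fibre_l2_iff)

lemma fibre_l2_add: "v \<in> fibre_l2 G x \<Longrightarrow> w \<in> fibre_l2 G x \<Longrightarrow> (\<lambda>\<gamma>. v \<gamma> + w \<gamma>) \<in> fibre_l2 G x"
  by (auto simp: fibre_l2_iff square_summable_add)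

lemma fibre_l2_scale: "v \<in> fibre_l2 G x \<Longrightarrow> (\<lambda>\<gamma>. c * v \<gamma>) \<in> fibre_l2 G x"
  by (auto simp: fibre_l2_iff square_summable_scale)

lemma fibre_l2_diff: "v \<in> fibre_l2 G x \<Longrightarrow> w \<in> fibre_l2 G x \<Longrightarrow> (\<lambda>\<gamma>. v \<gamma> - w \<gamma>) \<in> fibre_l2 G x"
  by (auto simp: fibre_l2_iff square_summable_diff)

lemma fibre_l2_zero: "(\<lambda>\<gamma>. 0) \<in> fibre_l2 G x"
  by (simp add: fibre_l2_iff)

lemma fibre_l2_mult:
  assumes "v \<in> fibre_l2 G x" "\<And>\<gamma>. cmod (f \<gamma>) \<le> c"
  shows "(\<lambda>\<gamma>. f \<gamma> * v \<gamma>) \<in> fibre_l2 G x"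
  using assms square_summable_mult(1)[of G x v f c] by (auto simp: fibre_l2_iff)

lemma fibre_l2_delta: "\<gamma> \<in> fibre G x \<Longrightarrow> delta \<gamma> \<in> fibre_l2 G x"
  using fibre_norm_finite_support(1)[of "{\<gamma>}" G x "delta \<gamma>"]
  by (auto simp: fibre_l2_iff delta_def indicator_def)

lemma fibre_restrict_l2: "square_summable G x v \<Longrightarrow> fibre_restrict G x v \<in> fibre_l2 G x"
  using square_summable_cong[of G x "fibre_restrict G x v" v]
  by (auto simp: fibre_l2_iff fibre_restrict_def)

lemma fibre_norm_restrict [simp]: "fibre_norm G x (fibre_restrict G x v) = fibre_norm G x v"
  by (rule fibre_norm_cong) (simp add: fibre_restrict_def)

lemma fibre_l2_eqI:
  assumes "v \<in> fibre_l2 G x" "w \<in> fibre_l2 G x" "\<And>\<gamma>. \<gamma> \<in> fibre G x \<Longrightarrow> v \<gamma> = w \<gamma>"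
  shows "v = w"
  using assms by (auto simp: fibre_l2_iff fun_eq_iff) metis

lemma on_set_fibre_l2:
  "finite F \<Longrightarrow> F \<subseteq> fibre G x \<Longrightarrow> on_set F v \<in> fibre_l2 G x"
  using fibre_norm_finite_support(1)[of F G x "on_set F v"]
  by (auto simp: fibre_l2_iff on_set_def)

lemma fibre_norm_on_set:
  assumes "finite F" "F \<subseteq> fibre G x"
  shows "fibre_norm G x (on_set F v) = L2_set (\<lambda>\<gamma>. cmod (v \<gamma>)) F"
  using fibre_norm_finite_support(2)[OF assms, of "on_set F v"]
  by (auto simp: on_set_def cong: L2_set_cong)

lemma fibre_inner_on_set_left:
  assumes "finite F" "F \<subseteq> fibre G x"
  shows "fibre_inner G x (on_set F v) w = (\<Sum>\<gamma>\<in>F. cnj (v \<gamma>) * w \<gamma>)"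
proof -
  have "fibre_inner G x (on_set F v) w = (\<Sum>\<^sub>\<infinity>\<gamma>\<in>F. cnj (v \<gamma>) * w \<gamma>)"
    unfolding fibre_inner_def using assms by (intro infsum_cong_neutral) (auto simp: on_set_def)
  then show ?thesis using assms(1) by simp
qed

lemma fibre_norm_tail_tendsto:
  assumes "square_summable G x v"
  shows "((\<lambda>F. fibre_norm G x (\<lambda>\<gamma>. v \<gamma> - on_set F v \<gamma>)) \<longlongrightarrow> 0) (finite_subsets_at_top (fibre G x))"
proof -
  let ?f = "\<lambda>\<gamma>. (cmod (v \<gamma>))\<^sup>2"
  have s: "?f summable_on fibre G x" using assms by (simp add: square_summable_def)
  have eq: "fibre_norm G x (\<lambda>\<gamma>. v \<gamma> - on_set F v \<gamma>) = sqrt (infsum ?f (fibre G x) - sum ?f F)"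
    if "finite F" "F \<subseteq> fibre G x" for F
  proof -
    have "(\<Sum>\<^sub>\<infinity>\<gamma>\<in>fibre G x. (cmod (v \<gamma> - on_set F v \<gamma>))\<^sup>2) = infsum ?f (fibre G x - F)"
      by (intro infsum_cong_neutral) (auto simp: on_set_def)
    also have "\<dots> = infsum ?f (fibre G x) - sum ?f F"
      using infsum_Diff[OF s _ that(2)] that by simp
    finally show ?thesis by (simp add: fibre_norm_def)
  qed
  have lim: "((\<lambda>F. sqrt (infsum ?f (fibre G x) - sum ?f F)) \<longlongrightarrow> sqrt (infsum ?f (fibre G x) - infsum ?f (fibre G x)))
      (finite_subsets_at_top (fibre G x))"
    by (intro tendsto_real_sqrt tendsto_diff tendsto_const infsum_tendsto s)
  have "\<forall>\<^sub>F F in finite_subsets_at_top (fibre G x).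
      sqrt (infsum ?f (fibre G x) - sum ?f F) = fibre_norm G x (\<lambda>\<gamma>. v \<gamma> - on_set F v \<gamma>)"
    by (rule eventually_finite_subsets_at_top_weakI) (rule eq[symmetric])
  from Lim_transform_eventually[OF lim this] show ?thesis by simp
qed

text \<open>The error of the partial sum over F is \<phi> of the tail of v, hence at most C times a
  tail norm that tends to 0. Applied to the entries of \<open>S v\<close> it gives matrix
  multiplication; applied to the pairing with a fixed vector it gives the adjoint relation.\<close>

lemma bounded_functional_has_sum:
  assumes add: "\<And>v w. v \<in> fibre_l2 G x \<Longrightarrow> w \<in> fibre_l2 G x \<Longrightarrow> \<phi> (\<lambda>\<gamma>. v \<gamma> + w \<gamma>) = \<phi> v + \<phi> w"
    and scale: "\<And>c v. v \<in> fibre_l2 G x \<Longrightarrow> \<phi> (\<lambda>\<gamma>. c * v \<gamma>) = c * \<phi> v"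
    and bound: "\<And>v. v \<in> fibre_l2 G x \<Longrightarrow> cmod (\<phi> v) \<le> C * fibre_norm G x v"
    and v: "v \<in> fibre_l2 G x"
  shows "((\<lambda>\<beta>. \<phi> (delta \<beta>) * v \<beta>) has_sum \<phi> v) (fibre G x)"
proof -
  have fin: "\<phi> (on_set F v) = (\<Sum>\<beta>\<in>F. \<phi> (delta \<beta>) * v \<beta>)" if "finite F" "F \<subseteq> fibre G x" for F
    using that
  proof (induction F)
    case empty
    show ?case using scale[OF fibre_l2_zero, of 0] by (simp add: on_set_def)
  next
    case (insert \<beta> F)
    have "on_set (insert \<beta> F) v = (\<lambda>\<gamma>. v \<beta> * delta \<beta> \<gamma> + on_set F v \<gamma>)"
      using insert.hyps by (auto simp: on_set_def delta_def indicator_def)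
    then show ?case
      using insert by (simp add: add scale fibre_l2_delta fibre_l2_scale on_set_fibre_l2)
  qed
  have diff: "cmod (\<phi> v - (\<Sum>\<beta>\<in>F. \<phi> (delta \<beta>) * v \<beta>)) \<le> C * fibre_norm G x (\<lambda>\<gamma>. v \<gamma> - on_set F v \<gamma>)"
    if F: "finite F" "F \<subseteq> fibre G x" for F
  proof -
    have t: "on_set F v \<in> fibre_l2 G x" using F by (rule on_set_fibre_l2)
    have "\<phi> v = \<phi> (\<lambda>\<gamma>. (v \<gamma> - on_set F v \<gamma>) + on_set F v \<gamma>)" by simp
    also have "\<dots> = \<phi> (\<lambda>\<gamma>. v \<gamma> - on_set F v \<gamma>) + \<phi> (on_set F v)"
      using v t by (intro add fibre_l2_diff)
    finally have "\<phi> v - (\<Sum>\<beta>\<in>F. \<phi> (delta \<beta>) * v \<beta>) = \<phi> (\<lambda>\<gamma>. v \<gamma> - on_set F v \<gamma>)"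
      by (simp add: fin[OF F])
    then show ?thesis using bound fibre_l2_diff[OF v t] by simp
  qed
  have "((\<lambda>F. C * fibre_norm G x (\<lambda>\<gamma>. v \<gamma> - on_set F v \<gamma>)) \<longlongrightarrow> C * 0) (finite_subsets_at_top (fibre G x))"
    by (intro tendsto_mult_left fibre_norm_tail_tendsto fibre_l2D(1)[OF v])
  then have lim: "((\<lambda>F. C * fibre_norm G x (\<lambda>\<gamma>. v \<gamma> - on_set F v \<gamma>)) \<longlongrightarrow> 0) (finite_subsets_at_top (fibre G x))"
    by simp
  have ev: "\<forall>\<^sub>F F in finite_subsets_at_top (fibre G x).
      cmod (\<phi> v - (\<Sum>\<beta>\<in>F. \<phi> (delta \<beta>) * v \<beta>)) \<le> C * fibre_norm G x (\<lambda>\<gamma>. v \<gamma> - on_set F v \<gamma>)"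
    by (rule eventually_finite_subsets_at_top_weakI) (rule diff)
  have "((\<lambda>F. \<phi> v - (\<Sum>\<beta>\<in>F. \<phi> (delta \<beta>) * v \<beta>)) \<longlongrightarrow> 0) (finite_subsets_at_top (fibre G x))"
    by (rule Lim_null_comparison[OF ev lim])
  from tendsto_diff[OF tendsto_const[of "\<phi> v"] this] show ?thesis by (simp add: has_sum_def)
qed

section \<open>Bounded operators on a fibre, their matrices and adjoints\<close>

lemma fibre_operatorsD:
  assumes "S \<in> fibre_operators G x"
  shows "v \<in> fibre_l2 G x \<Longrightarrow> S v \<in> fibre_l2 G x"
    and "v \<in> fibre_l2 G x \<Longrightarrow> w \<in> fibre_l2 G x \<Longrightarrow> S (\<lambda>\<gamma>. v \<gamma> + w \<gamma>) = (\<lambda>\<gamma>. S v \<gamma> + S w \<gamma>)"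
    and "v \<in> fibre_l2 G x \<Longrightarrow> S (\<lambda>\<gamma>. c * v \<gamma>) = (\<lambda>\<gamma>. c * S v \<gamma>)"
    and "v \<notin> fibre_l2 G x \<Longrightarrow> S v = undefined"
    and "\<exists>C. \<forall>v\<in>fibre_l2 G x. fibre_norm G x (S v) \<le> C * fibre_norm G x v"
  using assms unfolding fibre_operators_def by (auto dest: PiE_arb)

text \<open>Stated for homogeneous maps, since
  \<open>mult_comp (indicator A) S (indicator B)\<close> is in general not extensional and so lies
  outside \<open>fibre_operators\<close>. The crude constant C only ensures that the supremum in
  \<open>fibre_op_norm\<close> is that of a bounded set.\<close>

lemma homogeneous_norm_bound:
  assumes hom: "\<And>c v. v \<in> fibre_l2 G x \<Longrightarrow> S (\<lambda>\<gamma>. c * v \<gamma>) = (\<lambda>\<gamma>. c * S v \<gamma>)"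
    and C: "\<And>v. v \<in> fibre_l2 G x \<Longrightarrow> fibre_norm G x (S v) \<le> C * fibre_norm G x v"
    and v: "v \<in> fibre_l2 G x"
  shows "fibre_norm G x (S v) \<le> fibre_op_norm G x S * fibre_norm G x v"
proof -
  have bdd: "bdd_above ((\<lambda>v. fibre_norm G x (S v)) ` {v \<in> fibre_l2 G x. fibre_norm G x v \<le> 1})"
  proof (rule bdd_aboveI2[of _ _ "\<bar>C\<bar>"])
    fix v assume "v \<in> {v \<in> fibre_l2 G x. fibre_norm G x v \<le> 1}"
    then have v: "v \<in> fibre_l2 G x" "fibre_norm G x v \<le> 1" by auto
    have "fibre_norm G x (S v) \<le> C * fibre_norm G x v" by (rule C[OF v(1)])
    also have "\<dots> \<le> \<bar>C\<bar> * fibre_norm G x v" by (intro mult_right_mono) auto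
    also have "\<dots> \<le> \<bar>C\<bar> * 1" using v(2) by (intro mult_left_mono) auto
    finally show "fibre_norm G x (S v) \<le> \<bar>C\<bar>" by simp
  qed
  have le: "fibre_norm G x (S u) \<le> fibre_op_norm G x S"
    if "u \<in> fibre_l2 G x" "fibre_norm G x u \<le> 1" for u
    unfolding fibre_op_norm_def op_norm_def by (rule cSUP_upper[OF _ bdd]) (use that in auto)
  show ?thesis
  proof (cases "fibre_norm G x v = 0")
    case True
    then show ?thesis using C[OF v] by simp
  next
    case False
    define c where "c = complex_of_real (inverse (fibre_norm G x v))"
    have c: "cmod c = inverse (fibre_norm G x v)" by (simp add: c_def norm_inverse)
    have "inverse (fibre_norm G x v) * fibre_norm G x (S v) \<le> fibre_op_norm G x S"
      using le[OF fibre_l2_scale[OF v, of c]] hom[OF v, of c] False by (simp add: fibre_norm_scale c)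
    then show ?thesis using False by (simp add: field_simps order_less_le)
  qed
qed

lemma operator_norm_bound:
  assumes S: "S \<in> fibre_operators G x" and v: "v \<in> fibre_l2 G x"
  shows "fibre_norm G x (S v) \<le> fibre_op_norm G x S * fibre_norm G x v"
proof -
  obtain C where "\<And>v. v \<in> fibre_l2 G x \<Longrightarrow> fibre_norm G x (S v) \<le> C * fibre_norm G x v"
    using fibre_operatorsD(5)[OF S] by blast
  from homogeneous_norm_bound[OF fibre_operatorsD(3)[OF S] this v] show ?thesis .
qed

lemma op_norm_le:
  assumes "V0 \<in> V" "N V0 \<le> 1" "\<And>v. v \<in> V \<Longrightarrow> N v \<le> 1 \<Longrightarrow> N (S v) \<le> c"
  shows "op_norm N V S \<le> c"
  unfolding op_norm_def using assms by (intro cSUP_least) auto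

lemma operator_matrix_has_sum:
  assumes S: "S \<in> fibre_operators G x" and v: "v \<in> fibre_l2 G x" and \<gamma>: "\<gamma> \<in> fibre G x"
  shows "((\<lambda>\<beta>. S (delta \<beta>) \<gamma> * v \<beta>) has_sum S v \<gamma>) (fibre G x)"
proof (rule bounded_functional_has_sum[where \<phi> = "\<lambda>v. S v \<gamma>", OF _ _ _ v])
  fix w assume w: "w \<in> fibre_l2 G x"
  then have "S w \<in> fibre_l2 G x" by (rule fibre_operatorsD(1)[OF S])
  then show "cmod (S w \<gamma>) \<le> fibre_op_norm G x S * fibre_norm G x w"
    using cmod_le_fibre_norm[OF fibre_l2D(1) \<gamma>, of "S w"] operator_norm_bound[OF S w] by simp
qed (simp_all add: fibre_operatorsD[OF S])

lemma fibre_operators_eqI: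
  assumes S: "S \<in> fibre_operators G x" and R: "R \<in> fibre_operators G x"
    and eq: "\<And>\<beta> \<gamma>. \<beta> \<in> fibre G x \<Longrightarrow> \<gamma> \<in> fibre G x \<Longrightarrow> S (delta \<beta>) \<gamma> = R (delta \<beta>) \<gamma>"
  shows "S = R"
proof
  fix v
  show "S v = R v"
  proof (cases "v \<in> fibre_l2 G x")
    case True
    show ?thesis
    proof (rule fibre_l2_eqI)
      show "S v \<in> fibre_l2 G x" "R v \<in> fibre_l2 G x"
        by (simp_all add: fibre_operatorsD(1)[OF S] fibre_operatorsD(1)[OF R] True)
      fix \<gamma> assume \<gamma>: "\<gamma> \<in> fibre G x"
      have "((\<lambda>\<beta>. S (delta \<beta>) \<gamma> * v \<beta>) has_sum R v \<gamma>) (fibre G x)"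
        using operator_matrix_has_sum[OF R True \<gamma>] eq \<gamma> by (subst has_sum_cong) auto
      then show "S v \<gamma> = R v \<gamma>"
        using operator_matrix_has_sum[OF S True \<gamma>] has_sum_unique by blast
    qed
  next
    case False
    then show ?thesis by (simp add: fibre_operatorsD(4)[OF S] fibre_operatorsD(4)[OF R])
  qed
qed

text \<open>Testing against the truncation of \<open>f\<close> to \<open>F\<close> bounds that truncation itself.\<close>

lemma fibre_norm_le_by_duality:
  assumes "0 \<le> M"
    and "\<And>F. finite F \<Longrightarrow> F \<subseteq> fibre G x \<Longrightarrow>
           cmod (fibre_inner G x (on_set F f) f) \<le> M * fibre_norm G x (on_set F f)"
  shows "square_summable G x f" "fibre_norm G x f \<le> M"
proof -
  have "L2_set (\<lambda>\<gamma>. cmod (f \<gamma>)) F \<le> M" if F: "finite F" "F \<subseteq> fibre G x" for F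
  proof -
    let ?n = "L2_set (\<lambda>\<gamma>. cmod (f \<gamma>)) F"
    have "fibre_inner G x (on_set F f) f = fibre_inner G x (on_set F f) (on_set F f)"
      unfolding fibre_inner_def by (intro infsum_cong) (auto simp: on_set_def)
    then have "cmod (fibre_inner G x (on_set F f) f) = ?n\<^sup>2"
      by (simp add: fibre_inner_self fibre_norm_on_set[OF F] norm_power)
    then have "?n * ?n \<le> M * ?n"
      using assms(2)[OF F] by (simp add: fibre_norm_on_set[OF F] power2_eq_square)
    then show ?thesis using assms(1) L2_set_nonneg[of "\<lambda>\<gamma>. cmod (f \<gamma>)" F]
      by (metis mult_le_cancel_right order_le_less not_le)
  qed
  note bound = this
  show "square_summable G x f" by (rule square_summable_boundI(1)[OF assms(1) bound])
  show "fibre_norm G x f \<le> M" by (rule square_summable_boundI(2)[OF assms(1) bound])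
qed

text \<open>The entry at \<gamma> is the only value compatible with the adjoint relation tested on
  \<open>delta \<gamma>\<close>, so the adjoint can be written down without a representation
  theorem.\<close>

definition operator_adjoint :: "'g groupoid_data \<Rightarrow> 'g \<Rightarrow> 'g operator \<Rightarrow> 'g operator" where
  "operator_adjoint G x S = (\<lambda>w\<in>fibre_l2 G x. \<lambda>\<gamma>. if \<gamma> \<in> fibre G x then fibre_inner G x (S (delta \<gamma>)) w else 0)"

text \<open>The adjoint relation comes first, as an identity of infinite sums: expanding
  \<open>\<langle>w, S v\<rangle>\<close> over point masses uses only the boundedness of S. Square
  summability of the values of the adjoint then follows by duality, testing them against their own
  truncations.\<close>

lemma operator_adjoint:
  assumes S: "S \<in> fibre_operators G x"
  shows operator_adjoint_in: "operator_adjoint G x S \<in> fibre_operators G x"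
    and operator_adjoint_bound: "w \<in> fibre_l2 G x \<Longrightarrow> fibre_norm G x (operator_adjoint G x S w) \<le> fibre_op_norm G x S * fibre_norm G x w"
    and operator_adjoint_inner: "\<lbrakk>v \<in> fibre_l2 G x; w \<in> fibre_l2 G x\<rbrakk> \<Longrightarrow>
        fibre_inner G x (S v) w = fibre_inner G x v (operator_adjoint G x S w)"
proof -
  have Sl: "S v \<in> fibre_l2 G x" if "v \<in> fibre_l2 G x" for v
    by (rule fibre_operatorsD(1)[OF S that])
  have nn: "0 \<le> fibre_op_norm G x S * fibre_norm G x w" if "w \<in> fibre_l2 G x" for w
    by (rule order_trans[OF fibre_norm_nonneg operator_norm_bound[OF S that]])
  have adj: "operator_adjoint G x S w \<gamma> = (if \<gamma> \<in> fibre G x then fibre_inner G x (S (delta \<gamma>)) w else 0)"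
    if "w \<in> fibre_l2 G x" for w \<gamma> using that by (simp add: operator_adjoint_def)
  have inner: "fibre_inner G x (S v) w = fibre_inner G x v (operator_adjoint G x S w)"
    if v: "v \<in> fibre_l2 G x" and w: "w \<in> fibre_l2 G x" for v w
  proof -
    have "((\<lambda>\<beta>. fibre_inner G x w (S (delta \<beta>)) * v \<beta>) has_sum fibre_inner G x w (S v)) (fibre G x)"
    proof (rule bounded_functional_has_sum[where \<phi> = "\<lambda>v. fibre_inner G x w (S v)", OF _ _ _ v])
      fix u u' c assume u: "u \<in> fibre_l2 G x" "u' \<in> fibre_l2 G x"
      show "fibre_inner G x w (S (\<lambda>\<gamma>. u \<gamma> + u' \<gamma>)) = fibre_inner G x w (S u) + fibre_inner G x w (S u')"
        by (simp add: fibre_operatorsD(2)[OF S u] fibre_inner_add_right fibre_l2D(1) u w Sl)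
    next
      fix u c assume u: "u \<in> fibre_l2 G x"
      show "fibre_inner G x w (S (\<lambda>\<gamma>. c * u \<gamma>)) = c * fibre_inner G x w (S u)"
        by (simp add: fibre_operatorsD(3)[OF S u] fibre_inner_scale_right)
      have "cmod (fibre_inner G x w (S u)) \<le> fibre_norm G x w * fibre_norm G x (S u)"
        using w Sl[OF u] by (intro fibre_inner_summable fibre_l2D(1))
      also have "\<dots> \<le> fibre_norm G x w * (fibre_op_norm G x S * fibre_norm G x u)"
        by (intro mult_left_mono operator_norm_bound[OF S u]) auto
      finally show "cmod (fibre_inner G x w (S u)) \<le> (fibre_norm G x w * fibre_op_norm G x S) * fibre_norm G x u"
        by (simp add: mult.assoc)
    qed
    then have "((\<lambda>\<beta>. cnj (fibre_inner G x w (S (delta \<beta>)) * v \<beta>)) has_sum cnj (fibre_inner G x w (S v))) (fibre G x)"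
      by (simp only: has_sum_cnj_iff)
    then have "((\<lambda>\<beta>. cnj (v \<beta>) * operator_adjoint G x S w \<beta>) has_sum fibre_inner G x (S v) w) (fibre G x)"
      by (subst has_sum_cong[where g = "\<lambda>\<beta>. cnj (fibre_inner G x w (S (delta \<beta>)) * v \<beta>)"])
         (auto simp: adj[OF w] cnj_fibre_inner)
    then show ?thesis by (simp add: fibre_inner_def[of G x v] infsumI)
  qed
  have b: "square_summable G x (operator_adjoint G x S w) \<and>
      fibre_norm G x (operator_adjoint G x S w) \<le> fibre_op_norm G x S * fibre_norm G x w"
    if w: "w \<in> fibre_l2 G x" for w
  proof -
    let ?f = "operator_adjoint G x S w"
    have "cmod (fibre_inner G x (on_set F ?f) ?f) \<le> (fibre_op_norm G x S * fibre_norm G x w) * fibre_norm G x (on_set F ?f)"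
      if F: "finite F" "F \<subseteq> fibre G x" for F
    proof -
      have u: "on_set F ?f \<in> fibre_l2 G x" by (rule on_set_fibre_l2[OF F])
      have "cmod (fibre_inner G x (on_set F ?f) ?f) = cmod (fibre_inner G x (S (on_set F ?f)) w)"
        using inner[OF u w] by simp
      also have "\<dots> \<le> fibre_norm G x (S (on_set F ?f)) * fibre_norm G x w"
        using w Sl[OF u] by (intro fibre_inner_summable fibre_l2D(1))
      also have "\<dots> \<le> (fibre_op_norm G x S * fibre_norm G x (on_set F ?f)) * fibre_norm G x w"
        by (intro mult_right_mono operator_norm_bound[OF S u]) auto
      finally show ?thesis by (simp add: mult_ac)
    qed
    from fibre_norm_le_by_duality[OF nn[OF w] this] show ?thesis by blast
  qed
  show "w \<in> fibre_l2 G x \<Longrightarrow> fibre_norm G x (operator_adjoint G x S w) \<le> fibre_op_norm G x S * fibre_norm G x w"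
    using b by blast
  show "\<lbrakk>v \<in> fibre_l2 G x; w \<in> fibre_l2 G x\<rbrakk> \<Longrightarrow>
        fibre_inner G x (S v) w = fibre_inner G x v (operator_adjoint G x S w)"
    by (rule inner)
  have 1: "operator_adjoint G x S \<in> fibre_l2 G x \<rightarrow>\<^sub>E fibre_l2 G x"
  proof (rule PiE_I)
    fix w assume w: "w \<in> fibre_l2 G x"
    then show "operator_adjoint G x S w \<in> fibre_l2 G x"
      using b[OF w] by (simp add: fibre_l2_iff[of "operator_adjoint G x S w"] adj)
  qed (simp add: operator_adjoint_def)
  have 2: "operator_adjoint G x S (\<lambda>\<gamma>. v \<gamma> + w \<gamma>) = (\<lambda>\<gamma>. operator_adjoint G x S v \<gamma> + operator_adjoint G x S w \<gamma>)"
    if "v \<in> fibre_l2 G x" "w \<in> fibre_l2 G x" for v w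
    using that Sl by (auto simp: adj fibre_l2_add fibre_inner_add_right fibre_l2_delta fibre_l2D(1))
  have 3: "operator_adjoint G x S (\<lambda>\<gamma>. c * v \<gamma>) = (\<lambda>\<gamma>. c * operator_adjoint G x S v \<gamma>)"
    if "v \<in> fibre_l2 G x" for v c
    using that by (auto simp: adj fibre_l2_scale fibre_inner_scale_right)
  have 4: "\<exists>C. \<forall>w\<in>fibre_l2 G x. fibre_norm G x (operator_adjoint G x S w) \<le> C * fibre_norm G x w"
    by (rule exI[of _ "fibre_op_norm G x S"]) (simp add: b)
  show "operator_adjoint G x S \<in> fibre_operators G x"
    unfolding fibre_operators_def mem_Collect_eq
    by (intro conjI 1 4 ballI allI) (simp_all add: 2 3 del: restrict_apply)
qed

section \<open>Bump functions and bisections\<close>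

lemma finite_disjoint_open:
  fixes F :: "'a::t2_space set"
  assumes "finite F"
  obtains U where "\<And>a. a \<in> F \<Longrightarrow> open (U a)" "\<And>a. a \<in> F \<Longrightarrow> a \<in> U a"
    "\<And>a b. a \<in> F \<Longrightarrow> b \<in> F \<Longrightarrow> a \<noteq> b \<Longrightarrow> U a \<inter> U b = {}"
proof -
  have "\<exists>P Q. a \<noteq> b \<longrightarrow> open P \<and> open Q \<and> a \<in> P \<and> b \<in> Q \<and> P \<inter> Q = {}" for a b :: 'a
    using hausdorff[of a b] by (cases "a = b") simp_all
  then obtain P Q where "\<forall>a b :: 'a. a \<noteq> b \<longrightarrow> open (P a b) \<and> open (Q a b) \<and> a \<in> P a b \<and> b \<in> Q a b \<and> P a b \<inter> Q a b = {}"
    by metis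
  then have PQ: "\<And>a b :: 'a. a \<noteq> b \<Longrightarrow> open (P a b) \<and> open (Q a b) \<and> a \<in> P a b \<and> b \<in> Q a b \<and> P a b \<inter> Q a b = {}"
    by blast
  \<comment> \<open>P and Q are chosen for ordered pairs. Each point takes both roles, so that for a
    \<noteq> b the set at a lies in \<open>P a b\<close> and the set at b in
    \<open>Q a b\<close>.\<close>
  define U where "U a = (\<Inter>b\<in>F - {a}. P a b \<inter> Q b a)" for a
  show thesis
  proof
    show "open (U a)" if "a \<in> F" for a
      unfolding U_def
    proof (intro open_INT ballI open_Int)
      fix b assume "b \<in> F - {a}"
      then have "a \<noteq> b" "b \<noteq> a" by auto
      then show "open (P a b)" "open (Q b a)" by (simp_all add: PQ)
    qed (simp add: assms)
    show "a \<in> U a" if "a \<in> F" for a unfolding U_def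
    proof (intro INT_I IntI)
      fix b assume "b \<in> F - {a}"
      then have "a \<noteq> b" "b \<noteq> a" by auto
      then show "a \<in> P a b" "a \<in> Q b a" by (simp_all add: PQ)
    qed
    show "U a \<inter> U b = {}" if ab: "a \<in> F" "b \<in> F" "a \<noteq> b" for a b
    proof -
      have "U a \<subseteq> P a b" "U b \<subseteq> Q a b" using ab by (auto simp: U_def)
      then show ?thesis using PQ[OF ab(3)] by blast
    qed
  qed
qed

section \<open>Continuous functions with compact support\<close>

lemma supp_subsetI: "closed C \<Longrightarrow> (\<And>\<gamma>. f \<gamma> \<noteq> 0 \<Longrightarrow> \<gamma> \<in> C) \<Longrightarrow> supp f \<subseteq> C"
  unfolding supp_def by (intro closure_minimal) auto

lemma not_in_supp: "\<gamma> \<notin> supp f \<Longrightarrow> f \<gamma> = 0"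
  unfolding supp_def using closure_subset[of "{\<gamma>. f \<gamma> \<noteq> 0}"] by auto

lemma closed_supp [simp]: "closed (supp f)"
  by (simp add: supp_def)

lemma cont_compact_suppI:
  fixes C :: "'g::t2_space set"
  assumes "continuous_on UNIV f" "compact C" "\<And>\<gamma>. f \<gamma> \<noteq> 0 \<Longrightarrow> \<gamma> \<in> C"
  shows "f \<in> cont_compact_supp"
proof -
  have "supp f \<subseteq> C" using assms(2,3) compact_imp_closed by (intro supp_subsetI) auto
  then have "C \<inter> supp f = supp f" by blast
  then have "compact (supp f)" using compact_Int_closed[OF assms(2) closed_supp[of f]] by simp
  then show ?thesis using assms(1) by (simp add: cont_compact_supp_def)
qed

lemma cont_compact_supp_zero: "(\<lambda>\<gamma>. 0) \<in> cont_compact_supp"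
  by (simp add: cont_compact_supp_def supp_def)

lemma cont_compact_supp_add:
  fixes u v :: "'g::t2_space \<Rightarrow> complex"
  assumes "u \<in> cont_compact_supp" "v \<in> cont_compact_supp"
  shows "(\<lambda>\<gamma>. u \<gamma> + v \<gamma>) \<in> cont_compact_supp"
proof (rule cont_compact_suppI[of _ "supp u \<union> supp v"])
  show "continuous_on UNIV (\<lambda>\<gamma>. u \<gamma> + v \<gamma>)"
    using assms by (auto simp: cont_compact_supp_def intro: continuous_on_add)
  show "compact (supp u \<union> supp v)" using assms by (auto simp: cont_compact_supp_def)
  show "\<gamma> \<in> supp u \<union> supp v" if "u \<gamma> + v \<gamma> \<noteq> 0" for \<gamma>
    using that not_in_supp[of \<gamma> u] not_in_supp[of \<gamma> v] by (cases "\<gamma> \<in> supp u") auto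
qed

lemma cont_compact_supp_mult:
  fixes u :: "'g::t2_space \<Rightarrow> complex"
  assumes "u \<in> cont_compact_supp" "continuous_on UNIV f"
  shows "(\<lambda>\<gamma>. f \<gamma> * u \<gamma>) \<in> cont_compact_supp"
proof (rule cont_compact_suppI[of _ "supp u"])
  show "continuous_on UNIV (\<lambda>\<gamma>. f \<gamma> * u \<gamma>)"
    using assms by (auto simp: cont_compact_supp_def intro: continuous_on_mult)
  show "compact (supp u)" using assms by (auto simp: cont_compact_supp_def)
  show "\<gamma> \<in> supp u" if "f \<gamma> * u \<gamma> \<noteq> 0" for \<gamma>
    using that not_in_supp[of \<gamma> u] by auto
qed

lemma cont_compact_supp_scale:
  fixes u :: "'g::t2_space \<Rightarrow> complex"
  shows "u \<in> cont_compact_supp \<Longrightarrow> (\<lambda>\<gamma>. c * u \<gamma>) \<in> cont_compact_supp"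
  by (rule cont_compact_supp_mult) auto

lemma cont_compact_supp_diff:
  fixes u v :: "'g::t2_space \<Rightarrow> complex"
  assumes "u \<in> cont_compact_supp" "v \<in> cont_compact_supp"
  shows "(\<lambda>\<gamma>. u \<gamma> - v \<gamma>) \<in> cont_compact_supp"
  using cont_compact_supp_add[OF assms(1) cont_compact_supp_scale[OF assms(2), of "-1"]] by simp

lemma cont_compact_supp_sum:
  fixes u :: "'i \<Rightarrow> 'g::t2_space \<Rightarrow> complex"
  assumes "\<And>i. i \<in> I \<Longrightarrow> u i \<in> cont_compact_supp"
  shows "(\<lambda>\<gamma>. \<Sum>i\<in>I. u i \<gamma>) \<in> cont_compact_supp"
  using assms by (induction I rule: infinite_finite_induct)
    (auto simp: cont_compact_supp_zero intro!: cont_compact_supp_add)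

lemma cont_compact_supp_bounded:
  fixes u :: "'g::t2_space \<Rightarrow> complex"
  assumes "u \<in> cont_compact_supp"
  obtains B where "0 \<le> B" "\<And>\<gamma>. cmod (u \<gamma>) \<le> B"
proof -
  have "compact (u ` supp u)"
    using assms by (intro compact_continuous_image) (auto simp: cont_compact_supp_def intro: continuous_on_subset)
  then obtain B where B: "\<And>z. z \<in> u ` supp u \<Longrightarrow> cmod z \<le> B"
    using compact_imp_bounded bounded_iff by metis
  show thesis
  proof
    show "0 \<le> \<bar>B\<bar>" by simp
    show "cmod (u \<gamma>) \<le> \<bar>B\<bar>" for \<gamma>
      using B[of "u \<gamma>"] not_in_supp[of \<gamma> u] by (cases "\<gamma> \<in> supp u") auto
  qed
qed

context lc_etale_groupoid
begin

lemma inv_inv: "ginv G (ginv G \<gamma>) = \<gamma>"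
  by (metis inv_mul mul_assoc rng_inv rng_mul_left src_inv src_mul_right)

lemma continuous_rng: "continuous_on UNIV (grng G)"
proof -
  have "continuous_on UNIV (\<lambda>\<gamma>. gsrc G (ginv G \<gamma>))"
    by (rule continuous_on_compose2[OF continuous_src continuous_inv]) simp
  then show ?thesis by (simp add: src_inv)
qed

lemma src_in_units [simp]: "gsrc G \<gamma> \<in> units G"
  by (simp add: units_def)

lemma fibre_not_unit: "x \<notin> units G \<Longrightarrow> fibre G x = {}"
  by (auto simp: fibre_def units_def)

lemma in_fibre_src [simp]: "\<gamma> \<in> fibre G (gsrc G \<gamma>)"
  by (simp add: fibre_def)

text \<open>A Urysohn function that vanishes off U may have a support that reaches the boundary of
  U, and may be 1 on K only. Rescaling it puts the support inside U and makes it 1 on a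
  neighbourhood W of K; then a function multiplied by \<open>1 - h\<close> has its support away from
  K.\<close>

lemma bump_function:
  assumes "compact K" "open U" "K \<subseteq> U"
  obtains h :: "'g \<Rightarrow> complex" and W where "h \<in> cont_compact_supp" "supp h \<subseteq> U"
    "\<And>\<gamma>. cmod (h \<gamma>) \<le> 1" "\<And>\<gamma>. cmod (1 - h \<gamma>) \<le> 1"
    "open W" "K \<subseteq> W" "\<And>\<gamma>. \<gamma> \<in> W \<Longrightarrow> h \<gamma> = 1"
proof -
  let ?X = "euclidean :: 'g topology"
  have H: "Hausdorff_space ?X"
    unfolding Hausdorff_space_def disjnt_def using hausdorff by fastforce
  have R: "regular_space ?X" using locally_compact H by (rule locally_compact_Hausdorff_imp_regular_space)
  have CR: "completely_regular_space ?X"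
    using locally_compact R completely_regular_eq_regular_space by blast
  \<comment> \<open>L is there to make the support compact: the support will be contained in V,
    hence in L.\<close>
  obtain V L where V: "open V" "compact L" "closed L" "K \<subseteq> V" "V \<subseteq> L"
    using locally_compact_space_compact_closed_compact[of ?X] H locally_compact assms(1) by auto
  obtain k :: "'g \<Rightarrow> real" where k: "continuous_map ?X (top_of_set {0..1}) k"
    "k ` (- (U \<inter> V)) \<subseteq> {0}" "k ` K \<subseteq> {1}"
    by (rule Urysohn_completely_regular_compact_closed[of 0 1 ?X K "- (U \<inter> V)"])
       (use CR assms V in \<open>auto simp: disjnt_def\<close>)
  have kc: "continuous_on UNIV k" using k(1) by (simp add: continuous_map_in_subtopology)
  \<comment> \<open>Nonzero only where k > 1/3, so the support is within the closed set where k
    \<ge> 1/3, which still lies in U; equal to 1 on the open set where k > 2/3.\<close>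
  define h where "h \<gamma> = complex_of_real (min 1 (max 0 (3 * k \<gamma> - 1)))" for \<gamma>
  have hc: "continuous_on UNIV h"
    unfolding h_def by (intro continuous_intros kc)
  have cl: "closed {\<gamma>. 1/3 \<le> k \<gamma>}" by (intro closed_Collect_le continuous_intros kc)
  have sub: "{\<gamma>. 1/3 \<le> k \<gamma>} \<subseteq> U \<inter> V"
  proof
    fix \<gamma> assume "\<gamma> \<in> {\<gamma>. 1/3 \<le> k \<gamma>}"
    then show "\<gamma> \<in> U \<inter> V" using k(2) by (cases "\<gamma> \<in> U \<inter> V") auto
  qed
  have cpt: "compact {\<gamma>. 1/3 \<le> k \<gamma>}"
  proof -
    have "L \<inter> {\<gamma>. 1/3 \<le> k \<gamma>} = {\<gamma>. 1/3 \<le> k \<gamma>}" using sub V(5) by auto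
    then show ?thesis using compact_Int_closed[OF V(2) cl] by simp
  qed
  have nz: "\<gamma> \<in> {\<gamma>. 1/3 \<le> k \<gamma>}" if "h \<gamma> \<noteq> 0" for \<gamma>
    using that by (auto simp: h_def)
  show thesis
  proof
    show "h \<in> cont_compact_supp" by (rule cont_compact_suppI[OF hc cpt nz])
    show "supp h \<subseteq> U" using supp_subsetI[OF cl nz] sub by blast
    show "cmod (h \<gamma>) \<le> 1" for \<gamma> by (simp add: h_def)
    have "1 - h \<gamma> = complex_of_real (1 - min 1 (max 0 (3 * k \<gamma> - 1)))" for \<gamma>
      by (simp only: h_def of_real_diff of_real_1)
    then have "cmod (1 - h \<gamma>) = \<bar>1 - min 1 (max 0 (3 * k \<gamma> - 1))\<bar>" for \<gamma>
      by (simp only: norm_of_real)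
    then show "cmod (1 - h \<gamma>) \<le> 1" for \<gamma> by simp
    show "open {\<gamma>. 2/3 < k \<gamma>}" by (intro open_Collect_less continuous_intros kc)
    show "K \<subseteq> {\<gamma>. 2/3 < k \<gamma>}" using k(3) by auto
    show "h \<gamma> = 1" if "\<gamma> \<in> {\<gamma>. 2/3 < k \<gamma>}" for \<gamma> using that by (simp add: h_def)
  qed
qed

lemma bisection:
  obtains U where "open U" "\<gamma> \<in> U" "inj_on (gsrc G) U"
  using src_local_section[of \<gamma>] by (metis inj_on_inverseI)

text \<open>Finitely many bisections cover C, and each meets a fibre at most once. The bound does
  not depend on x, so functions in \<open>C\<^sub>c\<close> have uniformly bounded fibre
  norms.\<close>

lemma compact_fibre_card:
  assumes "compact C"
  obtains N where "\<And>x. finite (C \<inter> fibre G x)" "\<And>x. card (C \<inter> fibre G x) \<le> N"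
proof -
  have "\<exists>U. open U \<and> \<gamma> \<in> U \<and> inj_on (gsrc G) U" for \<gamma>
    using bisection[of \<gamma>] by blast
  then obtain U where U: "\<And>\<gamma>. open (U \<gamma>)" "\<And>\<gamma>. \<gamma> \<in> U \<gamma>" "\<And>\<gamma>. inj_on (gsrc G) (U \<gamma>)"
    by metis
  obtain D where D: "D \<subseteq> C" "finite D" "C \<subseteq> (\<Union>d\<in>D. U d)"
    using compactE_image[OF assms, of C U] U(1,2) by blast
  have one: "finite (U d \<inter> fibre G x) \<and> card (U d \<inter> fibre G x) \<le> 1" for d x
  proof (cases "U d \<inter> fibre G x = {}")
    case False
    then obtain \<gamma> where \<gamma>: "\<gamma> \<in> U d" "\<gamma> \<in> fibre G x" by blast
    then have "U d \<inter> fibre G x = {\<gamma>}"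
      using U(3)[of d] by (auto simp: fibre_def inj_on_def)
    then show ?thesis by simp
  qed simp
  have sub: "C \<inter> fibre G x \<subseteq> (\<Union>d\<in>D. U d \<inter> fibre G x)" for x using D(3) by blast
  have fin: "finite (\<Union>d\<in>D. U d \<inter> fibre G x)" for x using D(2) one by blast
  show thesis
  proof
    show "finite (C \<inter> fibre G x)" for x using finite_subset[OF sub fin] .
    fix x
    have "card (C \<inter> fibre G x) \<le> card (\<Union>d\<in>D. U d \<inter> fibre G x)" by (rule card_mono[OF fin sub])
    also have "\<dots> \<le> (\<Sum>d\<in>D. card (U d \<inter> fibre G x))" by (rule card_UN_le[OF D(2)])
    also have "\<dots> \<le> (\<Sum>d\<in>D. 1)" using one by (intro sum_mono) blast
    finally show "card (C \<inter> fibre G x) \<le> card D" by simp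
  qed
qed

lemma cont_compact_fibre_norm:
  assumes "u \<in> cont_compact_supp"
  obtains M where "\<And>x. square_summable G x u" "\<And>x. fibre_norm G x u \<le> M"
proof -
  obtain B where B: "0 \<le> B" "\<And>\<gamma>. cmod (u \<gamma>) \<le> B"
    by (rule cont_compact_supp_bounded[OF assms]) blast
  have "compact (supp u)" using assms by (simp add: cont_compact_supp_def)
  then obtain N where N: "\<And>x. finite (supp u \<inter> fibre G x)" "\<And>x. card (supp u \<inter> fibre G x) \<le> N"
    by (rule compact_fibre_card) blast
  have z: "u \<gamma> = 0" if "\<gamma> \<in> fibre G x - (supp u \<inter> fibre G x)" for \<gamma> x
    using that by (auto intro: not_in_supp[of \<gamma> u])
  show thesis
  proof
    show "square_summable G x u" for x
      by (rule fibre_norm_finite_support(1)[OF N(1) _ z]) auto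
    fix x
    have "fibre_norm G x u = L2_set (\<lambda>\<gamma>. cmod (u \<gamma>)) (supp u \<inter> fibre G x)"
      by (rule fibre_norm_finite_support(2)[OF N(1) _ z]) auto
    also have "\<dots> \<le> (\<Sum>\<gamma>\<in>supp u \<inter> fibre G x. cmod (u \<gamma>))" by (rule L2_set_le_sum) simp
    also have "\<dots> \<le> (\<Sum>\<gamma>\<in>supp u \<inter> fibre G x. B)" by (intro sum_mono B)
    also have "\<dots> = real (card (supp u \<inter> fibre G x)) * B" by simp
    also have "\<dots> \<le> real N * B" using N(2) B(1) by (intro mult_right_mono) auto
    finally show "fibre_norm G x u \<le> real N * B" .
  qed
qed

text \<open>A scheme for lifting vectors supported on F: v becomes the sum of the functions
  \<open>v \<beta> * \<phi> \<beta>\<close>. Injectivity of the source on a support makes \<beta>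
  its only point over x, and \<open>\<phi> \<beta> \<beta> = 1\<close> then makes the lift exact on
  that fibre. The neighbourhoods W are left free, to be chosen separated in
  \<open>separated_lift\<close>.\<close>

definition bump_system :: "'g \<Rightarrow> 'g set \<Rightarrow> ('g \<Rightarrow> 'g set) \<Rightarrow> ('g \<Rightarrow> 'g \<Rightarrow> complex) \<Rightarrow> bool" where
  "bump_system x F W \<phi> \<longleftrightarrow> finite F \<and> F \<subseteq> fibre G x \<and>
     (\<forall>\<beta>\<in>F. \<phi> \<beta> \<in> cont_compact_supp \<and> supp (\<phi> \<beta>) \<subseteq> W \<beta> \<and> (\<forall>\<gamma>. cmod (\<phi> \<beta> \<gamma>) \<le> 1) \<and>
        \<phi> \<beta> \<beta> = 1 \<and> inj_on (gsrc G) (supp (\<phi> \<beta>))) \<and>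
     (\<forall>\<beta>\<in>F. \<forall>\<beta>'\<in>F. \<beta> \<noteq> \<beta>' \<longrightarrow> supp (\<phi> \<beta>) \<inter> supp (\<phi> \<beta>') = {})"

lemma bump_system_exists:
  assumes "finite F" "F \<subseteq> fibre G x" "\<And>\<beta>. \<beta> \<in> F \<Longrightarrow> open (W \<beta>)" "\<And>\<beta>. \<beta> \<in> F \<Longrightarrow> \<beta> \<in> W \<beta>"
  obtains \<phi> where "bump_system x F W \<phi>"
proof -
  obtain U where U: "\<And>a. a \<in> F \<Longrightarrow> open (U a)" "\<And>a. a \<in> F \<Longrightarrow> a \<in> U a"
    "\<And>a b. a \<in> F \<Longrightarrow> b \<in> F \<Longrightarrow> a \<noteq> b \<Longrightarrow> U a \<inter> U b = {}"
    by (rule finite_disjoint_open[OF assms(1)]) blast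
  have "\<exists>U. open U \<and> \<gamma> \<in> U \<and> inj_on (gsrc G) U" for \<gamma>
    using bisection[of \<gamma>] by blast
  then obtain B where B: "\<And>\<gamma>. open (B \<gamma>)" "\<And>\<gamma>. \<gamma> \<in> B \<gamma>" "\<And>\<gamma>. inj_on (gsrc G) (B \<gamma>)"
    by metis
  have "\<exists>h. h \<in> cont_compact_supp \<and> supp h \<subseteq> W \<beta> \<inter> U \<beta> \<inter> B \<beta> \<and> (\<forall>\<gamma>. cmod (h \<gamma>) \<le> 1) \<and> h \<beta> = 1"
    if \<beta>: "\<beta> \<in> F" for \<beta>
  proof (rule bump_function[of "{\<beta>}" "W \<beta> \<inter> U \<beta> \<inter> B \<beta>"])
    show "open (W \<beta> \<inter> U \<beta> \<inter> B \<beta>)" by (intro open_Int assms(3) U(1) B(1) \<beta>)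
  qed (use assms(4) U(2) B(2) \<beta> in auto)
  then obtain \<phi> where \<phi>: "\<And>\<beta>. \<beta> \<in> F \<Longrightarrow> \<phi> \<beta> \<in> cont_compact_supp \<and>
      supp (\<phi> \<beta>) \<subseteq> W \<beta> \<inter> U \<beta> \<inter> B \<beta> \<and> (\<forall>\<gamma>. cmod (\<phi> \<beta> \<gamma>) \<le> 1) \<and> \<phi> \<beta> \<beta> = 1"
    by metis
  show thesis
  proof
    have "inj_on (gsrc G) (supp (\<phi> \<beta>))" if "\<beta> \<in> F" for \<beta>
      using inj_on_subset[OF B(3)[of \<beta>]] \<phi>[OF that] by auto
    moreover have "supp (\<phi> \<beta>) \<inter> supp (\<phi> \<beta>') = {}" if "\<beta> \<in> F" "\<beta>' \<in> F" "\<beta> \<noteq> \<beta>'" for \<beta> \<beta>'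
      using \<phi>[OF that(1)] \<phi>[OF that(2)] U(3)[OF that] by blast
    ultimately show "bump_system x F W \<phi>"
      unfolding bump_system_def using assms(1,2) \<phi> by auto
  qed
qed

lemma bump_sum_eq:
  assumes "bump_system x F W \<phi>" "\<beta> \<in> F" "\<gamma> \<in> supp (\<phi> \<beta>)"
  shows "(\<Sum>\<beta>\<in>F. v \<beta> * \<phi> \<beta> \<gamma>) = v \<beta> * \<phi> \<beta> \<gamma>"
proof -
  have "\<phi> \<beta>' \<gamma> = 0" if "\<beta>' \<in> F - {\<beta>}" for \<beta>'
    using assms that unfolding bump_system_def by (intro not_in_supp[of \<gamma> "\<phi> \<beta>'"]) blast
  then have "(\<Sum>\<beta>'\<in>F. v \<beta>' * \<phi> \<beta>' \<gamma>) = (\<Sum>\<beta>'\<in>{\<beta>}. v \<beta>' * \<phi> \<beta>' \<gamma>)"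
    using assms by (intro sum.mono_neutral_right) (auto simp: bump_system_def)
  then show ?thesis by simp
qed

lemma bump_sum_neq_0:
  assumes "bump_system x F W \<phi>" "(\<Sum>\<beta>\<in>F. v \<beta> * \<phi> \<beta> \<gamma>) \<noteq> 0"
  obtains \<beta> where "\<beta> \<in> F" "\<gamma> \<in> supp (\<phi> \<beta>)"
proof -
  obtain \<beta> where \<beta>: "\<beta> \<in> F" "v \<beta> * \<phi> \<beta> \<gamma> \<noteq> 0" using assms(2) by (meson sum.neutral)
  then show thesis using not_in_supp[of \<gamma> "\<phi> \<beta>"] by (intro that[of \<beta>]) auto
qed

lemma bump_sum_cont_compact_supp:
  assumes "bump_system x F W \<phi>"
  shows "(\<lambda>\<gamma>. \<Sum>\<beta>\<in>F. v \<beta> * \<phi> \<beta> \<gamma>) \<in> cont_compact_supp"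
  using assms by (intro cont_compact_supp_sum cont_compact_supp_scale) (simp add: bump_system_def)

lemma bump_self_in_supp: "bump_system x F W \<phi> \<Longrightarrow> \<beta> \<in> F \<Longrightarrow> \<beta> \<in> supp (\<phi> \<beta>)"
  using not_in_supp[of \<beta> "\<phi> \<beta>"] by (auto simp: bump_system_def)

lemma bump_sum_restrict:
  assumes "bump_system x F W \<phi>"
  shows "fibre_restrict G x (\<lambda>\<gamma>. \<Sum>\<beta>\<in>F. v \<beta> * \<phi> \<beta> \<gamma>) = on_set F v"
proof
  fix \<gamma>
  have F: "F \<subseteq> fibre G x" using assms by (simp add: bump_system_def)
  consider "\<gamma> \<notin> fibre G x" | "\<gamma> \<in> F" | "\<gamma> \<in> fibre G x" "\<gamma> \<notin> F" by blast
  then show "fibre_restrict G x (\<lambda>\<gamma>. \<Sum>\<beta>\<in>F. v \<beta> * \<phi> \<beta> \<gamma>) \<gamma> = on_set F v \<gamma>"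
  proof cases
    case 1
    then show ?thesis using F by (auto simp: fibre_restrict_def on_set_def)
  next
    case 2
    then have "(\<Sum>\<beta>\<in>F. v \<beta> * \<phi> \<beta> \<gamma>) = v \<gamma>"
      using bump_sum_eq[OF assms 2 bump_self_in_supp[OF assms 2], of v] assms by (simp add: bump_system_def)
    then show ?thesis using 2 F by (auto simp: fibre_restrict_def on_set_def)
  next
    case 3
    have "(\<Sum>\<beta>\<in>F. v \<beta> * \<phi> \<beta> \<gamma>) = 0"
    proof (rule ccontr)
      assume "\<not> ?thesis"
      then obtain \<beta> where \<beta>: "\<beta> \<in> F" "\<gamma> \<in> supp (\<phi> \<beta>)" using bump_sum_neq_0[OF assms] by blast
      then have "gsrc G \<gamma> = gsrc G \<beta>" using 3 F by (auto simp: fibre_def)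
      then have "\<gamma> = \<beta>"
        using assms \<beta> bump_self_in_supp[OF assms \<beta>(1)] by (auto simp: bump_system_def inj_on_def)
      with \<beta> 3 show False by simp
    qed
    then show ?thesis using 3 by (simp add: fibre_restrict_def on_set_def)
  qed
qed

lemma bump_sum_cmod:
  assumes "bump_system x F W \<phi>" "\<beta> \<in> F" "\<gamma> \<in> supp (\<phi> \<beta>)"
  shows "cmod (\<Sum>\<beta>\<in>F. v \<beta> * \<phi> \<beta> \<gamma>) \<le> cmod (v \<beta>)"
  using assms(1,2) mult_left_mono[of "cmod (\<phi> \<beta> \<gamma>)" 1 "cmod (v \<beta>)"]
  by (simp add: bump_sum_eq[OF assms] norm_mult bump_system_def)

text \<open>The supports are disjoint bisections, so each fibre meets each of them at most once.\<close>

lemma bump_sum_fibre_norm: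
  assumes "bump_system x F W \<phi>"
  shows "fibre_norm G y (\<lambda>\<gamma>. \<Sum>\<beta>\<in>F. v \<beta> * \<phi> \<beta> \<gamma>) \<le> fibre_norm G x (on_set F v)"
proof (rule square_summable_boundI(2))
  let ?\<xi> = "\<lambda>\<gamma>. \<Sum>\<beta>\<in>F. v \<beta> * \<phi> \<beta> \<gamma>"
  have F: "finite F" "F \<subseteq> fibre G x" using assms by (auto simp: bump_system_def)
  fix E assume E: "finite E" "E \<subseteq> fibre G y"
  define E' where "E' = {\<gamma> \<in> E. ?\<xi> \<gamma> \<noteq> 0}"
  have "\<forall>\<gamma>\<in>E'. \<exists>\<beta>. \<beta> \<in> F \<and> \<gamma> \<in> supp (\<phi> \<beta>)"
    unfolding E'_def using bump_sum_neq_0[OF assms] by blast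
  then obtain b where b: "\<And>\<gamma>. \<gamma> \<in> E' \<Longrightarrow> b \<gamma> \<in> F \<and> \<gamma> \<in> supp (\<phi> (b \<gamma>))" by metis
  have inj: "inj_on b E'"
  proof (rule inj_onI)
    fix \<gamma> \<gamma>' assume *: "\<gamma> \<in> E'" "\<gamma>' \<in> E'" "b \<gamma> = b \<gamma>'"
    then have "gsrc G \<gamma> = gsrc G \<gamma>'" using E(2) by (auto simp: E'_def fibre_def)
    moreover have "inj_on (gsrc G) (supp (\<phi> (b \<gamma>)))" using assms b[OF *(1)] by (simp add: bump_system_def)
    ultimately show "\<gamma> = \<gamma>'" using b[OF *(1)] b[OF *(2)] *(3) by (auto simp: inj_on_def)
  qed
  have "(\<Sum>\<gamma>\<in>E. (cmod (?\<xi> \<gamma>))\<^sup>2) = (\<Sum>\<gamma>\<in>E'. (cmod (?\<xi> \<gamma>))\<^sup>2)"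
    using E(1) by (intro sum.mono_neutral_right) (auto simp: E'_def)
  also have "\<dots> \<le> (\<Sum>\<gamma>\<in>E'. (cmod (v (b \<gamma>)))\<^sup>2)"
    using b bump_sum_cmod[OF assms] by (intro sum_mono power_mono) auto
  also have "\<dots> = (\<Sum>\<beta>\<in>b ` E'. (cmod (v \<beta>))\<^sup>2)" using inj by (simp add: sum.reindex)
  also have "\<dots> \<le> (\<Sum>\<beta>\<in>F. (cmod (v \<beta>))\<^sup>2)" using b F(1) by (intro sum_mono2) auto
  finally show "L2_set (\<lambda>\<gamma>. cmod (?\<xi> \<gamma>)) E \<le> fibre_norm G x (on_set F v)"
    by (simp add: fibre_norm_on_set[OF F] L2_set_def)
qed simp

text \<open>The norm bound holds on every fibre, so it controls the module norm of the lift and not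
  just its norm at x.\<close>

lemma finite_support_lift:
  assumes "finite F" "F \<subseteq> fibre G x"
  obtains \<xi> where "\<xi> \<in> cont_compact_supp" "fibre_restrict G x \<xi> = on_set F v"
    "\<And>y. fibre_norm G y \<xi> \<le> fibre_norm G x (on_set F v)"
proof -
  obtain \<phi> where \<phi>: "bump_system x F (\<lambda>_. UNIV) \<phi>"
    by (rule bump_system_exists[OF assms, of "\<lambda>_. UNIV"]) auto
  show thesis
    using that[OF bump_sum_cont_compact_supp[OF \<phi>] bump_sum_restrict[OF \<phi>] bump_sum_fibre_norm[OF \<phi>]] .
qed

section \<open>Products with a compact set, and separation\<close>

lemma set_mulI: "\<alpha> \<in> A \<Longrightarrow> \<beta> \<in> B \<Longrightarrow> gsrc G \<alpha> = grng G \<beta> \<Longrightarrow> gmul G \<alpha> \<beta> \<in> set_mul G A B"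
  by (auto simp: set_mul_def)

text \<open>Range and source are continuous into a Hausdorff space, so the composable pairs form a
  closed set and their part in \<open>A \<times> B\<close> is compact.\<close>

lemma compact_set_mul:
  assumes "compact A" "compact B"
  shows "compact (set_mul G A B)"
proof -
  have cl: "closed {p. gsrc G (fst p) = grng G (snd p)}"
    by (rule closed_Collect_eq;
        rule continuous_on_compose2[OF continuous_src] continuous_on_compose2[OF continuous_rng])
       (auto intro: continuous_intros)
  have eq: "set_mul G A B = (\<lambda>(\<alpha>, \<beta>). gmul G \<alpha> \<beta>) ` ((A \<times> B) \<inter> {p. gsrc G (fst p) = grng G (snd p)})"
  proof (intro subset_antisym subsetI)
    fix \<gamma> assume "\<gamma> \<in> set_mul G A B"
    then obtain \<alpha> \<beta> where "\<gamma> = gmul G \<alpha> \<beta>" "\<alpha> \<in> A" "\<beta> \<in> B" "gsrc G \<alpha> = grng G \<beta>"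
      by (auto simp: set_mul_def)
    then show "\<gamma> \<in> (\<lambda>(\<alpha>, \<beta>). gmul G \<alpha> \<beta>) ` ((A \<times> B) \<inter> {p. gsrc G (fst p) = grng G (snd p)})"
      by (intro image_eqI[of _ _ "(\<alpha>, \<beta>)"]) auto
  qed (auto intro: set_mulI)
  have "compact ((A \<times> B) \<inter> {p. gsrc G (fst p) = grng G (snd p)})"
    using compact_Times[OF assms] cl by (rule compact_Int_closed)
  then show ?thesis
    unfolding eq by (rule compact_continuous_image[rotated])
      (rule continuous_on_subset[OF continuous_mul], auto)
qed

lemma mul_inv_cancel: "gsrc G \<alpha> = grng G \<beta> \<Longrightarrow> gmul G (gmul G \<alpha> \<beta>) (ginv G \<beta>) = \<alpha>"
  by (metis mul_assoc mul_inv rng_inv src_mul_right)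

lemma inv_mul_cancel: "gsrc G \<alpha> = gsrc G \<beta> \<Longrightarrow> gmul G (gmul G \<alpha> (ginv G \<beta>)) \<beta> = \<alpha>"
  by (metis inv_mul mul_assoc rng_inv src_inv src_mul_right)

text \<open>Within one fibre, a is in the product of K with b exactly when
  \<open>a b\<inverse>\<close> is in K. This quotient is continuous on pairs with equal sources and
  K is closed, so avoiding K persists on a product neighbourhood of (a, b).\<close>

lemma not_in_set_mul_nbhd:
  assumes K: "compact K" and src: "gsrc G a = gsrc G b" and nin: "a \<notin> set_mul G K {b}"
  obtains V U where "open V" "open U" "a \<in> V" "b \<in> U" "set_mul G K U \<inter> V = {}"
proof -
  let ?P = "{p. gsrc G (fst p) = gsrc G (snd p)}"
  let ?q = "\<lambda>p. gmul G (fst p) (ginv G (snd p))"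
  have "continuous_on ?P ((\<lambda>(\<alpha>, \<beta>). gmul G \<alpha> \<beta>) \<circ> (\<lambda>p. (fst p, ginv G (snd p))))"
    by (intro continuous_on_compose continuous_on_subset[OF continuous_mul] continuous_intros
        continuous_on_compose2[OF continuous_inv]) (auto simp: rng_inv)
  then have q: "continuous_on ?P ?q" by (simp add: o_def)
  have "open (- K)" using K compact_imp_closed by blast
  \<comment> \<open>Q is controlled only on pairs with equal sources. That is enough, because
    \<open>\<kappa>\<beta>\<close> and \<beta> always have the same source.\<close>
  then obtain Q where Q: "open Q" "Q \<inter> ?P = ?q -` (- K) \<inter> ?P"
    using q unfolding continuous_on_open_invariant by blast
  have "gmul G a (ginv G b) \<notin> K"
  proof
    assume "gmul G a (ginv G b) \<in> K"
    then have "gmul G (gmul G a (ginv G b)) b \<in> set_mul G K {b}"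
      using src by (intro set_mulI) (auto simp: src_mul rng_inv src_inv)
    with nin show False by (simp add: inv_mul_cancel[OF src])
  qed
  then have "(a, b) \<in> Q" using Q(2) src by auto
  then obtain V U where VU: "open V" "open U" "(a, b) \<in> V \<times> U" "V \<times> U \<subseteq> Q"
    by (rule open_prod_elim[OF Q(1)]) blast
  show thesis
  proof
    show "set_mul G K U \<inter> V = {}"
    proof (rule ccontr)
      assume "set_mul G K U \<inter> V \<noteq> {}"
      then obtain \<kappa> \<beta> where *: "\<kappa> \<in> K" "\<beta> \<in> U" "gsrc G \<kappa> = grng G \<beta>" "gmul G \<kappa> \<beta> \<in> V"
        by (auto simp: set_mul_def)
      then have "(gmul G \<kappa> \<beta>, \<beta>) \<in> Q \<inter> ?P" using VU(4) by (auto simp: src_mul)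
      then have "gmul G (gmul G \<kappa> \<beta>) (ginv G \<beta>) \<notin> K" using Q(2) by auto
      then show False using * by (simp add: mul_inv_cancel)
    qed
  qed (use VU in auto)
qed

text \<open>From \<open>\<kappa>\<alpha> = \<beta>\<close> follows
  \<open>\<alpha> = \<kappa>\<inverse>\<beta>\<close>. Both separation conditions thereby become
  conditions on products with B: they hold as soon as A avoids the products of B with K and with the
  inverses of K.\<close>

lemma set_mul_inverse_disjoint:
  "set_mul G K A \<inter> B = {} \<longleftrightarrow> A \<inter> set_mul G (ginv G ` K) B = {}"
proof -
  have 1: "A' \<inter> set_mul G (ginv G ` K') B' = {}" if "set_mul G K' A' \<inter> B' = {}" for A' B' K'
  proof (rule ccontr)
    assume "A' \<inter> set_mul G (ginv G ` K') B' \<noteq> {}"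
    then obtain \<kappa> \<beta> where *: "\<kappa> \<in> K'" "\<beta> \<in> B'" "grng G \<kappa> = grng G \<beta>" "gmul G (ginv G \<kappa>) \<beta> \<in> A'"
      by (auto simp: set_mul_def src_inv)
    have "gmul G \<kappa> (gmul G (ginv G \<kappa>) \<beta>) = gmul G (gmul G \<kappa> (ginv G \<kappa>)) \<beta>"
      using * by (simp add: mul_assoc rng_inv src_inv)
    also have "\<dots> = \<beta>" using * by (simp add: mul_inv rng_mul_left)
    finally have "\<beta> \<in> set_mul G K' A'"
      using set_mulI[of \<kappa> K' "gmul G (ginv G \<kappa>) \<beta>" A'] * by (simp add: rng_mul src_inv rng_inv)
    with that * show False by blast
  qed
  have "ginv G ` ginv G ` K = K" by (simp add: image_image inv_inv)
  then show ?thesis using 1[of K A B] 1[of "ginv G ` K" B A] by (metis Int_commute)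
qed

end

section \<open>The Hilbert module as a space of functions\<close>

text \<open>Lower semicontinuity of the norm under pointwise limits, as in Fatou's lemma: each
  finite section passes to the limit. It is applied to Cauchy sequences with w one of their
  members.\<close>

lemma fibre_norm_limit:
  assumes lim: "\<And>\<gamma>. \<gamma> \<in> fibre G x \<Longrightarrow> (\<lambda>m. u m \<gamma>) \<longlonglongrightarrow> \<xi> \<gamma>"
    and bound: "\<And>m. m \<ge> N \<Longrightarrow> square_summable G x (\<lambda>\<gamma>. u m \<gamma> - w \<gamma>)"
      "\<And>m. m \<ge> N \<Longrightarrow> fibre_norm G x (\<lambda>\<gamma>. u m \<gamma> - w \<gamma>) \<le> c"
  shows "square_summable G x (\<lambda>\<gamma>. \<xi> \<gamma> - w \<gamma>)" "fibre_norm G x (\<lambda>\<gamma>. \<xi> \<gamma> - w \<gamma>) \<le> c"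
proof -
  have c: "0 \<le> c" using order_trans[OF fibre_norm_nonneg bound(2)[of N]] by simp
  have b: "L2_set (\<lambda>\<gamma>. cmod (\<xi> \<gamma> - w \<gamma>)) F \<le> c" if F: "finite F" "F \<subseteq> fibre G x" for F
  proof (rule LIMSEQ_le_const2)
    show "(\<lambda>m. L2_set (\<lambda>\<gamma>. cmod (u m \<gamma> - w \<gamma>)) F) \<longlonglongrightarrow> L2_set (\<lambda>\<gamma>. cmod (\<xi> \<gamma> - w \<gamma>)) F"
      unfolding L2_set_def using F(2)
      by (intro tendsto_real_sqrt tendsto_sum tendsto_power tendsto_norm tendsto_diff tendsto_const lim) auto
    have "L2_set (\<lambda>\<gamma>. cmod (u m \<gamma> - w \<gamma>)) F \<le> c" if "m \<ge> N" for m
      using L2_set_le_fibre_norm[OF bound(1)[OF that] F] bound(2)[OF that] by linarith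
    then show "\<exists>N. \<forall>m\<ge>N. L2_set (\<lambda>\<gamma>. cmod (u m \<gamma> - w \<gamma>)) F \<le> c" by blast
  qed
  show "square_summable G x (\<lambda>\<gamma>. \<xi> \<gamma> - w \<gamma>)" by (rule square_summable_boundI(1)[OF c b])
  show "fibre_norm G x (\<lambda>\<gamma>. \<xi> \<gamma> - w \<gamma>) \<le> c" by (rule square_summable_boundI(2)[OF c b])
qed

lemma module_norm_eq: "module_norm G \<xi> = sqrt (SUP x\<in>units G. (fibre_norm G x \<xi>)\<^sup>2)"
  by (simp add: module_norm_def module_inner_def fibre_inner_self norm_power)

lemma units_nonempty: "units G \<noteq> {}"
  by (simp add: units_def)

lemma module_norm_le:
  assumes "\<And>x. x \<in> units G \<Longrightarrow> fibre_norm G x \<xi> \<le> c"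
  shows "module_norm G \<xi> \<le> c"
proof -
  obtain y where "y \<in> units G" using units_nonempty[of G] by blast
  then have c: "0 \<le> c" using order_trans[OF fibre_norm_nonneg assms] by blast
  have "(SUP x\<in>units G. (fibre_norm G x \<xi>)\<^sup>2) \<le> c\<^sup>2"
    using units_nonempty assms by (intro cSUP_least power_mono) auto
  then have "sqrt (SUP x\<in>units G. (fibre_norm G x \<xi>)\<^sup>2) \<le> sqrt (c\<^sup>2)" by (rule real_sqrt_le_mono)
  then show ?thesis using c by (simp add: module_norm_eq)
qed

text \<open>M guarantees that the fibre norms are bounded; otherwise their supremum would be
  unspecified.\<close>

lemma fibre_norm_le_module_norm:
  assumes "\<And>x. x \<in> units G \<Longrightarrow> fibre_norm G x \<xi> \<le> M" "x \<in> units G"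
  shows "fibre_norm G x \<xi> \<le> module_norm G \<xi>"
proof -
  have "bdd_above ((\<lambda>x. (fibre_norm G x \<xi>)\<^sup>2) ` units G)"
    using assms(1) by (intro bdd_aboveI2[of _ _ "M\<^sup>2"] power_mono) auto
  then have "(fibre_norm G x \<xi>)\<^sup>2 \<le> (SUP x\<in>units G. (fibre_norm G x \<xi>)\<^sup>2)"
    using assms(2) by (rule cSUP_upper[rotated])
  then have "sqrt ((fibre_norm G x \<xi>)\<^sup>2) \<le> module_norm G \<xi>"
    unfolding module_norm_eq by (rule real_sqrt_le_mono)
  then show ?thesis by simp
qed

text \<open>Distance at most \<epsilon> in the supremum of the fibre norms, written without a
  supremum and with summability included, so that it makes sense before either function is known to
  lie in the module. Over a non-unit the fibre is empty and the condition reduces to 0 \<le>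
  \<epsilon>.\<close>

definition fibrewise_close :: "'g groupoid_data \<Rightarrow> real \<Rightarrow> ('g \<Rightarrow> complex) \<Rightarrow> ('g \<Rightarrow> complex) \<Rightarrow> bool" where
  "fibrewise_close G \<epsilon> \<xi> \<eta> \<longleftrightarrow> (\<forall>x. square_summable G x (\<lambda>\<gamma>. \<xi> \<gamma> - \<eta> \<gamma>) \<and> fibre_norm G x (\<lambda>\<gamma>. \<xi> \<gamma> - \<eta> \<gamma>) \<le> \<epsilon>)"

lemma fibrewise_close_trans:
  assumes "fibrewise_close G \<epsilon> \<xi> \<eta>" "fibrewise_close G \<delta> \<eta> \<zeta>"
  shows "fibrewise_close G (\<epsilon> + \<delta>) \<xi> \<zeta>"
proof -
  have "square_summable G x (\<lambda>\<gamma>. \<xi> \<gamma> - \<zeta> \<gamma>) \<and> fibre_norm G x (\<lambda>\<gamma>. \<xi> \<gamma> - \<zeta> \<gamma>) \<le> \<epsilon> + \<delta>" for x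
    using square_summable_add[of G x "\<lambda>\<gamma>. \<xi> \<gamma> - \<eta> \<gamma>" "\<lambda>\<gamma>. \<eta> \<gamma> - \<zeta> \<gamma>"] assms
    unfolding fibrewise_close_def by (simp add: add_mono order_trans)
  then show ?thesis by (simp add: fibrewise_close_def)
qed

lemma fibrewise_close_sym: "fibrewise_close G \<epsilon> \<xi> \<eta> \<Longrightarrow> fibrewise_close G \<epsilon> \<eta> \<xi>"
  unfolding fibrewise_close_def square_summable_def fibre_norm_def by (simp add: norm_minus_commute)

lemma fibrewise_close_mult:
  assumes "fibrewise_close G \<epsilon> \<xi> \<eta>" "\<And>\<gamma>. cmod (f \<gamma>) \<le> c" "0 \<le> c"
  shows "fibrewise_close G (c * \<epsilon>) (\<lambda>\<gamma>. f \<gamma> * \<xi> \<gamma>) (\<lambda>\<gamma>. f \<gamma> * \<eta> \<gamma>)"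
proof -
  have eq: "(\<lambda>\<gamma>. f \<gamma> * \<xi> \<gamma> - f \<gamma> * \<eta> \<gamma>) = (\<lambda>\<gamma>. f \<gamma> * (\<xi> \<gamma> - \<eta> \<gamma>))" by (simp add: algebra_simps)
  show ?thesis
    unfolding fibrewise_close_def eq
    using square_summable_mult[of G _ "\<lambda>\<gamma>. \<xi> \<gamma> - \<eta> \<gamma>" f c] assms
    unfolding fibrewise_close_def by (meson mult_left_mono order_trans)
qed

context lc_etale_groupoid
begin

text \<open>Replaces Cauchy sequences by approximation. The pointwise limit of a Cauchy sequence is
  fibrewise close to its late members by \<open>fibre_norm_limit\<close>; conversely, approximations
  within 1/(n+1) form a Cauchy sequence that converges pointwise, because values are bounded by
  fibre norms. Completeness, in the form \<open>L2_closed\<close>, then takes only an \<epsilon>/2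
  argument.\<close>

lemma L2_iff: "\<xi> \<in> L2 G \<longleftrightarrow> (\<forall>\<epsilon>>0. \<exists>u\<in>cont_compact_supp. fibrewise_close G \<epsilon> \<xi> u)"
proof
  assume "\<xi> \<in> L2 G"
  then obtain u where u: "\<And>n. u n \<in> cont_compact_supp"
    "\<And>\<epsilon>. \<epsilon> > 0 \<Longrightarrow> \<exists>N. \<forall>m\<ge>N. \<forall>n\<ge>N. module_norm G (\<lambda>\<gamma>. u m \<gamma> - u n \<gamma>) < \<epsilon>"
    "\<And>\<gamma>. (\<lambda>n. u n \<gamma>) \<longlonglongrightarrow> \<xi> \<gamma>"
    unfolding L2_def by blast
  show "\<forall>\<epsilon>>0. \<exists>u\<in>cont_compact_supp. fibrewise_close G \<epsilon> \<xi> u"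
  proof (intro allI impI)
    fix \<epsilon> :: real assume "\<epsilon> > 0"
    then obtain N where N: "\<And>m n. m \<ge> N \<Longrightarrow> n \<ge> N \<Longrightarrow> module_norm G (\<lambda>\<gamma>. u m \<gamma> - u n \<gamma>) < \<epsilon>"
      using u(2) by blast
    have close: "square_summable G x (\<lambda>\<gamma>. u m \<gamma> - u N \<gamma>) \<and> fibre_norm G x (\<lambda>\<gamma>. u m \<gamma> - u N \<gamma>) \<le> \<epsilon>"
      if "m \<ge> N" for m x
    proof (cases "x \<in> units G")
      case True
      obtain M where M: "\<And>x. square_summable G x (\<lambda>\<gamma>. u m \<gamma> - u N \<gamma>)" "\<And>x. fibre_norm G x (\<lambda>\<gamma>. u m \<gamma> - u N \<gamma>) \<le> M"
        by (rule cont_compact_fibre_norm[OF cont_compact_supp_diff[OF u(1) u(1)]]) blast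
      have "fibre_norm G x (\<lambda>\<gamma>. u m \<gamma> - u N \<gamma>) \<le> module_norm G (\<lambda>\<gamma>. u m \<gamma> - u N \<gamma>)"
        by (rule fibre_norm_le_module_norm[OF M(2) True])
      then show ?thesis using N[OF that order_refl] M(1) by auto
    next
      case False
      then show ?thesis using \<open>\<epsilon> > 0\<close> by (simp add: square_summable_def fibre_norm_def fibre_not_unit)
    qed
    have "fibrewise_close G \<epsilon> \<xi> (u N)"
      unfolding fibrewise_close_def
      using fibre_norm_limit[of G _ u \<xi> N "u N" \<epsilon>, OF u(3)] close by blast
    then show "\<exists>u\<in>cont_compact_supp. fibrewise_close G \<epsilon> \<xi> u" using u(1) by blast
  qed
next
  assume a: "\<forall>\<epsilon>>0. \<exists>u\<in>cont_compact_supp. fibrewise_close G \<epsilon> \<xi> u"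
  have "\<forall>n. \<exists>u. u \<in> cont_compact_supp \<and> fibrewise_close G (inverse (real (Suc n))) \<xi> u"
    using a by (metis inverse_positive_iff_positive of_nat_0_less_iff zero_less_Suc)
  then obtain u where u: "\<And>n. u n \<in> cont_compact_supp" "\<And>n. fibrewise_close G (inverse (real (Suc n))) \<xi> (u n)"
    by metis
  show "\<xi> \<in> L2 G"
    unfolding L2_def
  proof (intro CollectI exI[of _ u] conjI allI impI u(1))
    fix \<epsilon> :: real assume e: "\<epsilon> > 0"
    then obtain N where N: "inverse (real (Suc N)) < \<epsilon> / 2" using reals_Archimedean[of "\<epsilon> / 2"] by auto
    have "module_norm G (\<lambda>\<gamma>. u m \<gamma> - u n \<gamma>) < \<epsilon>" if "m \<ge> N" "n \<ge> N" for m n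
    proof -
      have le: "inverse (real (Suc k)) \<le> inverse (real (Suc N))" if "k \<ge> N" for k
        using that by (simp add: field_simps)
      have "fibrewise_close G (inverse (real (Suc m)) + inverse (real (Suc n))) (u m) (u n)"
        by (rule fibrewise_close_trans[OF fibrewise_close_sym[OF u(2)] u(2)])
      then have "module_norm G (\<lambda>\<gamma>. u m \<gamma> - u n \<gamma>) \<le> inverse (real (Suc m)) + inverse (real (Suc n))"
        unfolding fibrewise_close_def by (intro module_norm_le) blast
      also have "\<dots> < \<epsilon>" using le[OF that(1)] le[OF that(2)] N by linarith
      finally show ?thesis .
    qed
    then show "\<exists>N. \<forall>m\<ge>N. \<forall>n\<ge>N. module_norm G (\<lambda>\<gamma>. u m \<gamma> - u n \<gamma>) < \<epsilon>" by blast
  next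
    fix \<gamma>
    have "cmod (u n \<gamma> - \<xi> \<gamma>) \<le> inverse (real (Suc n))" for n
    proof -
      have "square_summable G (gsrc G \<gamma>) (\<lambda>\<gamma>. \<xi> \<gamma> - u n \<gamma>)"
        "fibre_norm G (gsrc G \<gamma>) (\<lambda>\<gamma>. \<xi> \<gamma> - u n \<gamma>) \<le> inverse (real (Suc n))"
        using u(2)[of n] unfolding fibrewise_close_def by blast+
      then show ?thesis
        using cmod_le_fibre_norm[of G "gsrc G \<gamma>" "\<lambda>\<gamma>. \<xi> \<gamma> - u n \<gamma>" \<gamma>] by (simp add: norm_minus_commute)
    qed
    then have "(\<lambda>n. u n \<gamma> - \<xi> \<gamma>) \<longlonglongrightarrow> 0"
      by (intro Lim_null_comparison[OF _ LIMSEQ_inverse_real_of_nat]) auto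
    then show "(\<lambda>n. u n \<gamma>) \<longlonglongrightarrow> \<xi> \<gamma>" by (rule LIM_zero_cancel)
  qed
qed

lemma fibrewise_close_refl: "0 \<le> \<epsilon> \<Longrightarrow> fibrewise_close G \<epsilon> \<xi> \<xi>"
  by (simp add: fibrewise_close_def)

lemma cont_compact_supp_L2: "u \<in> cont_compact_supp \<Longrightarrow> u \<in> L2 G"
  unfolding L2_iff using fibrewise_close_refl[of _ u] less_imp_le by blast

lemma L2_closed:
  assumes "\<And>\<epsilon>. \<epsilon> > 0 \<Longrightarrow> \<exists>\<eta>\<in>L2 G. fibrewise_close G \<epsilon> \<xi> \<eta>"
  shows "\<xi> \<in> L2 G"
  unfolding L2_iff
proof (intro allI impI)
  fix \<epsilon> :: real assume "\<epsilon> > 0"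
  then have e: "\<epsilon> / 2 > 0" by simp
  from assms[OF e] obtain \<eta> where \<eta>: "\<eta> \<in> L2 G" "fibrewise_close G (\<epsilon> / 2) \<xi> \<eta>" by blast
  from \<eta>(1) e obtain u where u: "u \<in> cont_compact_supp" "fibrewise_close G (\<epsilon> / 2) \<eta> u"
    unfolding L2_iff by blast
  show "\<exists>u\<in>cont_compact_supp. fibrewise_close G \<epsilon> \<xi> u"
    using fibrewise_close_trans[OF \<eta>(2) u(2)] u(1) by (intro bexI[of _ u]) simp_all
qed

lemma L2_bounded:
  assumes "\<xi> \<in> L2 G"
  obtains M where "\<And>x. square_summable G x \<xi>" "\<And>x. fibre_norm G x \<xi> \<le> M"
proof -
  obtain u where u: "u \<in> cont_compact_supp" "fibrewise_close G 1 \<xi> u"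
    using assms unfolding L2_iff by (meson zero_less_one)
  obtain M where M: "\<And>x. square_summable G x u" "\<And>x. fibre_norm G x u \<le> M"
    by (rule cont_compact_fibre_norm[OF u(1)]) blast
  have c: "square_summable G x (\<lambda>\<gamma>. \<xi> \<gamma> - u \<gamma>)" "fibre_norm G x (\<lambda>\<gamma>. \<xi> \<gamma> - u \<gamma>) \<le> 1" for x
    using u(2) by (auto simp: fibrewise_close_def)
  have s: "square_summable G x \<xi>" "fibre_norm G x \<xi> \<le> 1 + M" for x
    using square_summable_add[OF c(1) M(1), of x] c(2)[of x] M(2)[of x] by auto
  show thesis by (rule that[OF s])
qed

lemma L2_square_summable: "\<xi> \<in> L2 G \<Longrightarrow> square_summable G x \<xi>"
  by (rule L2_bounded) blast+

lemma L2_fibre_norm_le: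
  assumes "\<xi> \<in> L2 G"
  shows "fibre_norm G x \<xi> \<le> module_norm G \<xi>"
proof -
  obtain M where M: "\<And>x. fibre_norm G x \<xi> \<le> M" by (rule L2_bounded[OF assms]) blast
  show ?thesis
  proof (cases "x \<in> units G")
    case True
    show ?thesis by (rule fibre_norm_le_module_norm[OF M True])
  next
    case False
    obtain y where y: "y \<in> units G" using units_nonempty[of G] by blast
    have "0 \<le> module_norm G \<xi>"
      by (rule order_trans[OF fibre_norm_nonneg fibre_norm_le_module_norm[OF M y]])
    with False show ?thesis by (simp add: fibre_norm_def fibre_not_unit)
  qed
qed

lemma L2_restrict: "\<xi> \<in> L2 G \<Longrightarrow> fibre_restrict G x \<xi> \<in> fibre_l2 G x"
  by (rule fibre_restrict_l2[OF L2_square_summable])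

lemma L2_mult:
  assumes "\<xi> \<in> L2 G" "continuous_on UNIV f" "\<And>\<gamma>. cmod (f \<gamma>) \<le> c"
  shows "(\<lambda>\<gamma>. f \<gamma> * \<xi> \<gamma>) \<in> L2 G"
  unfolding L2_iff
proof (intro allI impI)
  fix \<epsilon> :: real assume "\<epsilon> > 0"
  have c: "0 \<le> c" using order_trans[OF norm_ge_zero assms(3)] .
  define \<delta> where "\<delta> = \<epsilon> / (c + 1)"
  have "\<delta> > 0" using c \<open>\<epsilon> > 0\<close> by (simp add: \<delta>_def)
  with assms(1) obtain u where u: "u \<in> cont_compact_supp" "fibrewise_close G \<delta> \<xi> u"
    unfolding L2_iff by blast
  have "c * \<delta> \<le> \<epsilon>" using c \<open>\<epsilon> > 0\<close> by (simp add: \<delta>_def field_simps)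
  then have "fibrewise_close G \<epsilon> (\<lambda>\<gamma>. f \<gamma> * \<xi> \<gamma>) (\<lambda>\<gamma>. f \<gamma> * u \<gamma>)"
    using fibrewise_close_mult[OF u(2) assms(3) c] unfolding fibrewise_close_def
    by (meson order_trans)
  then show "\<exists>u\<in>cont_compact_supp. fibrewise_close G \<epsilon> (\<lambda>\<gamma>. f \<gamma> * \<xi> \<gamma>) u"
    using cont_compact_supp_mult[OF u(1) assms(2)] by blast
qed

text \<open>Values are bounded by fibre norms, so approximation in the module is uniform
  approximation by continuous functions.\<close>

lemma L2_continuous:
  assumes "\<xi> \<in> L2 G"
  shows "continuous_on UNIV \<xi>"
proof -
  have "\<forall>n. \<exists>u. u \<in> cont_compact_supp \<and> fibrewise_close G (inverse (real (Suc n))) \<xi> u"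
    using assms unfolding L2_iff by (metis inverse_positive_iff_positive of_nat_0_less_iff zero_less_Suc)
  then obtain u where u: "\<And>n. u n \<in> cont_compact_supp" "\<And>n. fibrewise_close G (inverse (real (Suc n))) \<xi> (u n)"
    by metis
  have d: "dist (u n \<gamma>) (\<xi> \<gamma>) \<le> inverse (real (Suc n))" for n \<gamma>
  proof -
    have "square_summable G (gsrc G \<gamma>) (\<lambda>\<gamma>. \<xi> \<gamma> - u n \<gamma>)"
      "fibre_norm G (gsrc G \<gamma>) (\<lambda>\<gamma>. \<xi> \<gamma> - u n \<gamma>) \<le> inverse (real (Suc n))"
      using u(2)[of n] unfolding fibrewise_close_def by blast+
    then show ?thesis
      using cmod_le_fibre_norm[of G "gsrc G \<gamma>" "\<lambda>\<gamma>. \<xi> \<gamma> - u n \<gamma>" \<gamma>] by (simp add: dist_norm norm_minus_commute)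
  qed
  have "uniform_limit UNIV u \<xi> sequentially"
  proof (rule uniform_limitI)
    fix \<epsilon> :: real assume "\<epsilon> > 0"
    then have "\<forall>\<^sub>F n in sequentially. inverse (real (Suc n)) < \<epsilon>"
      using order_tendstoD(2)[OF LIMSEQ_inverse_real_of_nat] by blast
    then show "\<forall>\<^sub>F n in sequentially. \<forall>\<gamma>\<in>UNIV. dist (u n \<gamma>) (\<xi> \<gamma>) < \<epsilon>"
      by eventually_elim (use d in \<open>auto intro: le_less_trans\<close>)
  qed
  then show ?thesis
    using u(1) by (intro uniform_limit_theorem[where f = u and F = sequentially]) (auto simp: cont_compact_supp_def)
qed

end

section \<open>Slices of adjointable operators\<close>

text \<open>\<open>adjointable\<close> without extensionality and with inner products compared fibre
  by fibre. Unrestricted maps such as \<open>glue\<close> fit in, and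
  \<open>adjoint_pair_sym\<close> allows every fact about S to be used for A.\<close>

definition adjoint_pair :: "'g::topological_space groupoid_data \<Rightarrow> 'g operator \<Rightarrow> 'g operator \<Rightarrow> bool" where
  "adjoint_pair G S A \<longleftrightarrow> (\<forall>\<xi>\<in>L2 G. S \<xi> \<in> L2 G) \<and> (\<forall>\<xi>\<in>L2 G. A \<xi> \<in> L2 G) \<and>
     (\<forall>\<eta>\<in>L2 G. \<forall>\<xi>\<in>L2 G. \<forall>x. fibre_inner G x (S \<eta>) \<xi> = fibre_inner G x \<eta> (A \<xi>))"

lemma adjoint_pairD:
  assumes "adjoint_pair G S A"
  shows "\<xi> \<in> L2 G \<Longrightarrow> S \<xi> \<in> L2 G" "\<xi> \<in> L2 G \<Longrightarrow> A \<xi> \<in> L2 G"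
    "\<eta> \<in> L2 G \<Longrightarrow> \<xi> \<in> L2 G \<Longrightarrow> fibre_inner G x (S \<eta>) \<xi> = fibre_inner G x \<eta> (A \<xi>)"
  using assms by (auto simp: adjoint_pair_def)

lemma adjoint_pair_sym: "adjoint_pair G S A \<Longrightarrow> adjoint_pair G A S"
  unfolding adjoint_pair_def by (metis cnj_fibre_inner)

lemma adjointable_iff:
  "S \<in> adjointable G \<longleftrightarrow> S \<in> extensional (L2 G) \<and> (\<exists>A. adjoint_pair G S A)"
proof
  assume "S \<in> adjointable G"
  then obtain A where A: "S \<in> L2 G \<rightarrow>\<^sub>E L2 G" "A \<in> L2 G \<rightarrow>\<^sub>E L2 G"
    "\<forall>\<eta>\<in>L2 G. \<forall>\<xi>\<in>L2 G. module_inner G (S \<eta>) \<xi> = module_inner G \<eta> (A \<xi>)"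
    unfolding adjointable_def by blast
  then have "adjoint_pair G S A"
    unfolding adjoint_pair_def module_inner_def fun_eq_iff by (auto simp: PiE_iff)
  then show "S \<in> extensional (L2 G) \<and> (\<exists>A. adjoint_pair G S A)"
    using A(1) by (auto simp: PiE_iff)
next
  assume "S \<in> extensional (L2 G) \<and> (\<exists>A. adjoint_pair G S A)"
  then obtain A where S: "S \<in> extensional (L2 G)" and A: "adjoint_pair G S A" by blast
  have "restrict A (L2 G) \<in> L2 G \<rightarrow>\<^sub>E L2 G" "S \<in> L2 G \<rightarrow>\<^sub>E L2 G"
    using S adjoint_pairD(1,2)[OF A] by (auto simp: PiE_iff)
  moreover have "\<forall>\<eta>\<in>L2 G. \<forall>\<xi>\<in>L2 G. module_inner G (S \<eta>) \<xi> = module_inner G \<eta> (restrict A (L2 G) \<xi>)"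
    using adjoint_pairD(3)[OF A] by (auto simp: module_inner_def fun_eq_iff)
  ultimately show "S \<in> adjointable G" unfolding adjointable_def by blast
qed

context lc_etale_groupoid
begin

lemma delta_lift:
  assumes "\<gamma> \<in> fibre G x"
  obtains h where "h \<in> cont_compact_supp" "fibre_restrict G x h = delta \<gamma>"
proof -
  have "on_set {\<gamma>} (\<lambda>_. 1) = delta \<gamma>" by (auto simp: on_set_def delta_def)
  then show thesis
    using finite_support_lift[of "{\<gamma>}" x "\<lambda>_. 1"] assms that by auto
qed

lemma fibre_inner_restrict_left: "fibre_inner G x (fibre_restrict G x v) w = fibre_inner G x v w"
  by (rule fibre_inner_cong) (auto simp: fibre_restrict_def)

lemma fibre_inner_restrict_right: "fibre_inner G x v (fibre_restrict G x w) = fibre_inner G x v w"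
  by (rule fibre_inner_cong) (auto simp: fibre_restrict_def)

text \<open>The point mass at \<gamma> is the restriction of h, so evaluation at \<gamma> is an
  inner product whose operator can be moved to the other side. In particular
  \<open>S \<xi> \<gamma>\<close> sees \<xi> only on the fibre of \<gamma>.\<close>

lemma adjoint_pair_value:
  assumes P: "adjoint_pair G S A" and h: "h \<in> L2 G" "fibre_restrict G x h = delta \<gamma>"
    and \<gamma>: "\<gamma> \<in> fibre G x" and \<xi>: "\<xi> \<in> L2 G"
  shows "S \<xi> \<gamma> = fibre_inner G x (A h) \<xi>"
proof -
  have "S \<xi> \<gamma> = fibre_inner G x (fibre_restrict G x h) (S \<xi>)" using \<gamma> h(2) by simp
  also have "\<dots> = fibre_inner G x h (S \<xi>)" by (rule fibre_inner_restrict_left)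
  also have "\<dots> = fibre_inner G x (A h) \<xi>"
    using adjoint_pairD(3)[OF adjoint_pair_sym[OF P] h(1) \<xi>] by simp
  finally show ?thesis .
qed

lemma adjoint_pair_scale:
  assumes P: "adjoint_pair G S A" and \<xi>: "\<xi> \<in> L2 G" "(\<lambda>\<gamma>. c * \<xi> \<gamma>) \<in> L2 G"
  shows "S (\<lambda>\<gamma>. c * \<xi> \<gamma>) = (\<lambda>\<gamma>. c * S \<xi> \<gamma>)"
proof
  fix \<gamma>
  obtain h where h: "h \<in> cont_compact_supp" "fibre_restrict G (gsrc G \<gamma>) h = delta \<gamma>"
    using delta_lift[of \<gamma> "gsrc G \<gamma>"] by auto
  note val = adjoint_pair_value[OF P cont_compact_supp_L2[OF h(1)] h(2)]
  show "S (\<lambda>\<gamma>. c * \<xi> \<gamma>) \<gamma> = c * S \<xi> \<gamma>"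
    using \<xi> by (simp add: val fibre_inner_scale_right)
qed

text \<open>A truncation of v that retains at least half of its norm is lifted and normalised; its
  pairing with v has modulus equal to the norm N of the truncation. The lift is no larger on the
  other fibres, so the result lies in the unit ball of the module.\<close>

lemma almost_norming_vector:
  assumes v: "square_summable G x v" "fibre_norm G x v > 0"
  obtains e where "e \<in> cont_compact_supp" "\<And>y. fibre_norm G y e \<le> 1"
    "fibre_norm G x v / 2 \<le> cmod (fibre_inner G x v e)"
proof -
  have "\<forall>\<^sub>F F in finite_subsets_at_top (fibre G x). fibre_norm G x (\<lambda>\<gamma>. v \<gamma> - on_set F v \<gamma>) < fibre_norm G x v / 2"
    using order_tendstoD(2)[OF fibre_norm_tail_tendsto[OF v(1)], of "fibre_norm G x v / 2"] v(2) by simp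
  then obtain F where F: "finite F" "F \<subseteq> fibre G x"
    "fibre_norm G x (\<lambda>\<gamma>. v \<gamma> - on_set F v \<gamma>) < fibre_norm G x v / 2"
    unfolding eventually_finite_subsets_at_top by blast
  define N where "N = fibre_norm G x (on_set F v)"
  note w = fibre_l2D(1)[OF on_set_fibre_l2[OF F(1,2), of v]]
  have "fibre_norm G x v \<le> fibre_norm G x (\<lambda>\<gamma>. v \<gamma> - on_set F v \<gamma>) + N"
    using square_summable_add(2)[OF square_summable_diff(1)[OF v(1) w] w] by (simp add: N_def)
  then have N: "fibre_norm G x v / 2 \<le> N" "0 < N" using F(3) v(2) by auto
  obtain e where e: "e \<in> cont_compact_supp" "fibre_restrict G x e = on_set F v"
    "\<And>y. fibre_norm G y e \<le> N"
    unfolding N_def by (rule finite_support_lift[OF F(1,2), of v]) blast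
  define c where "c = complex_of_real (inverse N)"
  have c: "cmod c = inverse N" using N by (simp add: c_def norm_inverse)
  have "fibre_inner G x v e = fibre_inner G x v (on_set F v)"
    using fibre_inner_restrict_right[of x v e] e(2) by simp
  also have "\<dots> = fibre_inner G x (on_set F v) (on_set F v)"
    unfolding fibre_inner_def by (intro infsum_cong) (auto simp: on_set_def)
  also have "\<dots> = of_real (N\<^sup>2)" by (simp add: fibre_inner_self N_def)
  finally have f: "fibre_inner G x v e = of_real (N\<^sup>2)" .
  show thesis
  proof
    show "(\<lambda>\<gamma>. c * e \<gamma>) \<in> cont_compact_supp" by (rule cont_compact_supp_scale[OF e(1)])
    show "fibre_norm G y (\<lambda>\<gamma>. c * e \<gamma>) \<le> 1" for y
      using e(3)[of y] N(2) by (simp add: fibre_norm_scale c field_simps)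
    have "cmod (fibre_inner G x v (\<lambda>\<gamma>. c * e \<gamma>)) = N"
      using N(2) by (simp add: fibre_inner_scale_right f norm_mult c norm_power power2_eq_square)
    then show "fibre_norm G x v / 2 \<le> cmod (fibre_inner G x v (\<lambda>\<gamma>. c * e \<gamma>))" using N by simp
  qed
qed

text \<open>The constant 4/3 is the sum of all powers of 1/4: the steps from n on add up to at most
  \<open>4/3 * (1/4)^n\<close>.\<close>

lemma geometric_series_L2:
  assumes v: "\<And>n. v n \<in> cont_compact_supp"
    and step: "\<And>n y. fibre_norm G y (\<lambda>\<gamma>. v (Suc n) \<gamma> - v n \<gamma>) \<le> (1/4)^n"
  obtains \<xi> where "\<xi> \<in> L2 G" "\<And>n. fibrewise_close G (4/3 * (1/4)^n) \<xi> (v n)"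
proof -
  have sq: "square_summable G y (\<lambda>\<gamma>. v m \<gamma> - v n \<gamma>)" for y m n
    by (rule cont_compact_fibre_norm[OF cont_compact_supp_diff[OF v v]]) blast
  have tele: "fibre_norm G y (\<lambda>\<gamma>. v (n + k) \<gamma> - v n \<gamma>) \<le> 4/3 * ((1/4)^n - (1/4)^(n + k))" for y n k
  proof (induction k)
    case (Suc k)
    have "fibre_norm G y (\<lambda>\<gamma>. v (n + Suc k) \<gamma> - v n \<gamma>)
        = fibre_norm G y (\<lambda>\<gamma>. (v (Suc (n + k)) \<gamma> - v (n + k) \<gamma>) + (v (n + k) \<gamma> - v n \<gamma>))" by simp
    also have "\<dots> \<le> fibre_norm G y (\<lambda>\<gamma>. v (Suc (n + k)) \<gamma> - v (n + k) \<gamma>) + fibre_norm G y (\<lambda>\<gamma>. v (n + k) \<gamma> - v n \<gamma>)"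
      by (rule square_summable_add(2)[OF sq sq])
    also have "\<dots> \<le> (1/4)^(n + k) + 4/3 * ((1/4)^n - (1/4)^(n + k))"
      by (intro add_mono step Suc.IH)
    also have "\<dots> = 4/3 * ((1/4)^n - (1/4)^(n + Suc k))" by (simp add: field_simps)
    finally show ?case .
  qed simp
  have close: "fibre_norm G y (\<lambda>\<gamma>. v m \<gamma> - v n \<gamma>) \<le> 4/3 * (1/4)^n" if "m \<ge> n" for m n y
  proof -
    have "fibre_norm G y (\<lambda>\<gamma>. v m \<gamma> - v n \<gamma>) \<le> 4/3 * ((1/4)^n - (1/4)^m)"
      using tele[of y n "m - n"] le_add_diff_inverse[OF that] by (simp only:)
    also have "\<dots> \<le> 4/3 * (1/4)^n" by (intro mult_left_mono) simp_all
    finally show ?thesis .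
  qed
  have "\<exists>l. (\<lambda>n. v n \<gamma>) \<longlonglongrightarrow> l" for \<gamma>
  proof -
    have "cmod (v (Suc n) \<gamma> - v n \<gamma>) \<le> (1/4)^n" for n
      using cmod_le_fibre_norm[OF sq, of \<gamma> "gsrc G \<gamma>" "Suc n" n] step[of "gsrc G \<gamma>" n] by simp
    then have "summable (\<lambda>n. v (Suc n) \<gamma> - v n \<gamma>)"
      by (intro summable_comparison_test[OF _ summable_geometric[of "1/4::real"]]) auto
    then have "(\<lambda>n. \<Sum>k<n. v (Suc k) \<gamma> - v k \<gamma>) \<longlonglongrightarrow> (\<Sum>k. v (Suc k) \<gamma> - v k \<gamma>)"
      by (rule summable_LIMSEQ)
    then have "(\<lambda>n. v n \<gamma> - v 0 \<gamma>) \<longlonglongrightarrow> (\<Sum>k. v (Suc k) \<gamma> - v k \<gamma>)"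
      by (simp only: sum_lessThan_telescope[of "\<lambda>k. v k \<gamma>"])
    from tendsto_add[OF this tendsto_const[of "v 0 \<gamma>"]] show ?thesis by auto
  qed
  then obtain \<xi> where \<xi>: "\<And>\<gamma>. (\<lambda>n. v n \<gamma>) \<longlonglongrightarrow> \<xi> \<gamma>" by metis
  have c: "fibrewise_close G (4/3 * (1/4)^n) \<xi> (v n)" for n
    unfolding fibrewise_close_def
    using fibre_norm_limit[of G _ v \<xi> n "v n" "4/3 * (1/4)^n", OF \<xi> sq close] by blast
  have "\<xi> \<in> L2 G"
  proof (rule L2_closed)
    fix \<epsilon> :: real assume "\<epsilon> > 0"
    have "(\<lambda>n. 4/3 * (1/4::real)^n) \<longlonglongrightarrow> 4/3 * 0"
      by (intro tendsto_mult_left LIMSEQ_power_zero) simp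
    then have "\<forall>\<^sub>F n in sequentially. 4/3 * (1/4::real)^n < \<epsilon>"
      using \<open>\<epsilon> > 0\<close> by (intro order_tendstoD(2)) auto
    then obtain n where "4/3 * (1/4::real)^n < \<epsilon>" using eventually_happens by force
    then have "fibrewise_close G \<epsilon> \<xi> (v n)"
      using c[of n] unfolding fibrewise_close_def by (meson less_imp_le order_trans)
    then show "\<exists>\<eta>\<in>L2 G. fibrewise_close G \<epsilon> \<xi> \<eta>" using cont_compact_supp_L2[OF v] by blast
  qed
  then show thesis using c by (rule that)
qed

text \<open>A gliding hump argument. Were the image of the unit ball unbounded at \<open>x\<close>, signed sums of
  vectors almost norming its elements would converge to a vector on which the functionals
  \<open>\<langle>S u\<^sub>n, _\<rangle> = \<langle>u\<^sub>n, A _\<rangle>\<close> are unbounded.\<close>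

lemma adjoint_pair_bounded_unit_ball:
  assumes P: "adjoint_pair G S A"
  shows "\<exists>C. \<forall>u\<in>cont_compact_supp. (\<forall>y. fibre_norm G y u \<le> 1) \<longrightarrow> fibre_norm G x (S u) \<le> C"
proof (rule ccontr)
  assume "\<not> ?thesis"
  \<comment> \<open>The growth rate is dictated by the estimate below: the n-th hump secures at
    least \<open>(1/4)^n * M n / 2\<close>, everything after it changes this by at most
    \<open>4/3 * (1/4)^Suc n * M n\<close>, which is \<open>(1/4)^n * M n / 3\<close>, and the
    difference \<open>(1/4)^n * M n / 6\<close> has to exceed n.\<close>
  then have "\<forall>n. \<exists>u. u \<in> cont_compact_supp \<and> (\<forall>y. fibre_norm G y u \<le> 1) \<and>
      6 * real n * 4^n < fibre_norm G x (S u)"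
    by (meson not_le)
  then obtain u where u: "\<And>n. u n \<in> cont_compact_supp" "\<And>n y. fibre_norm G y (u n) \<le> 1"
    "\<And>n. 6 * real n * 4^n < fibre_norm G x (S (u n))" by metis
  define M where "M n = fibre_norm G x (S (u n))" for n
  have uL: "u n \<in> L2 G" for n by (rule cont_compact_supp_L2[OF u(1)])
  have sS: "square_summable G x (S (u n))" for n
    by (rule L2_square_summable[OF adjoint_pairD(1)[OF P uL]])
  have Mpos: "0 < M n" for n
    using u(3)[of n] unfolding M_def by (rule le_less_trans[rotated]) simp
  define f where "f n \<eta> = fibre_inner G x (S (u n)) \<eta>" for n \<eta>
  have "\<forall>n. \<exists>e. e \<in> cont_compact_supp \<and> (\<forall>y. fibre_norm G y e \<le> 1) \<and> M n / 2 \<le> cmod (f n e)"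
    unfolding f_def M_def
    using almost_norming_vector[OF sS Mpos[unfolded M_def]] by metis
  then obtain e where e: "\<And>n. e n \<in> cont_compact_supp" "\<And>n y. fibre_norm G y (e n) \<le> 1"
    "\<And>n. M n / 2 \<le> cmod (f n (e n))" by metis
  have sC: "square_summable G y w" if "w \<in> cont_compact_supp" for w y
    by (rule cont_compact_fibre_norm[OF that]) blast
  have fadd: "f n (\<lambda>\<gamma>. w \<gamma> + c * e k \<gamma>) = f n w + c * f n (e k)" if "square_summable G x w" for n w c k
    unfolding f_def using that sS square_summable_scale[OF sC[OF e(1)]]
    by (simp add: fibre_inner_add_right fibre_inner_scale_right)
  define q where "q n = complex_of_real ((1/4)^n)" for n
  \<comment> \<open>For any a, one of |a + b| and |a - b| is at least |b|, because 2b is the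
    difference of a + b and a - b. The sign is chosen accordingly, so that earlier terms cannot
    cancel the n-th hump.\<close>
  define next_sum where "next_sum n w = (if cmod (q n * f n (e n)) \<le> cmod (f n (\<lambda>\<gamma>. w \<gamma> + q n * e n \<gamma>))
      then (\<lambda>\<gamma>. w \<gamma> + q n * e n \<gamma>) else (\<lambda>\<gamma>. w \<gamma> + - q n * e n \<gamma>))" for n w
  define v where "v = rec_nat (\<lambda>\<gamma>. 0) next_sum"
  have v0: "v 0 = (\<lambda>\<gamma>. 0)" and vSuc: "v (Suc n) = next_sum n (v n)" for n
    by (simp_all add: v_def)
  have vC: "v n \<in> cont_compact_supp" for n
  proof (induction n)
    case 0
    show ?case by (simp add: v0 cont_compact_supp_zero)
  next
    case (Suc n)
    have "(\<lambda>\<gamma>. v n \<gamma> + c * e n \<gamma>) \<in> cont_compact_supp" for c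
      by (rule cont_compact_supp_add[OF Suc cont_compact_supp_scale[OF e(1)]])
    from this[of "q n"] this[of "- q n"] show ?case by (simp add: vSuc next_sum_def)
  qed
  have step: "fibre_norm G y (\<lambda>\<gamma>. v (Suc n) \<gamma> - v n \<gamma>) \<le> (1/4)^n" for n y
  proof -
    have q: "cmod (q n) = (1/4)^n" by (simp add: q_def norm_power norm_divide)
    consider "v (Suc n) = (\<lambda>\<gamma>. v n \<gamma> + q n * e n \<gamma>)" | "v (Suc n) = (\<lambda>\<gamma>. v n \<gamma> + - q n * e n \<gamma>)"
      unfolding vSuc next_sum_def by presburger
    then obtain c where "(\<lambda>\<gamma>. v (Suc n) \<gamma> - v n \<gamma>) = (\<lambda>\<gamma>. c * e n \<gamma>)" "cmod c = (1/4)^n"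
    proof cases
      case 1
      then show ?thesis using q by (intro that[of "q n"]) (auto simp: fun_eq_iff)
    next
      case 2
      then show ?thesis using q by (intro that[of "- q n"]) (auto simp: fun_eq_iff)
    qed
    then show ?thesis using e(2)[of y n] mult_left_mono[of "fibre_norm G y (e n)" 1 "(1/4)^n"]
      by (simp add: fibre_norm_scale)
  qed
  have large: "(1/4)^n * (M n / 2) \<le> cmod (f n (v (Suc n)))" for n
  proof -
    have "(1/4)^n * (M n / 2) \<le> (1/4)^n * cmod (f n (e n))" using e(3)[of n] by (intro mult_left_mono) auto
    also have "\<dots> = cmod (q n * f n (e n))" by (simp add: q_def norm_mult norm_power norm_divide)
    also have "\<dots> \<le> cmod (f n (v (Suc n)))"
    proof (cases "cmod (q n * f n (e n)) \<le> cmod (f n (\<lambda>\<gamma>. v n \<gamma> + q n * e n \<gamma>))")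
      case True
      then show ?thesis by (simp add: vSuc next_sum_def)
    next
      case False
      let ?a = "f n (v n)" and ?b = "q n * f n (e n)"
      have "cmod (?a + ?b) < cmod ?b" using False by (simp add: fadd[OF sC[OF vC]])
      moreover have "2 * cmod ?b \<le> cmod (?a + ?b) + cmod (?a - ?b)"
      proof -
        have "cmod (2 * ?b) = cmod ((?a + ?b) - (?a - ?b))" by (simp add: algebra_simps)
        also have "\<dots> \<le> cmod (?a + ?b) + cmod (?a - ?b)" by (rule norm_triangle_ineq4)
        finally show ?thesis by (simp add: norm_mult)
      qed
      moreover have "f n (v (Suc n)) = ?a - ?b"
        using False fadd[OF sC[OF vC], of n n "- q n" n] by (simp add: vSuc next_sum_def)
      ultimately show ?thesis by simp
    qed
    finally show ?thesis .
  qed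
  obtain \<xi> where \<xi>: "\<xi> \<in> L2 G" "\<And>n. fibrewise_close G (4/3 * (1/4)^n) \<xi> (v n)"
    by (rule geometric_series_L2[OF vC step]) blast
  have lower: "real n \<le> cmod (f n \<xi>)" for n
  proof -
    let ?w = "v (Suc n)"
    have s: "square_summable G x (\<lambda>\<gamma>. \<xi> \<gamma> - ?w \<gamma>)" "fibre_norm G x (\<lambda>\<gamma>. \<xi> \<gamma> - ?w \<gamma>) \<le> 4/3 * (1/4)^Suc n"
      using \<xi>(2)[of "Suc n"] unfolding fibrewise_close_def by blast+
    have "f n \<xi> = f n (\<lambda>\<gamma>. ?w \<gamma> + (\<xi> \<gamma> - ?w \<gamma>))" by simp
    also have "\<dots> = f n ?w + f n (\<lambda>\<gamma>. \<xi> \<gamma> - ?w \<gamma>)"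
      unfolding f_def by (rule fibre_inner_add_right[OF sS sC[OF vC] s(1)])
    finally have eq: "f n \<xi> = f n ?w + f n (\<lambda>\<gamma>. \<xi> \<gamma> - ?w \<gamma>)" .
    have "cmod (f n (\<lambda>\<gamma>. \<xi> \<gamma> - ?w \<gamma>)) \<le> M n * fibre_norm G x (\<lambda>\<gamma>. \<xi> \<gamma> - ?w \<gamma>)"
      unfolding f_def M_def by (rule fibre_inner_summable(2)[OF sS s(1)])
    also have "\<dots> \<le> M n * (4/3 * (1/4)^Suc n)"
      using s(2) Mpos[of n] by (intro mult_left_mono) auto
    finally have "cmod (f n (\<lambda>\<gamma>. \<xi> \<gamma> - ?w \<gamma>)) \<le> (1/4)^n * M n / 3" by (simp add: mult.commute)
    moreover have "cmod (f n ?w) \<le> cmod (f n \<xi>) + cmod (f n (\<lambda>\<gamma>. \<xi> \<gamma> - ?w \<gamma>))"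
      unfolding eq by (metis add_diff_cancel_right' norm_triangle_ineq4)
    moreover have "real n \<le> (1/4)^n * M n / 6"
      using u(3)[of n] unfolding M_def by (simp add: field_simps power_divide)
    ultimately show ?thesis using large[of n] by simp
  qed
  have upper: "cmod (f n \<xi>) \<le> fibre_norm G x (A \<xi>)" for n
  proof -
    have "f n \<xi> = fibre_inner G x (u n) (A \<xi>)" unfolding f_def by (rule adjoint_pairD(3)[OF P uL \<xi>(1)])
    then have "cmod (f n \<xi>) \<le> fibre_norm G x (u n) * fibre_norm G x (A \<xi>)"
      using fibre_inner_summable(2)[OF sC[OF u(1)] L2_square_summable[OF adjoint_pairD(2)[OF P \<xi>(1)]]] by simp
    also have "\<dots> \<le> 1 * fibre_norm G x (A \<xi>)" by (intro mult_right_mono u(2)) simp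
    finally show ?thesis by simp
  qed
  obtain n where "fibre_norm G x (A \<xi>) < real n" using reals_Archimedean2 by blast
  then show False using lower[of n] upper[of n] by linarith
qed

lemma adjoint_pair_bounded:
  assumes P: "adjoint_pair G S A"
  obtains C where "0 \<le> C" "\<And>u c. u \<in> cont_compact_supp \<Longrightarrow> (\<And>y. fibre_norm G y u \<le> c) \<Longrightarrow> fibre_norm G x (S u) \<le> C * c"
proof -
  obtain C where C: "\<And>u. u \<in> cont_compact_supp \<Longrightarrow> (\<And>y. fibre_norm G y u \<le> 1) \<Longrightarrow> fibre_norm G x (S u) \<le> C"
    using adjoint_pair_bounded_unit_ball[OF P, of x] by blast
  have C0: "0 \<le> C" using order_trans[OF fibre_norm_nonneg C[OF cont_compact_supp_zero]] by simp
  have *: "fibre_norm G x (S u) \<le> C * c" if u: "u \<in> cont_compact_supp" "\<And>y. fibre_norm G y u \<le> c" "c > 0" for u c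
  proof -
    let ?k = "complex_of_real (inverse c)"
    have k: "cmod ?k = inverse c" using u(3) by (simp add: norm_inverse)
    have "fibre_norm G x (S (\<lambda>\<gamma>. ?k * u \<gamma>)) \<le> C"
    proof (rule C)
      show "(\<lambda>\<gamma>. ?k * u \<gamma>) \<in> cont_compact_supp" by (rule cont_compact_supp_scale[OF u(1)])
      show "fibre_norm G y (\<lambda>\<gamma>. ?k * u \<gamma>) \<le> 1" for y
        using u(2)[of y] u(3) unfolding fibre_norm_scale k by (simp add: field_simps)
    qed
    moreover have "S (\<lambda>\<gamma>. ?k * u \<gamma>) = (\<lambda>\<gamma>. ?k * S u \<gamma>)"
      by (intro adjoint_pair_scale[OF P] cont_compact_supp_L2 cont_compact_supp_scale u(1))
    ultimately have "inverse c * fibre_norm G x (S u) \<le> C" by (simp only: fibre_norm_scale k)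
    then show ?thesis using u(3) by (simp add: field_simps)
  qed
  show thesis
  proof (rule that[OF C0])
    fix u c assume u: "u \<in> cont_compact_supp" "\<And>y. fibre_norm G y u \<le> c"
    have c: "0 \<le> c" using order_trans[OF fibre_norm_nonneg u(2)] .
    show "fibre_norm G x (S u) \<le> C * c"
    proof (rule field_le_epsilon)
      fix d :: real assume "d > 0"
      \<comment> \<open>Scaling into the unit ball requires a positive c, but c may be 0. Enlarging
        c by \<open>d / (C + 1)\<close> costs at most d.\<close>
      have "C * (d / (C + 1)) \<le> d" using C0 \<open>d > 0\<close> by (simp add: field_simps)
      moreover have "fibre_norm G x (S u) \<le> C * (c + d / (C + 1))"
      proof (rule *[OF u(1)])
        have "0 < d / (C + 1)" using \<open>d > 0\<close> C0 by simp
        then show "0 < c + d / (C + 1)" "fibre_norm G y u \<le> c + d / (C + 1)" for y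
          using c u(2)[of y] by simp_all
      qed
      ultimately show "fibre_norm G x (S u) \<le> C * c + d" by (simp add: distrib_left)
    qed
  qed
qed

text \<open>\<open>slice\<close> selects the operator with this property by definite description, so
  it has meaning only where \<open>is_slice_exists\<close> and \<open>is_slice_unique\<close>
  apply.\<close>

definition is_slice :: "'g \<Rightarrow> 'g operator \<Rightarrow> 'g operator \<Rightarrow> bool" where
  "is_slice x S R \<longleftrightarrow> R \<in> fibre_operators G x \<and>
     (\<forall>\<xi>\<in>L2 G. R (fibre_restrict G x \<xi>) = fibre_restrict G x (S \<xi>))"

lemma is_slice_unique:
  assumes "is_slice x S R" "is_slice x S R'"
  shows "R = R'"
proof (rule fibre_operators_eqI)
  fix \<beta> \<gamma> assume "\<beta> \<in> fibre G x"
  then obtain h where "h \<in> cont_compact_supp" "fibre_restrict G x h = delta \<beta>" by (rule delta_lift)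
  then show "R (delta \<beta>) \<gamma> = R' (delta \<beta>) \<gamma>"
    using assms cont_compact_supp_L2[of h] unfolding is_slice_def by metis
qed (use assms in \<open>auto simp: is_slice_def\<close>)

lemma slice_eq_iff:
  assumes "\<exists>R. is_slice x S R"
  shows "slice G x S = R \<longleftrightarrow> is_slice x S R"
proof -
  have "is_slice x S (slice G x S)"
    using assms is_slice_unique theI'[of "is_slice x S"] unfolding slice_def is_slice_def[symmetric] by blast
  then show ?thesis using is_slice_unique by blast
qed

text \<open>The value of R v at \<gamma> is forced by \<open>adjoint_pair_value\<close>: it is
  \<open>\<langle>A (h \<gamma>), v\<rangle>\<close>. Boundedness follows by duality from the bound
  for A on \<open>C\<^sub>c\<close>: with w a lift of a truncation of \<open>r v\<close>, pairing
  that truncation with \<open>r v\<close> amounts, up to conjugation, to pairing v with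
  \<open>A w\<close>.\<close>

lemma is_slice_exists:
  assumes P: "adjoint_pair G S A"
  shows "\<exists>R. is_slice x S R"
proof -
  have "\<forall>\<gamma>. \<exists>h. \<gamma> \<in> fibre G x \<longrightarrow> h \<in> cont_compact_supp \<and> fibre_restrict G x h = delta \<gamma>"
    using delta_lift by metis
  then obtain h where h: "\<And>\<gamma>. \<gamma> \<in> fibre G x \<Longrightarrow> h \<gamma> \<in> cont_compact_supp"
    "\<And>\<gamma>. \<gamma> \<in> fibre G x \<Longrightarrow> fibre_restrict G x (h \<gamma>) = delta \<gamma>" by metis
  have hL: "h \<gamma> \<in> L2 G" if "\<gamma> \<in> fibre G x" for \<gamma> by (rule cont_compact_supp_L2[OF h(1)[OF that]])
  have AL: "A (h \<gamma>) \<in> L2 G" if "\<gamma> \<in> fibre G x" for \<gamma> by (rule adjoint_pairD(2)[OF P hL[OF that]])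
  define r where "r v \<gamma> = (if \<gamma> \<in> fibre G x then fibre_inner G x (A (h \<gamma>)) v else 0)" for v \<gamma>
  obtain C where C: "0 \<le> C"
    "\<And>u c. u \<in> cont_compact_supp \<Longrightarrow> (\<And>y. fibre_norm G y u \<le> c) \<Longrightarrow> fibre_norm G x (A u) \<le> C * c"
    using adjoint_pair_bounded[OF adjoint_pair_sym[OF P], of x] by metis
  have b: "square_summable G x (r v) \<and> fibre_norm G x (r v) \<le> C * fibre_norm G x v"
    if v: "v \<in> fibre_l2 G x" for v
  proof -
    have "cmod (fibre_inner G x (on_set F (r v)) (r v)) \<le> (C * fibre_norm G x v) * fibre_norm G x (on_set F (r v))"
      if F: "finite F" "F \<subseteq> fibre G x" for F
    proof -
      obtain w where w: "w \<in> cont_compact_supp" "fibre_restrict G x w = on_set F (r v)"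
        "\<And>y. fibre_norm G y w \<le> fibre_norm G x (on_set F (r v))"
        by (rule finite_support_lift[OF F]) blast
      have wL: "w \<in> L2 G" by (rule cont_compact_supp_L2[OF w(1)])
      \<comment> \<open>The lift w and the combination of the lifts \<open>h \<gamma>\<close> are
        only known to agree on the fibre at x. This suffices, since the values of \<open>A w\<close>
        there are determined by the restriction of w.\<close>
      have Aw: "A w \<beta> = (\<Sum>\<gamma>\<in>F. r v \<gamma> * A (h \<gamma>) \<beta>)" if \<beta>: "\<beta> \<in> fibre G x" for \<beta>
      proof -
        note val = adjoint_pair_value[OF adjoint_pair_sym[OF P] hL[OF \<beta>] h(2)[OF \<beta>] \<beta>]
        have 1: "A (h \<gamma>) \<beta> = cnj (S (h \<beta>) \<gamma>)" if "\<gamma> \<in> F" for \<gamma>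
        proof -
          have \<gamma>: "\<gamma> \<in> fibre G x" using that F by blast
          have "A (h \<gamma>) \<beta> = fibre_inner G x (S (h \<beta>)) (fibre_restrict G x (h \<gamma>))"
            by (simp add: val[OF hL[OF \<gamma>]] fibre_inner_restrict_right)
          also have "\<dots> = cnj (fibre_inner G x (delta \<gamma>) (S (h \<beta>)))"
            by (simp only: h(2)[OF \<gamma>] cnj_fibre_inner)
          also have "\<dots> = cnj (S (h \<beta>) \<gamma>)" by (simp add: \<gamma>)
          finally show ?thesis .
        qed
        have "A w \<beta> = fibre_inner G x (S (h \<beta>)) (fibre_restrict G x w)"
          by (simp add: val[OF wL] fibre_inner_restrict_right)
        also have "\<dots> = cnj (fibre_inner G x (on_set F (r v)) (S (h \<beta>)))"
          by (simp only: w(2) cnj_fibre_inner)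
        also have "\<dots> = (\<Sum>\<gamma>\<in>F. r v \<gamma> * A (h \<gamma>) \<beta>)"
          by (simp add: fibre_inner_on_set_left[OF F] 1)
        finally show ?thesis .
      qed
      have sA: "square_summable G x (A (h \<gamma>))" if "\<gamma> \<in> F" for \<gamma>
        using F that AL by (intro L2_square_summable) blast
      have sum_inner: "fibre_inner G x v (\<lambda>\<beta>. \<Sum>\<gamma>\<in>E. r v \<gamma> * A (h \<gamma>) \<beta>) = (\<Sum>\<gamma>\<in>E. r v \<gamma> * fibre_inner G x v (A (h \<gamma>)))
          \<and> square_summable G x (\<lambda>\<beta>. \<Sum>\<gamma>\<in>E. r v \<gamma> * A (h \<gamma>) \<beta>)" if "E \<subseteq> F" for E
        using finite_subset[OF that F(1)] that
      proof (induction E)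
        case empty
        show ?case by (simp add: fibre_inner_def)
      next
        case (insert \<gamma> E)
        then have s: "square_summable G x (\<lambda>\<beta>. r v \<gamma> * A (h \<gamma>) \<beta>)"
          and IH: "fibre_inner G x v (\<lambda>\<beta>. \<Sum>\<gamma>\<in>E. r v \<gamma> * A (h \<gamma>) \<beta>) = (\<Sum>\<gamma>\<in>E. r v \<gamma> * fibre_inner G x v (A (h \<gamma>)))"
            "square_summable G x (\<lambda>\<beta>. \<Sum>\<gamma>\<in>E. r v \<gamma> * A (h \<gamma>) \<beta>)"
          by (auto intro!: square_summable_scale[OF sA])
        show ?case
          using insert.hyps IH(1) square_summable_add(1)[OF s IH(2)]
            fibre_inner_add_right[OF fibre_l2D(1)[OF v] s IH(2)]
          by (simp add: fibre_inner_scale_right)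
      qed
      have "fibre_inner G x (on_set F (r v)) (r v) = (\<Sum>\<gamma>\<in>F. cnj (r v \<gamma>) * fibre_inner G x (A (h \<gamma>)) v)"
        using F by (simp add: fibre_inner_on_set_left[OF F]) (intro sum.cong, auto simp: r_def)
      also have "\<dots> = cnj (\<Sum>\<gamma>\<in>F. r v \<gamma> * fibre_inner G x v (A (h \<gamma>)))"
        by (simp add: cnj_fibre_inner)
      also have "\<dots> = cnj (fibre_inner G x v (A w))"
        using sum_inner[OF order_refl] fibre_inner_cong[of G x v v "A w"] Aw by simp
      finally have "cmod (fibre_inner G x (on_set F (r v)) (r v)) = cmod (fibre_inner G x v (A w))" by simp
      also have "\<dots> \<le> fibre_norm G x v * fibre_norm G x (A w)"
        by (rule fibre_inner_summable(2)[OF fibre_l2D(1)[OF v] L2_square_summable[OF adjoint_pairD(2)[OF P wL]]])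
      also have "\<dots> \<le> fibre_norm G x v * (C * fibre_norm G x (on_set F (r v)))"
        by (intro mult_left_mono C(2)[OF w(1)] w(3)) simp
      finally show ?thesis by (simp add: mult_ac)
    qed
    note bound = this
    have nn: "0 \<le> C * fibre_norm G x v" using C(1) by simp
    show ?thesis using fibre_norm_le_by_duality[OF nn bound] by blast
  qed
  have rL: "r v \<in> fibre_l2 G x" if "v \<in> fibre_l2 G x" for v
    using b[OF that] by (auto simp: fibre_l2_iff r_def)
  define R where "R = restrict r (fibre_l2 G x)"
  have R: "R v = r v" if "v \<in> fibre_l2 G x" for v using that by (simp add: R_def)
  have 1: "R \<in> fibre_l2 G x \<rightarrow>\<^sub>E fibre_l2 G x" using rL by (auto simp: R_def)
  have 2: "R (\<lambda>\<gamma>. v \<gamma> + w \<gamma>) = (\<lambda>\<gamma>. R v \<gamma> + R w \<gamma>)" if "v \<in> fibre_l2 G x" "w \<in> fibre_l2 G x" for v w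
    using that AL by (auto simp: R fibre_l2_add r_def fibre_inner_add_right L2_square_summable fibre_l2D(1))
  have 3: "R (\<lambda>\<gamma>. c * v \<gamma>) = (\<lambda>\<gamma>. c * R v \<gamma>)" if "v \<in> fibre_l2 G x" for v c
    using that by (auto simp: R fibre_l2_scale r_def fibre_inner_scale_right)
  have 4: "\<exists>C. \<forall>v\<in>fibre_l2 G x. fibre_norm G x (R v) \<le> C * fibre_norm G x v"
    using b by (intro exI[of _ C]) (simp add: R)
  have "R \<in> fibre_operators G x"
    unfolding fibre_operators_def mem_Collect_eq
    by (intro conjI 1 4 ballI allI) (simp_all add: 2 3)
  moreover have "R (fibre_restrict G x \<xi>) = fibre_restrict G x (S \<xi>)" if \<xi>: "\<xi> \<in> L2 G" for \<xi>
  proof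
    fix \<gamma>
    show "R (fibre_restrict G x \<xi>) \<gamma> = fibre_restrict G x (S \<xi>) \<gamma>"
      using adjoint_pair_value[OF P hL h(2) _ \<xi>, of \<gamma>]
      by (simp add: R[OF L2_restrict[OF \<xi>]] r_def fibre_inner_restrict_right) (simp add: fibre_restrict_def)
  qed
  ultimately show ?thesis unfolding is_slice_def by blast
qed

end

section \<open>From operators to families\<close>

lemma atin_top_of_set:
  fixes a :: "'a::topological_space"
  assumes "a \<in> S"
  shows "atin (top_of_set S) a = at a within S"
  unfolding atin_subtopology_within[OF assms] filter_eq_iff eventually_atin_within eventually_at_topological
  by auto

lemma on_set_apply: "on_set F v \<gamma> = (if \<gamma> \<in> F then v \<gamma> else 0)"
  by (simp add: on_set_def)

lemma fibre_operator_family_bound: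
  assumes "T \<in> bounded_operator_families G"
  obtains C where "0 \<le> C" "\<And>x v. x \<in> units G \<Longrightarrow> v \<in> fibre_l2 G x \<Longrightarrow> fibre_norm G x (T x v) \<le> C * fibre_norm G x v"
proof -
  obtain C where C: "\<And>x. x \<in> units G \<Longrightarrow> fibre_op_norm G x (T x) \<le> C"
    and T: "\<And>x. x \<in> units G \<Longrightarrow> T x \<in> fibre_operators G x"
    using assms unfolding bounded_operator_families_def by blast
  show thesis
  proof
    show "0 \<le> \<bar>C\<bar>" by simp
    fix x v assume x: "x \<in> units G" and v: "v \<in> fibre_l2 G x"
    have "fibre_norm G x (T x v) \<le> fibre_op_norm G x (T x) * fibre_norm G x v"
      by (rule operator_norm_bound[OF T[OF x] v])
    also have "\<dots> \<le> \<bar>C\<bar> * fibre_norm G x v"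
      using C[OF x] by (intro mult_right_mono) auto
    finally show "fibre_norm G x (T x v) \<le> \<bar>C\<bar> * fibre_norm G x v" .
  qed
qed

lemma operator_on_finite_support:
  assumes S: "S \<in> fibre_operators G x" and F: "finite F" "F \<subseteq> fibre G x" and \<gamma>: "\<gamma> \<in> fibre G x"
  shows "S (on_set F v) \<gamma> = (\<Sum>\<beta>\<in>F. S (delta \<beta>) \<gamma> * v \<beta>)"
proof -
  have "((\<lambda>\<beta>. S (delta \<beta>) \<gamma> * on_set F v \<beta>) has_sum S (on_set F v) \<gamma>) (fibre G x)"
    by (rule operator_matrix_has_sum[OF S on_set_fibre_l2[OF F] \<gamma>])
  moreover have "((\<lambda>\<beta>. S (delta \<beta>) \<gamma> * on_set F v \<beta>) has_sum (\<Sum>\<beta>\<in>F. S (delta \<beta>) \<gamma> * v \<beta>)) (fibre G x)"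
    using F by (subst has_sum_cong_neutral[where T = F and g = "\<lambda>\<beta>. S (delta \<beta>) \<gamma> * v \<beta>"]) (auto simp: on_set_def)
  ultimately show ?thesis by (rule has_sum_unique)
qed

lemma indicator_fibre_l2: "v \<in> fibre_l2 G x \<Longrightarrow> (\<lambda>\<gamma>. indicator B \<gamma> * v \<gamma>) \<in> fibre_l2 G x"
  by (rule fibre_l2_mult[where c = 1]) (auto simp: indicator_def)

text \<open>The matrix expansion shows that S applied to finite truncations of the input converges
  entrywise, and a bound on the output need only be checked on finite sections. Uniform bounds for
  finite subsets thus pass to arbitrary A and B.\<close>

lemma mult_comp_indicator_bound:
  assumes S: "S \<in> fibre_operators G x" and v: "v \<in> fibre_l2 G x" and c: "0 \<le> c"
    and fin: "\<And>A\<^sub>0 B\<^sub>0. \<lbrakk>finite A\<^sub>0; A\<^sub>0 \<subseteq> A \<inter> fibre G x; finite B\<^sub>0; B\<^sub>0 \<subseteq> B \<inter> fibre G x\<rbrakk> \<Longrightarrow>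
           fibre_norm G x (on_set A\<^sub>0 (S (on_set B\<^sub>0 v))) \<le> c"
  shows "fibre_norm G x (mult_comp (indicator A) S (indicator B) v) \<le> c"
proof (rule square_summable_boundI(2)[OF c])
  fix E assume E: "finite E" "E \<subseteq> fibre G x"
  let ?w = "\<lambda>\<gamma>. indicator B \<gamma> * v \<gamma> :: complex"
  have A0: "finite (E \<inter> A)" "E \<inter> A \<subseteq> A \<inter> fibre G x" "E \<inter> A \<subseteq> fibre G x" using E by auto
  have lim: "((\<lambda>F. S (on_set (F \<inter> B) v) \<gamma>) \<longlongrightarrow> S ?w \<gamma>) (finite_subsets_at_top (fibre G x))"
    if \<gamma>: "\<gamma> \<in> fibre G x" for \<gamma>
  proof -
    have t: "((\<lambda>F. \<Sum>\<beta>\<in>F. S (delta \<beta>) \<gamma> * ?w \<beta>) \<longlongrightarrow> S ?w \<gamma>) (finite_subsets_at_top (fibre G x))"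
      using operator_matrix_has_sum[OF S indicator_fibre_l2[OF v] \<gamma>] by (simp add: has_sum_def)
    have "(\<Sum>\<beta>\<in>F. S (delta \<beta>) \<gamma> * ?w \<beta>) = S (on_set (F \<inter> B) v) \<gamma>" if F: "finite F" "F \<subseteq> fibre G x" for F
    proof -
      have "S (on_set (F \<inter> B) v) \<gamma> = (\<Sum>\<beta>\<in>F \<inter> B. S (delta \<beta>) \<gamma> * v \<beta>)"
        using F by (intro operator_on_finite_support[OF S _ _ \<gamma>]) auto
      also have "\<dots> = (\<Sum>\<beta>\<in>F. S (delta \<beta>) \<gamma> * ?w \<beta>)"
        using F(1) by (intro sum.mono_neutral_cong_left) auto
      finally show ?thesis by simp
    qed
    then have "\<forall>\<^sub>F F in finite_subsets_at_top (fibre G x). (\<Sum>\<beta>\<in>F. S (delta \<beta>) \<gamma> * ?w \<beta>) = S (on_set (F \<inter> B) v) \<gamma>"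
      by (rule eventually_finite_subsets_at_top_weakI)
    with t show ?thesis by (rule Lim_transform_eventually)
  qed
  have "((\<lambda>F. L2_set (\<lambda>\<gamma>. cmod (S (on_set (F \<inter> B) v) \<gamma>)) (E \<inter> A)) \<longlongrightarrow> L2_set (\<lambda>\<gamma>. cmod (S ?w \<gamma>)) (E \<inter> A))
      (finite_subsets_at_top (fibre G x))"
    unfolding L2_set_def using A0(3)
    by (intro tendsto_real_sqrt tendsto_sum tendsto_power tendsto_norm lim) auto
  moreover have "L2_set (\<lambda>\<gamma>. cmod (S (on_set (F \<inter> B) v) \<gamma>)) (E \<inter> A) \<le> c"
    if F: "finite F" "F \<subseteq> fibre G x" for F
    using fin[OF A0(1,2), of "F \<inter> B"] F fibre_norm_on_set[OF A0(1,3), of "S (on_set (F \<inter> B) v)"] by auto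
  then have "\<forall>\<^sub>F F in finite_subsets_at_top (fibre G x). L2_set (\<lambda>\<gamma>. cmod (S (on_set (F \<inter> B) v) \<gamma>)) (E \<inter> A) \<le> c"
    by (rule eventually_finite_subsets_at_top_weakI)
  ultimately have le: "L2_set (\<lambda>\<gamma>. cmod (S ?w \<gamma>)) (E \<inter> A) \<le> c"
    by (rule tendsto_upperbound) simp
  have "L2_set (\<lambda>\<gamma>. cmod (mult_comp (indicator A) S (indicator B) v \<gamma>)) E = L2_set (\<lambda>\<gamma>. cmod (S ?w \<gamma>)) (E \<inter> A)"
    unfolding L2_set_def mult_comp_def using E(1)
    by (intro arg_cong[of _ _ sqrt] sum.mono_neutral_cong_right) (auto simp: indicator_def)
  with le show "L2_set (\<lambda>\<gamma>. cmod (mult_comp (indicator A) S (indicator B) v \<gamma>)) E \<le> c" by simp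
qed

context lc_etale_groupoid
begin

text \<open>Pairs of arrows in a common fibre, the positions of matrix entries. What composes is the
  first arrow with the inverse of the second.\<close>

definition composable :: "('g \<times> 'g) set" where
  "composable = {p. gsrc G (fst p) = gsrc G (snd p)}"

definition matrix_coeff :: "('g \<Rightarrow> 'g operator) \<Rightarrow> 'g \<times> 'g \<Rightarrow> complex" where
  "matrix_coeff T p = T (gsrc G (fst p)) (delta (snd p)) (fst p)"

text \<open>Convergence in the operator fibre space is tested on nets of arrows over the base
  points. Along a section such arrows determine the base point, so these nets live on the space of
  pairs, where the test becomes ordinary continuity.\<close>

lemma continuous_section_iff:
  assumes T: "\<And>x. x \<in> units G \<Longrightarrow> T x \<in> fibre_operators G x"
  shows "continuous_section G T \<longleftrightarrow> continuous_on composable (matrix_coeff T)"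
proof
  assume c: "continuous_section G T"
  \<comment> \<open>The section is pulled back along the source; the two coordinate projections then
    serve as the nets of arrows.\<close>
  let ?\<sigma> = "\<lambda>p :: 'g \<times> 'g. (gsrc G (fst p), T (gsrc G (fst p)))"
  have "continuous_map (top_of_set composable) (top_of_set (units G)) (\<lambda>p. gsrc G (fst p))"
    by (auto simp: continuous_map_in_subtopology intro!: continuous_on_compose2[OF continuous_src] continuous_intros)
  from continuous_map_compose[OF this c[unfolded continuous_section_def]]
  have cm: "continuous_map (top_of_set composable) (operator_space_topology G) ?\<sigma>"
    by (simp add: o_def)
  show "continuous_on composable (matrix_coeff T)"
    unfolding continuous_on_def
  proof
    fix p assume p: "p \<in> composable"
    have "limitin (operator_space_topology G) ?\<sigma> (?\<sigma> p) (at p within composable)"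
      using limitin_continuous_map[OF cm, of p] p by (simp add: atin_top_of_set)
    then have conv: "operator_space_converges G ?\<sigma> (?\<sigma> p) (at p within composable)"
      by (simp only: limitin_operator_space)
    have lims: "(snd \<longlongrightarrow> snd p) (at p within composable)" "(fst \<longlongrightarrow> fst p) (at p within composable)"
      by (intro tendsto_fst tendsto_snd tendsto_ident_at)+
    have ev: "\<forall>\<^sub>F q in at p within composable. gsrc G (snd q) = fst (?\<sigma> q) \<and> fst (?\<sigma> q) = gsrc G (fst q)"
      unfolding eventually_at_topological by (rule exI[of _ UNIV]) (auto simp: composable_def)
    from conv lims ev have "((\<lambda>q. fibre_inner G (fst (?\<sigma> q)) (delta (fst q)) (snd (?\<sigma> q) (delta (snd q))))
        \<longlongrightarrow> fibre_inner G (fst (?\<sigma> p)) (delta (fst p)) (snd (?\<sigma> p) (delta (snd p)))) (at p within composable)"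
      unfolding operator_space_converges_def by blast
    then show "(matrix_coeff T \<longlongrightarrow> matrix_coeff T p) (at p within composable)"
      by (simp add: matrix_coeff_def[abs_def])
  qed
next
  assume c: "continuous_on composable (matrix_coeff T)"
  show "continuous_section G T"
    unfolding continuous_section_def continuous_map_atin
  proof
    fix x assume "x \<in> topspace (top_of_set (units G))"
    then have x: "x \<in> units G" by simp
    have ev: "\<forall>\<^sub>F y in at x within units G. y \<in> units G"
      unfolding eventually_at_topological by (rule exI[of _ UNIV]) auto
    show "limitin (operator_space_topology G) (\<lambda>y. (y, T y)) (x, T x) (atin (top_of_set (units G)) x)"
      unfolding atin_top_of_set[OF x] limitin_operator_space operator_space_converges_def fst_conv snd_conv
    proof (intro conjI allI impI)
      show "(x, T x) \<in> operator_space G" using x T by (simp add: operator_space_def)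
      show "\<forall>\<^sub>F y in at x within units G. (y, T y) \<in> operator_space G"
        using ev by eventually_elim (simp add: operator_space_def T)
      show "((\<lambda>y. y) \<longlongrightarrow> x) (at x within units G)" by (rule tendsto_ident_at)
      fix \<gamma>' \<gamma>'' a b
      assume a: "(\<gamma>' \<longlongrightarrow> a) (at x within units G)" and b: "(\<gamma>'' \<longlongrightarrow> b) (at x within units G)"
        and s: "\<forall>\<^sub>F y in at x within units G. gsrc G (\<gamma>' y) = y \<and> y = gsrc G (\<gamma>'' y)"
      show "((\<lambda>y. fibre_inner G y (delta (\<gamma>'' y)) (T y (delta (\<gamma>' y)))) \<longlongrightarrow> fibre_inner G x (delta b) (T x (delta a))) (at x within units G)"
      \<comment> \<open>At an isolated unit the filter is trivial, and the limits a and b need not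
        lie over x. Otherwise continuity of the source and uniqueness of limits force them
        to.\<close>
      proof (cases "at x within units G = bot")
        case False
        have src: "gsrc G l = x" if "(\<gamma> \<longlongrightarrow> l) (at x within units G)" "\<forall>\<^sub>F y in at x within units G. gsrc G (\<gamma> y) = y" for \<gamma> l
        proof -
          have "((\<lambda>y. gsrc G (\<gamma> y)) \<longlongrightarrow> gsrc G l) (at x within units G)"
            using continuous_on_tendsto_compose[OF continuous_src that(1)] by simp
          then have "((\<lambda>y. y) \<longlongrightarrow> gsrc G l) (at x within units G)"
            using that(2) by (rule Lim_transform_eventually)
          then show ?thesis using tendsto_ident_at[of x "units G"] False tendsto_unique by blast
        qed
        have sa: "gsrc G a = x" by (rule src[OF a]) (use s in eventually_elim, simp)
        have sb: "gsrc G b = x" by (rule src[OF b]) (use s in eventually_elim, simp)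
        have t: "((\<lambda>y. matrix_coeff T (\<gamma>'' y, \<gamma>' y)) \<longlongrightarrow> matrix_coeff T (b, a)) (at x within units G)"
        proof (rule continuous_on_tendsto_compose[OF c])
          show "((\<lambda>y. (\<gamma>'' y, \<gamma>' y)) \<longlongrightarrow> (b, a)) (at x within units G)" by (intro tendsto_Pair a b)
          show "(b, a) \<in> composable" by (simp add: composable_def sa sb)
          show "\<forall>\<^sub>F y in at x within units G. (\<gamma>'' y, \<gamma>' y) \<in> composable"
            using s by eventually_elim (simp add: composable_def)
        qed
        have "\<forall>\<^sub>F y in at x within units G. matrix_coeff T (\<gamma>'' y, \<gamma>' y) = fibre_inner G y (delta (\<gamma>'' y)) (T y (delta (\<gamma>' y)))"
          using s by eventually_elim (auto simp: matrix_coeff_def fibre_def)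
        from Lim_transform_eventually[OF t this] show ?thesis
          using sa sb by (simp add: matrix_coeff_def fibre_def)
      qed simp
    qed
  qed
qed

text \<open>One function u serves all nearby columns: it is 1 near the column index of p and
  supported on a bisection, so on the fibre of each nearby pair it restricts to the point mass at
  the second component. The entry is therefore \<open>S u\<close> at the first component, and
  \<open>S u\<close> is continuous.\<close>

lemma slices_matrix_coeff_continuous:
  assumes P: "adjoint_pair G S A" and sl: "\<And>x. x \<in> units G \<Longrightarrow> is_slice x S (T x)"
  shows "continuous_on composable (matrix_coeff T)"
  unfolding continuous_on_def
proof
  fix p assume p: "p \<in> composable"
  obtain U where U: "open U" "snd p \<in> U" "inj_on (gsrc G) U" using bisection[of "snd p"] by blast
  obtain u W where u: "u \<in> cont_compact_supp" "supp u \<subseteq> U"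
    "open W" "snd p \<in> W" "\<And>\<gamma>. \<gamma> \<in> W \<Longrightarrow> u \<gamma> = 1"
    by (rule bump_function[of "{snd p}" U]) (use U in auto)
  have uL: "u \<in> L2 G" by (rule cont_compact_supp_L2[OF u(1)])
  have eq: "S u (fst q) = matrix_coeff T q" if q: "q \<in> composable" "snd q \<in> W" for q
  proof -
    let ?x = "gsrc G (fst q)"
    have "fibre_restrict G ?x u = delta (snd q)"
    proof
      fix \<gamma>
      have 1: "\<gamma> = snd q" if "\<gamma> \<in> fibre G ?x" "u \<gamma> \<noteq> 0"
      proof -
        have "\<gamma> \<in> U" "snd q \<in> U" using not_in_supp[of _ u] u(2) that(2) u(5)[OF q(2)] by force+
        moreover have "gsrc G \<gamma> = gsrc G (snd q)" using that(1) q(1) by (simp add: fibre_def composable_def)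
        ultimately show ?thesis using U(3) by (auto dest: inj_onD)
      qed
      have 2: "snd q \<in> fibre G ?x" using q(1) by (simp add: fibre_def composable_def)
      show "fibre_restrict G ?x u \<gamma> = delta (snd q) \<gamma>"
        using 1 2 u(5)[OF q(2)] by (cases "\<gamma> = snd q") (auto simp: fibre_restrict_def delta_def)
    qed
    then have "T ?x (delta (snd q)) = fibre_restrict G ?x (S u)"
      using sl[of ?x] uL by (auto simp: is_slice_def)
    then show ?thesis by (simp add: matrix_coeff_def fibre_restrict_def)
  qed
  have t: "((\<lambda>q. S u (fst q)) \<longlongrightarrow> S u (fst p)) (at p within composable)"
    by (rule continuous_on_tendsto_compose[OF L2_continuous[OF adjoint_pairD(1)[OF P uL]]])
       (auto intro: tendsto_fst tendsto_ident_at)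
  have "\<forall>\<^sub>F q in at p within composable. S u (fst q) = matrix_coeff T q"
    unfolding eventually_at_topological
    by (rule exI[of _ "UNIV \<times> W"]) (use u(3,4) eq in \<open>auto simp: open_Times mem_Times_iff\<close>)
  from Lim_transform_eventually[OF t this]
  show "(matrix_coeff T \<longlongrightarrow> matrix_coeff T p) (at p within composable)"
    using eq[OF p u(4)] by simp
qed

section \<open>Passing locality from an operator to its slices\<close>

lemma bump_sum_bcontfun:
  assumes "bump_system x F W \<phi>"
  obtains f :: "'g \<Rightarrow>\<^sub>C complex" where "norm f \<le> 1" "supp (apply_bcontfun f) \<subseteq> (\<Union>\<beta>\<in>F. W \<beta>)"
    "fibre_restrict G x (apply_bcontfun f) = on_set F (\<lambda>_. 1)"
proof -
  let ?f = "\<lambda>\<gamma>. \<Sum>\<beta>\<in>F. 1 * \<phi> \<beta> \<gamma>"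
  have b: "cmod (?f \<gamma>) \<le> 1" for \<gamma>
  proof (cases "?f \<gamma> = 0")
    case False
    then obtain \<beta> where "\<beta> \<in> F" "\<gamma> \<in> supp (\<phi> \<beta>)" by (rule bump_sum_neq_0[OF assms])
    then show ?thesis using bump_sum_cmod[OF assms, of \<beta> \<gamma> "\<lambda>_. 1"] by simp
  qed simp
  have "continuous_on UNIV ?f"
    using bump_sum_cont_compact_supp[OF assms, of "\<lambda>_. 1"] by (simp add: cont_compact_supp_def)
  then have f: "apply_bcontfun (Bcontfun ?f) = ?f"
    using b by (intro Bcontfun_inverse bcontfun_normI)
  have cl: "closed (\<Union>\<beta>\<in>F. supp (\<phi> \<beta>))" using assms by (intro closed_UN) (auto simp: bump_system_def)
  have "supp ?f \<subseteq> (\<Union>\<beta>\<in>F. supp (\<phi> \<beta>))"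
    using bump_sum_neq_0[OF assms, of "\<lambda>_. 1"] by (intro supp_subsetI[OF cl]) blast
  also have "\<dots> \<subseteq> (\<Union>\<beta>\<in>F. W \<beta>)" using assms unfolding bump_system_def by blast
  finally have s: "supp ?f \<subseteq> (\<Union>\<beta>\<in>F. W \<beta>)" .
  show thesis
  proof (rule that[of "Bcontfun ?f"])
    show "norm (Bcontfun ?f) \<le> 1" by (rule norm_bound) (simp only: f b)
    show "supp (apply_bcontfun (Bcontfun ?f)) \<subseteq> (\<Union>\<beta>\<in>F. W \<beta>)" using s by (simp only: f)
    show "fibre_restrict G x (apply_bcontfun (Bcontfun ?f)) = on_set F (\<lambda>_. 1)"
      unfolding f by (rule bump_sum_restrict[OF assms])
  qed
qed

text \<open>Points of \<open>A\<^sub>0\<close> and \<open>B\<^sub>0\<close> have pairwise separated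
  neighbourhoods by \<open>not_in_set_mul_nbhd\<close>, and finiteness keeps the intersections of
  these open. Separation of f and g concerns supports, which a bump system keeps inside the
  prescribed open sets. Here f belongs to the input side B and g to the output side A.\<close>

lemma separated_lift:
  assumes K: "compact K" and sep: "fibre_separated G K x A B"
    and A0: "finite A\<^sub>0" "A\<^sub>0 \<subseteq> A" and B0: "finite B\<^sub>0" "B\<^sub>0 \<subseteq> B"
  obtains f g :: "'g \<Rightarrow>\<^sub>C complex" where "separated G K f g" "norm f \<le> 1" "norm g \<le> 1"
    "fibre_restrict G x (apply_bcontfun f) = on_set B\<^sub>0 (\<lambda>_. 1)"
    "fibre_restrict G x (apply_bcontfun g) = on_set A\<^sub>0 (\<lambda>_. 1)"
proof -
  have Ax: "A\<^sub>0 \<subseteq> fibre G x" and Bx: "B\<^sub>0 \<subseteq> fibre G x"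
    using sep A0 B0 by (auto simp: fibre_separated_def)
  have ex: "\<exists>V U. open V \<and> open U \<and> a \<in> V \<and> b \<in> U \<and> set_mul G K U \<inter> V = {} \<and> set_mul G K V \<inter> U = {}"
    if "a \<in> A\<^sub>0" "b \<in> B\<^sub>0" for a b
  proof -
    have s: "gsrc G a = gsrc G b" using that Ax Bx by (auto simp: fibre_def)
    have ab: "a \<in> A" "b \<in> B" using that A0 B0 by auto
    have 1: "a \<notin> set_mul G K {b}" "b \<notin> set_mul G K {a}"
      using sep ab unfolding fibre_separated_def set_mul_def by blast+
    obtain V1 U1 where 2: "open V1" "open U1" "a \<in> V1" "b \<in> U1" "set_mul G K U1 \<inter> V1 = {}"
      by (rule not_in_set_mul_nbhd[OF K s 1(1)]) blast
    obtain U2 V2 where 3: "open U2" "open V2" "b \<in> U2" "a \<in> V2" "set_mul G K V2 \<inter> U2 = {}"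
      by (rule not_in_set_mul_nbhd[OF K s[symmetric] 1(2)]) blast
    have mono: "set_mul G K (X \<inter> Y) \<subseteq> set_mul G K X \<inter> set_mul G K Y" for X Y
      unfolding set_mul_def by blast
    show ?thesis
      using 2 3 mono[of U1 U2] mono[of V1 V2]
      by (intro exI[of _ "V1 \<inter> V2"] exI[of _ "U1 \<inter> U2"]) (auto simp: open_Int)
  qed
  then obtain V U where VU: "\<And>a b. a \<in> A\<^sub>0 \<Longrightarrow> b \<in> B\<^sub>0 \<Longrightarrow> open (V a b) \<and> open (U a b) \<and> a \<in> V a b \<and> b \<in> U a b \<and>
      set_mul G K (U a b) \<inter> V a b = {} \<and> set_mul G K (V a b) \<inter> U a b = {}"
    by metis
  define V' where "V' a = (\<Inter>b\<in>B\<^sub>0. V a b)" for a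
  define U' where "U' b = (\<Inter>a\<in>A\<^sub>0. U a b)" for b
  obtain \<phi> where \<phi>: "bump_system x B\<^sub>0 U' \<phi>"
  proof (rule bump_system_exists[OF B0(1) Bx, of U'])
    show "open (U' \<beta>)" if "\<beta> \<in> B\<^sub>0" for \<beta> unfolding U'_def using A0(1) VU that by (intro open_INT) auto
    show "\<beta> \<in> U' \<beta>" if "\<beta> \<in> B\<^sub>0" for \<beta> unfolding U'_def using VU that by auto
  qed
  obtain \<psi> where \<psi>: "bump_system x A\<^sub>0 V' \<psi>"
  proof (rule bump_system_exists[OF A0(1) Ax, of V'])
    show "open (V' \<beta>)" if "\<beta> \<in> A\<^sub>0" for \<beta> unfolding V'_def using B0(1) VU that by (intro open_INT) auto
    show "\<beta> \<in> V' \<beta>" if "\<beta> \<in> A\<^sub>0" for \<beta> unfolding V'_def using VU that by auto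
  qed
  obtain f where f: "norm f \<le> 1" "supp (apply_bcontfun f) \<subseteq> (\<Union>\<beta>\<in>B\<^sub>0. U' \<beta>)"
    "fibre_restrict G x (apply_bcontfun f) = on_set B\<^sub>0 (\<lambda>_. 1)"
    by (rule bump_sum_bcontfun[OF \<phi>])
  obtain g where g: "norm g \<le> 1" "supp (apply_bcontfun g) \<subseteq> (\<Union>\<beta>\<in>A\<^sub>0. V' \<beta>)"
    "fibre_restrict G x (apply_bcontfun g) = on_set A\<^sub>0 (\<lambda>_. 1)"
    by (rule bump_sum_bcontfun[OF \<psi>])
  have disj: "set_mul G K (\<Union>d\<in>D. Y d) \<inter> (\<Union>c\<in>C. X c) = {}"
    if "\<And>c d. c \<in> C \<Longrightarrow> d \<in> D \<Longrightarrow> Y d \<subseteq> Y' c d \<and> X c \<subseteq> X' c d \<and> set_mul G K (Y' c d) \<inter> X' c d = {}"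
    for C D :: "'g set" and X Y X' Y'
  proof (rule equals0I)
    fix \<gamma> assume "\<gamma> \<in> set_mul G K (\<Union>d\<in>D. Y d) \<inter> (\<Union>c\<in>C. X c)"
    then obtain c d \<kappa> \<beta> where *: "c \<in> C" "d \<in> D" "\<kappa> \<in> K" "\<beta> \<in> Y d" "gsrc G \<kappa> = grng G \<beta>" "\<gamma> = gmul G \<kappa> \<beta>" "\<gamma> \<in> X c"
      unfolding set_mul_def by blast
    note cd = that[OF *(1,2)]
    have "\<gamma> \<in> set_mul G K (Y' c d) \<inter> X' c d"
      using cd * set_mulI[of \<kappa> K \<beta> "Y' c d"] by auto
    then show False using cd by blast
  qed
  have 1: "set_mul G K (\<Union>\<beta>\<in>B\<^sub>0. U' \<beta>) \<inter> (\<Union>\<beta>\<in>A\<^sub>0. V' \<beta>) = {}"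
    by (rule disj[where X' = V and Y' = U]) (use VU in \<open>auto simp: U'_def V'_def\<close>)
  have 2: "set_mul G K (\<Union>\<beta>\<in>A\<^sub>0. V' \<beta>) \<inter> (\<Union>\<beta>\<in>B\<^sub>0. U' \<beta>) = {}"
    by (rule disj[where X' = "\<lambda>b a. U a b" and Y' = "\<lambda>b a. V a b"]) (use VU in \<open>auto simp: U'_def V'_def\<close>)
  have mono: "set_mul G K X \<subseteq> set_mul G K Y" if "X \<subseteq> Y" for X Y
    using that unfolding set_mul_def by blast
  have "separated G K f g"
    unfolding separated_def
  proof
    have "set_mul G K (supp (apply_bcontfun f)) \<inter> supp (apply_bcontfun g)
        \<subseteq> set_mul G K (\<Union>\<beta>\<in>B\<^sub>0. U' \<beta>) \<inter> (\<Union>\<beta>\<in>A\<^sub>0. V' \<beta>)"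
      by (intro Int_mono mono f(2) g(2))
    then show "set_mul G K (supp (apply_bcontfun f)) \<inter> supp (apply_bcontfun g) = {}"
      unfolding 1 by (rule subset_empty[THEN iffD1])
    have "set_mul G K (supp (apply_bcontfun g)) \<inter> supp (apply_bcontfun f)
        \<subseteq> set_mul G K (\<Union>\<beta>\<in>A\<^sub>0. V' \<beta>) \<inter> (\<Union>\<beta>\<in>B\<^sub>0. U' \<beta>)"
      by (intro Int_mono mono f(2) g(2))
    then have "set_mul G K (supp (apply_bcontfun g)) \<inter> supp (apply_bcontfun f) = {}"
      unfolding 2 by (rule subset_empty[THEN iffD1])
    then show "supp (apply_bcontfun f) \<inter> set_mul G K (supp (apply_bcontfun g)) = {}"
      by (simp only: Int_commute)
  qed
  then show thesis by (rule that[OF _ f(1) g(1) f(3) g(3)])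
qed

text \<open>On the fibre at x the factors f and g act as truncations to \<open>B\<^sub>0\<close> and
  \<open>A\<^sub>0\<close>, so a finite section of the slice becomes visible in the global
  operator.\<close>

lemma mult_comp_restrict:
  assumes sl: "is_slice x S R" and \<xi>: "\<xi> \<in> L2 G" and f: "(\<lambda>\<gamma>. f \<gamma> * \<xi> \<gamma>) \<in> L2 G"
    and r: "fibre_restrict G x \<xi> = on_set B\<^sub>0 v" "fibre_restrict G x f = on_set B\<^sub>0 (\<lambda>_. 1)"
      "fibre_restrict G x g = on_set A\<^sub>0 (\<lambda>_. 1)"
  shows "fibre_restrict G x (mult_comp g S f \<xi>) = on_set A\<^sub>0 (R (on_set B\<^sub>0 v))"
proof -
  have pt: "\<xi> \<gamma> = on_set B\<^sub>0 v \<gamma>" "f \<gamma> = on_set B\<^sub>0 (\<lambda>_. 1) \<gamma>" "g \<gamma> = on_set A\<^sub>0 (\<lambda>_. 1) \<gamma>"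
    if "\<gamma> \<in> fibre G x" for \<gamma>
    using r[THEN fun_cong, of \<gamma>] that by (simp_all add: fibre_restrict_def)
  have out: "on_set B\<^sub>0 v \<gamma> = 0" "on_set A\<^sub>0 (\<lambda>_. 1) \<gamma> = 0" if "\<gamma> \<notin> fibre G x" for \<gamma>
    using r(1,3)[THEN fun_cong, of \<gamma>] that by (simp_all add: fibre_restrict_def)
  have "fibre_restrict G x (\<lambda>\<gamma>. f \<gamma> * \<xi> \<gamma>) = on_set B\<^sub>0 v"
    using pt out by (auto simp: fun_eq_iff fibre_restrict_def) (auto simp: on_set_def)
  then have R: "R (on_set B\<^sub>0 v) = fibre_restrict G x (S (\<lambda>\<gamma>. f \<gamma> * \<xi> \<gamma>))"
    using sl f unfolding is_slice_def by metis
  show ?thesis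
  proof
    fix \<gamma>
    show "fibre_restrict G x (mult_comp g S f \<xi>) \<gamma> = on_set A\<^sub>0 (R (on_set B\<^sub>0 v)) \<gamma>"
      using pt(3)[of \<gamma>] out(2)[of \<gamma>]
      by (cases "\<gamma> \<in> fibre G x"; cases "\<gamma> \<in> A\<^sub>0") (auto simp: R fibre_restrict_def mult_comp_def on_set_apply)
  qed
qed

lemma bcontfun_mult_L2:
  fixes f :: "'g \<Rightarrow>\<^sub>C complex"
  shows "\<xi> \<in> L2 G \<Longrightarrow> (\<lambda>\<gamma>. apply_bcontfun f \<gamma> * \<xi> \<gamma>) \<in> L2 G"
  by (rule L2_mult[where c = "norm f"]) (auto simp: norm_bounded)

lemma slice_fibre_norm_le:
  assumes b: "\<And>x v. x \<in> units G \<Longrightarrow> v \<in> fibre_l2 G x \<Longrightarrow> fibre_norm G x (T x v) \<le> C * fibre_norm G x v"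
    and sl: "\<And>x. x \<in> units G \<Longrightarrow> is_slice x S (T x)" and \<xi>: "\<xi> \<in> L2 G" and x: "x \<in> units G"
  shows "fibre_norm G x (S \<xi>) \<le> C * fibre_norm G x \<xi>"
proof -
  have "T x (fibre_restrict G x \<xi>) = fibre_restrict G x (S \<xi>)"
    using sl[OF x] \<xi> by (simp add: is_slice_def)
  then show ?thesis using b[OF x L2_restrict[OF \<xi>]] by simp
qed

text \<open>The uniform bound C on the slices shows that \<open>module_op_norm\<close> is the
  supremum of a bounded set, and hence dominates the individual values.\<close>

lemma mult_comp_norm_le:
  fixes f g :: "'g \<Rightarrow>\<^sub>C complex"
  assumes P: "adjoint_pair G S A" and C: "0 \<le> C"
    and b: "\<And>x v. x \<in> units G \<Longrightarrow> v \<in> fibre_l2 G x \<Longrightarrow> fibre_norm G x (T x v) \<le> C * fibre_norm G x v"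
    and sl: "\<And>x. x \<in> units G \<Longrightarrow> is_slice x S (T x)"
    and \<xi>: "\<xi> \<in> L2 G" "module_norm G \<xi> \<le> 1"
  shows "fibre_norm G x (mult_comp (apply_bcontfun g) S (apply_bcontfun f) \<xi>)
      \<le> module_op_norm G (mult_comp (apply_bcontfun g) S (apply_bcontfun f))"
proof -
  let ?R = "mult_comp (apply_bcontfun g) S (apply_bcontfun f)"
  have RL: "?R \<eta> \<in> L2 G" if "\<eta> \<in> L2 G" for \<eta>
    unfolding mult_comp_def by (intro bcontfun_mult_L2 adjoint_pairD(1)[OF P] that)
  have le: "module_norm G (?R \<eta>) \<le> norm g * (C * norm f)" if \<eta>: "\<eta> \<in> L2 G" "module_norm G \<eta> \<le> 1" for \<eta>
  proof (rule module_norm_le)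
    fix y assume y: "y \<in> units G"
    let ?f\<eta> = "\<lambda>\<gamma>. apply_bcontfun f \<gamma> * \<eta> \<gamma>"
    have f\<eta>: "?f\<eta> \<in> L2 G" by (rule bcontfun_mult_L2[OF \<eta>(1)])
    have "fibre_norm G y (?R \<eta>) \<le> norm g * fibre_norm G y (S ?f\<eta>)"
      unfolding mult_comp_def
      by (rule square_summable_mult(2)[OF L2_square_summable[OF adjoint_pairD(1)[OF P f\<eta>]] norm_bounded]) simp
    also have "fibre_norm G y (S ?f\<eta>) \<le> C * fibre_norm G y ?f\<eta>"
      by (rule slice_fibre_norm_le[OF b sl f\<eta> y])
    also have "fibre_norm G y ?f\<eta> \<le> norm f * fibre_norm G y \<eta>"
      by (rule square_summable_mult(2)[OF L2_square_summable[OF \<eta>(1)] norm_bounded]) simp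
    also have "fibre_norm G y \<eta> \<le> 1" using L2_fibre_norm_le[OF \<eta>(1)] \<eta>(2) by (rule order_trans)
    finally show "fibre_norm G y (?R \<eta>) \<le> norm g * (C * norm f)"
      using C by (simp add: mult_left_mono)
  qed
  have "fibre_norm G x (?R \<xi>) \<le> module_norm G (?R \<xi>)" by (rule L2_fibre_norm_le[OF RL[OF \<xi>(1)]])
  also have "\<dots> \<le> module_op_norm G ?R"
    unfolding module_op_norm_def op_norm_def
    using \<xi> le by (intro cSUP_upper bdd_aboveI2[of _ _ "norm g * (C * norm f)"]) auto
  finally show ?thesis .
qed

lemma quasi_local_slices:
  assumes P: "adjoint_pair G S A" and T: "T \<in> bounded_operator_families G"
    and sl: "\<And>x. x \<in> units G \<Longrightarrow> is_slice x S (T x)" and q: "quasi_local G S"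
  shows "compactly_uniformly_quasi_local G T"
  unfolding compactly_uniformly_quasi_local_def
proof (intro allI impI)
  fix \<epsilon> :: real assume "\<epsilon> > 0"
  \<comment> \<open>The passage from finite sections to the limit preserves only \<le>, while the
    claim is strict.\<close>
  then have e: "\<epsilon> / 2 > 0" by simp
  obtain C where C: "0 \<le> C" "\<And>x v. x \<in> units G \<Longrightarrow> v \<in> fibre_l2 G x \<Longrightarrow> fibre_norm G x (T x v) \<le> C * fibre_norm G x v"
    using fibre_operator_family_bound[OF T] by metis
  from q e obtain K where K: "compact K" and
    Kq: "\<And>f g. separated G K f g \<Longrightarrow> module_op_norm G (mult_comp (apply_bcontfun g) S (apply_bcontfun f)) \<le> \<epsilon> / 2 * norm g * norm f"
    unfolding quasi_local_def by (metis less_imp_le)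
  have "fibre_op_norm G x (mult_comp (indicator A') (T x) (indicator B)) < \<epsilon>"
    if x: "x \<in> units G" and sep: "fibre_separated G K x A' B" for x A' B
  proof -
    have "fibre_op_norm G x (mult_comp (indicator A') (T x) (indicator B)) \<le> \<epsilon> / 2"
      unfolding fibre_op_norm_def
    proof (rule op_norm_le[of "\<lambda>\<gamma>. 0"])
      fix v assume v: "v \<in> fibre_l2 G x" "fibre_norm G x v \<le> 1"
      show "fibre_norm G x (mult_comp (indicator A') (T x) (indicator B) v) \<le> \<epsilon> / 2"
      proof (rule mult_comp_indicator_bound[OF _ v(1)])
        show "T x \<in> fibre_operators G x" using sl[OF x] by (simp add: is_slice_def)
        show "0 \<le> \<epsilon> / 2" using e by simp
        fix A\<^sub>0 B\<^sub>0 assume A0: "finite A\<^sub>0" "A\<^sub>0 \<subseteq> A' \<inter> fibre G x" and B0: "finite B\<^sub>0" "B\<^sub>0 \<subseteq> B \<inter> fibre G x"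
        obtain f g where fg: "separated G K f g" "norm f \<le> 1" "norm g \<le> 1"
          "fibre_restrict G x (apply_bcontfun f) = on_set B\<^sub>0 (\<lambda>_. 1)"
          "fibre_restrict G x (apply_bcontfun g) = on_set A\<^sub>0 (\<lambda>_. 1)"
          by (rule separated_lift[OF K sep A0(1) _ B0(1)]) (use A0 B0 in auto)
        have Bx: "B\<^sub>0 \<subseteq> fibre G x" using B0 by blast
        obtain \<xi> where \<xi>: "\<xi> \<in> cont_compact_supp" "fibre_restrict G x \<xi> = on_set B\<^sub>0 v"
          "\<And>y. fibre_norm G y \<xi> \<le> fibre_norm G x (on_set B\<^sub>0 v)"
          by (rule finite_support_lift[OF B0(1) Bx]) blast
        have \<xi>L: "\<xi> \<in> L2 G" by (rule cont_compact_supp_L2[OF \<xi>(1)])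
        have "fibre_norm G x (on_set B\<^sub>0 v) \<le> fibre_norm G x v"
          by (rule fibre_norm_mono(2)[OF fibre_l2D(1)[OF v(1)]]) (simp add: on_set_def)
        then have n: "module_norm G \<xi> \<le> 1"
          using \<xi>(3) v(2) by (intro module_norm_le) (meson order_trans)
        have "fibre_norm G x (on_set A\<^sub>0 (T x (on_set B\<^sub>0 v)))
            = fibre_norm G x (mult_comp (apply_bcontfun g) S (apply_bcontfun f) \<xi>)"
          using mult_comp_restrict[OF sl[OF x] \<xi>L bcontfun_mult_L2[OF \<xi>L] \<xi>(2) fg(4,5)] fibre_norm_restrict by metis
        also have "\<dots> \<le> module_op_norm G (mult_comp (apply_bcontfun g) S (apply_bcontfun f))"
          by (rule mult_comp_norm_le[OF P C sl \<xi>L n])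
        also have "\<dots> \<le> \<epsilon> / 2 * norm g * norm f" by (rule Kq[OF fg(1)])
        also have "\<dots> \<le> \<epsilon> / 2 * 1 * 1" using e fg(2,3) by (intro mult_mono) auto
        finally show "fibre_norm G x (on_set A\<^sub>0 (T x (on_set B\<^sub>0 v))) \<le> \<epsilon> / 2" by simp
      qed
    qed (simp_all add: fibre_l2_zero)
    then show ?thesis using e by simp
  qed
  then show "\<exists>K. compact K \<and> (\<forall>x\<in>units G. \<forall>A B. fibre_separated G K x A B \<longrightarrow>
      fibre_op_norm G x (mult_comp (indicator A) (T x) (indicator B)) < \<epsilon>)"
    using K by blast
qed

text \<open>Vanishing can be read off one matrix entry at a time: a column in B and a row in A have
  separated lifts, and the expansion of \<open>T x\<close> over columns does the rest.\<close>

lemma compactly_supported_slices: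
  assumes sl: "\<And>x. x \<in> units G \<Longrightarrow> is_slice x S (T x)" and q: "compactly_supported G S"
  shows "\<exists>K. compact K \<and> (\<forall>x\<in>units G. \<forall>A B. fibre_separated G K x A B \<longrightarrow>
           (\<forall>v\<in>fibre_l2 G x. mult_comp (indicator A) (T x) (indicator B) v = (\<lambda>\<gamma>. 0)))"
proof -
  from q obtain K where K: "compact K" and
    Kq: "\<And>f g \<xi>. separated G K f g \<Longrightarrow> \<xi> \<in> L2 G \<Longrightarrow> mult_comp (apply_bcontfun g) S (apply_bcontfun f) \<xi> = (\<lambda>\<gamma>. 0)"
    unfolding compactly_supported_def by blast
  have "mult_comp (indicator A) (T x) (indicator B) v = (\<lambda>\<gamma>. 0)"
    if x: "x \<in> units G" and sep: "fibre_separated G K x A B" and v: "v \<in> fibre_l2 G x" for x A B v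
  proof
    fix \<alpha>
    have Tx: "T x \<in> fibre_operators G x" using sl[OF x] by (simp add: is_slice_def)
    have AB: "A \<subseteq> fibre G x" "B \<subseteq> fibre G x" using sep by (auto simp: fibre_separated_def)
    have z: "T x (delta \<beta>) \<alpha> = 0" if \<alpha>: "\<alpha> \<in> A" and \<beta>: "\<beta> \<in> B" for \<beta>
    proof -
      obtain f g where fg: "separated G K f g" "norm f \<le> 1" "norm g \<le> 1"
        "fibre_restrict G x (apply_bcontfun f) = on_set {\<beta>} (\<lambda>_. 1)"
        "fibre_restrict G x (apply_bcontfun g) = on_set {\<alpha>} (\<lambda>_. 1)"
        by (rule separated_lift[OF K sep, of "{\<alpha>}" "{\<beta>}"]) (use \<alpha> \<beta> in auto)
      obtain h where h: "h \<in> cont_compact_supp" "fibre_restrict G x h = delta \<beta>"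
        using delta_lift[of \<beta> x] \<beta> AB by blast
      have d: "delta \<beta> = on_set {\<beta>} (\<lambda>_. 1)" by (auto simp: on_set_def delta_def)
      have hL: "h \<in> L2 G" by (rule cont_compact_supp_L2[OF h(1)])
      have "on_set {\<alpha>} (T x (delta \<beta>)) = fibre_restrict G x (\<lambda>\<gamma>. 0)"
        using mult_comp_restrict[OF sl[OF x] hL bcontfun_mult_L2[OF hL] h(2)[unfolded d] fg(4,5)]
        by (simp add: Kq[OF fg(1) hL] d)
      from fun_cong[OF this, of \<alpha>] show ?thesis by (simp add: on_set_def fibre_restrict_def)
    qed
    show "mult_comp (indicator A) (T x) (indicator B) v \<alpha> = 0"
    proof (cases "\<alpha> \<in> A")
      case True
      have "((\<lambda>\<beta>. T x (delta \<beta>) \<alpha> * (indicator B \<beta> * v \<beta>)) has_sum T x (\<lambda>\<gamma>. indicator B \<gamma> * v \<gamma>) \<alpha>) (fibre G x)"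
        using True AB by (intro operator_matrix_has_sum[OF Tx indicator_fibre_l2[OF v]]) auto
      moreover have "((\<lambda>\<beta>. T x (delta \<beta>) \<alpha> * (indicator B \<beta> * v \<beta>)) has_sum 0) (fibre G x)"
        using z[OF True] by (intro has_sum_0) (auto simp: indicator_def)
      ultimately have "T x (\<lambda>\<gamma>. indicator B \<gamma> * v \<gamma>) \<alpha> = 0" by (rule has_sum_unique)
      then show ?thesis by (simp add: mult_comp_def)
    qed (simp add: mult_comp_def)
  qed
  then show ?thesis using K by blast
qed

end

section \<open>From families to operators\<close>

text \<open>A common consequence of the two locality conditions that suffices for gluing. The
  estimate is made on vectors and with \<le>, which avoids suprema and passes to adjoints.\<close>

definition small_off_compact :: "'g::topological_space groupoid_data \<Rightarrow> ('g \<Rightarrow> 'g operator) \<Rightarrow> bool" where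
  "small_off_compact G T \<longleftrightarrow>
     (\<forall>\<epsilon>>0. \<exists>K. compact K \<and>
        (\<forall>x\<in>units G. \<forall>A B. fibre_separated G K x A B \<longrightarrow>
           (\<forall>v\<in>fibre_l2 G x. fibre_norm G x (mult_comp (indicator A) (T x) (indicator B) v) \<le> \<epsilon> * fibre_norm G x v)))"

lemma small_off_compactD:
  assumes "small_off_compact G T" "\<epsilon> > 0"
  shows "\<exists>K. compact K \<and> (\<forall>x A B v. x \<in> units G \<longrightarrow> fibre_separated G K x A B \<longrightarrow> v \<in> fibre_l2 G x \<longrightarrow>
           fibre_norm G x (mult_comp (indicator A) (T x) (indicator B) v) \<le> \<epsilon> * fibre_norm G x v)"
  using assms(1)[unfolded small_off_compact_def, THEN spec, THEN mp, OF assms(2)]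
  by (elim exE conjE) (rule exI, rule conjI, assumption, simp)

lemma operator_zero: "S \<in> fibre_operators G x \<Longrightarrow> S (\<lambda>\<gamma>. 0) = (\<lambda>\<gamma>. 0)"
  using fibre_operatorsD(3)[OF _ fibre_l2_zero, of S G x 0] by simp

lemma indicator_mult:
  assumes "square_summable G x v"
  shows "square_summable G x (\<lambda>\<gamma>. indicator A \<gamma> * v \<gamma>)"
    and "fibre_norm G x (\<lambda>\<gamma>. indicator A \<gamma> * v \<gamma>) \<le> fibre_norm G x v"
proof -
  have i: "cmod (indicator A \<gamma>) \<le> 1" for \<gamma> by (simp add: indicator_def)
  show "square_summable G x (\<lambda>\<gamma>. indicator A \<gamma> * v \<gamma>)" by (rule square_summable_mult(1)[OF assms i])
  show "fibre_norm G x (\<lambda>\<gamma>. indicator A \<gamma> * v \<gamma>) \<le> fibre_norm G x v"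
    using square_summable_mult(2)[OF assms i] by simp
qed

lemma mult_comp_norm_bound:
  assumes S: "S \<in> fibre_operators G x" and v: "v \<in> fibre_l2 G x"
  shows "fibre_norm G x (mult_comp (indicator A) S (indicator B) v)
      \<le> fibre_op_norm G x (mult_comp (indicator A) S (indicator B)) * fibre_norm G x v"
proof (rule homogeneous_norm_bound[where S = "mult_comp (indicator A) S (indicator B)", OF _ _ v])
  fix c u assume u: "u \<in> fibre_l2 G x"
  let ?u = "\<lambda>\<gamma>. indicator B \<gamma> * u \<gamma>"
  have "(\<lambda>\<gamma>. indicator B \<gamma> * (c * u \<gamma>)) = (\<lambda>\<gamma>. c * ?u \<gamma>)" by (simp add: mult.left_commute)
  then show "mult_comp (indicator A) S (indicator B) (\<lambda>\<gamma>. c * u \<gamma>) = (\<lambda>\<gamma>. c * mult_comp (indicator A) S (indicator B) u \<gamma>)"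
    using fibre_operatorsD(3)[OF S indicator_fibre_l2[OF u, of B], of c]
    by (simp add: mult_comp_def mult.left_commute)
  have "fibre_norm G x (mult_comp (indicator A) S (indicator B) u) \<le> fibre_norm G x (S ?u)"
    unfolding mult_comp_def
    by (rule indicator_mult(2)[OF fibre_l2D(1)[OF fibre_operatorsD(1)[OF S indicator_fibre_l2[OF u]]]])
  also have "\<dots> \<le> fibre_op_norm G x S * fibre_norm G x ?u"
    by (rule operator_norm_bound[OF S indicator_fibre_l2[OF u]])
  also have "\<dots> \<le> \<bar>fibre_op_norm G x S\<bar> * fibre_norm G x ?u" by (intro mult_right_mono) auto
  also have "\<dots> \<le> \<bar>fibre_op_norm G x S\<bar> * fibre_norm G x u"
    by (intro mult_left_mono indicator_mult(2)[OF fibre_l2D(1)[OF u]]) simp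
  finally show "fibre_norm G x (mult_comp (indicator A) S (indicator B) u) \<le> \<bar>fibre_op_norm G x S\<bar> * fibre_norm G x u" .
qed

lemma quasi_local_small_off_compact:
  assumes T: "\<And>x. x \<in> units G \<Longrightarrow> T x \<in> fibre_operators G x" and q: "compactly_uniformly_quasi_local G T"
  shows "small_off_compact G T"
  unfolding small_off_compact_def
proof (intro allI impI)
  fix \<epsilon> :: real assume e: "\<epsilon> > 0"
  obtain K where K: "compact K" "\<forall>x\<in>units G. \<forall>A B. fibre_separated G K x A B \<longrightarrow>
      fibre_op_norm G x (mult_comp (indicator A) (T x) (indicator B)) < \<epsilon>"
    using q[unfolded compactly_uniformly_quasi_local_def, THEN spec, THEN mp, OF e] by blast
  have *: "fibre_norm G x (mult_comp (indicator A) (T x) (indicator B) v) \<le> \<epsilon> * fibre_norm G x v"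
    if x: "x \<in> units G" and s: "fibre_separated G K x A B" and v: "v \<in> fibre_l2 G x" for x A B v
  proof -
    have "fibre_op_norm G x (mult_comp (indicator A) (T x) (indicator B)) * fibre_norm G x v \<le> \<epsilon> * fibre_norm G x v"
      using K(2)[rule_format, OF x s] by (intro mult_right_mono) auto
    with mult_comp_norm_bound[OF T[OF x] v, of A B] show ?thesis by (rule order_trans)
  qed
  show "\<exists>K. compact K \<and> (\<forall>x\<in>units G. \<forall>A B. fibre_separated G K x A B \<longrightarrow>
      (\<forall>v\<in>fibre_l2 G x. fibre_norm G x (mult_comp (indicator A) (T x) (indicator B) v) \<le> \<epsilon> * fibre_norm G x v))"
    by (intro exI[of _ K] conjI K(1) ballI allI impI) (rule *)
qed

lemma fibre_inner_indicator:
  "fibre_inner G x (\<lambda>\<gamma>. indicator A \<gamma> * v \<gamma>) w = fibre_inner G x v (\<lambda>\<gamma>. indicator A \<gamma> * w \<gamma>)"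
  unfolding fibre_inner_def by (intro infsum_cong) (simp add: indicator_def)

lemma fibre_separated_sym: "fibre_separated G K x A B \<Longrightarrow> fibre_separated G K x B A"
  unfolding fibre_separated_def by blast

text \<open>The adjoint of a compression of S from A to B is the compression of its adjoint from B
  to A. For the vector u whose norm is sought, the squared norm equals the inner product of the
  compression of S at u with v, so one factor cancels.\<close>

lemma adjoint_mult_comp_norm:
  assumes S: "S \<in> fibre_operators G x" and v: "v \<in> fibre_l2 G x" and c: "0 \<le> c"
    and b: "\<And>u. u \<in> fibre_l2 G x \<Longrightarrow> fibre_norm G x (mult_comp (indicator B) S (indicator A) u) \<le> c * fibre_norm G x u"
  shows "fibre_norm G x (mult_comp (indicator A) (operator_adjoint G x S) (indicator B) v) \<le> c * fibre_norm G x v"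
proof -
  let ?w = "\<lambda>\<gamma>. indicator B \<gamma> * v \<gamma> :: complex"
  let ?y = "operator_adjoint G x S ?w"
  define u where "u = mult_comp (indicator A) (operator_adjoint G x S) (indicator B) v"
  have w: "?w \<in> fibre_l2 G x" by (rule indicator_fibre_l2[OF v])
  have y: "?y \<in> fibre_l2 G x" by (rule fibre_operatorsD(1)[OF operator_adjoint_in[OF S] w])
  have u: "u \<in> fibre_l2 G x" unfolding u_def mult_comp_def by (rule indicator_fibre_l2[OF y])
  have Au: "(\<lambda>\<gamma>. indicator A \<gamma> * u \<gamma>) = u" by (auto simp: u_def mult_comp_def indicator_def)
  have Su: "S u \<in> fibre_l2 G x" by (rule fibre_operatorsD(1)[OF S u])
  have "fibre_inner G x u u = fibre_inner G x (\<lambda>\<gamma>. indicator A \<gamma> * u \<gamma>) ?y"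
    unfolding fibre_inner_indicator by (simp add: u_def mult_comp_def)
  also have "\<dots> = fibre_inner G x (S u) ?w"
    unfolding Au by (rule operator_adjoint_inner[OF S u w, symmetric])
  also have "\<dots> = fibre_inner G x (mult_comp (indicator B) S (indicator A) u) v"
    unfolding fibre_inner_indicator[symmetric] mult_comp_def Au ..
  finally have eq: "fibre_inner G x u u = fibre_inner G x (mult_comp (indicator B) S (indicator A) u) v" .
  have "(fibre_norm G x u)\<^sup>2 = cmod (fibre_inner G x u u)" by (simp add: fibre_inner_self norm_power)
  also have "\<dots> = cmod (fibre_inner G x (mult_comp (indicator B) S (indicator A) u) v)" by (simp only: eq)
  also have "\<dots> \<le> fibre_norm G x (mult_comp (indicator B) S (indicator A) u) * fibre_norm G x v"
  proof (rule fibre_inner_summable(2)[OF _ fibre_l2D(1)[OF v]])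
    show "square_summable G x (mult_comp (indicator B) S (indicator A) u)"
      unfolding mult_comp_def Au by (rule indicator_mult(1)[OF fibre_l2D(1)[OF Su]])
  qed
  also have "\<dots> \<le> (c * fibre_norm G x u) * fibre_norm G x v"
    by (intro mult_right_mono b[OF u]) simp
  finally have "fibre_norm G x u * fibre_norm G x u \<le> (c * fibre_norm G x v) * fibre_norm G x u"
    by (simp add: power2_eq_square mult_ac)
  then have "fibre_norm G x u \<le> c * fibre_norm G x v"
    using c by (cases "fibre_norm G x u = 0") (auto simp: order_less_le)
  then show ?thesis by (simp add: u_def)
qed

context lc_etale_groupoid
begin

text \<open>The hypotheses of the gluing construction, in a form that is stable under adjoints with
  the same C.\<close>

definition gluable :: "('g \<Rightarrow> 'g operator) \<Rightarrow> real \<Rightarrow> bool" where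
  "gluable T C \<longleftrightarrow> (\<forall>x\<in>units G. T x \<in> fibre_operators G x \<and> fibre_op_norm G x (T x) \<le> C) \<and> 0 \<le> C \<and>
     continuous_on composable (matrix_coeff T) \<and> small_off_compact G T"

lemma gluableD:
  assumes "gluable T C"
  shows "x \<in> units G \<Longrightarrow> T x \<in> fibre_operators G x"
    and "x \<in> units G \<Longrightarrow> v \<in> fibre_l2 G x \<Longrightarrow> fibre_norm G x (T x v) \<le> C * fibre_norm G x v"
    and "0 \<le> C" "continuous_on composable (matrix_coeff T)" "small_off_compact G T"
proof -
  show T: "T x \<in> fibre_operators G x" if "x \<in> units G" for x using that assms by (simp add: gluable_def)
  show "0 \<le> C" "continuous_on composable (matrix_coeff T)" "small_off_compact G T"
    using assms by (simp_all add: gluable_def)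
  assume x: "x \<in> units G" and v: "v \<in> fibre_l2 G x"
  have "fibre_op_norm G x (T x) * fibre_norm G x v \<le> C * fibre_norm G x v"
    using assms x by (intro mult_right_mono) (auto simp: gluable_def)
  with operator_norm_bound[OF T[OF x] v] show "fibre_norm G x (T x v) \<le> C * fibre_norm G x v" by (rule order_trans)
qed

text \<open>Entries of the adjoint are conjugate entries at swapped pairs, so continuity is kept.
  Separation in a fibre is symmetric in A and B, so the same K works.\<close>

lemma gluable_adjoint:
  assumes T: "gluable T C"
  shows "gluable (\<lambda>x. operator_adjoint G x (T x)) C"
  unfolding gluable_def
proof (intro conjI ballI)
  note Tx = gluableD(1)[OF T]
  show "0 \<le> C" by (rule gluableD(3)[OF T])
  show "operator_adjoint G x (T x) \<in> fibre_operators G x" if "x \<in> units G" for x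
    by (rule operator_adjoint_in[OF Tx[OF that]])
  show "fibre_op_norm G x (operator_adjoint G x (T x)) \<le> C" if x: "x \<in> units G" for x
    unfolding fibre_op_norm_def
  proof (rule op_norm_le[of "\<lambda>\<gamma>. 0"])
    fix v assume v: "v \<in> fibre_l2 G x" "fibre_norm G x v \<le> 1"
    have "fibre_norm G x (operator_adjoint G x (T x) v) \<le> fibre_op_norm G x (T x) * fibre_norm G x v"
      by (rule operator_adjoint_bound[OF Tx[OF x] v(1)])
    also have "\<dots> \<le> C * fibre_norm G x v"
      using T x by (intro mult_right_mono) (auto simp: gluable_def)
    also have "\<dots> \<le> C * 1" using gluableD(3)[OF T] v(2) by (intro mult_left_mono)
    finally show "fibre_norm G x (operator_adjoint G x (T x) v) \<le> C" by simp
  qed (simp_all add: fibre_l2_zero)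
  show "continuous_on composable (matrix_coeff (\<lambda>x. operator_adjoint G x (T x)))"
  proof -
    have "continuous_on composable (\<lambda>p. cnj (matrix_coeff T (snd p, fst p)))"
      by (intro continuous_on_cnj continuous_on_compose2[OF gluableD(4)[OF T]] continuous_intros)
         (auto simp: composable_def)
    moreover have "cnj (matrix_coeff T (snd p, fst p)) = matrix_coeff (\<lambda>x. operator_adjoint G x (T x)) p"
      if "p \<in> composable" for p
    proof -
      let ?x = "gsrc G (fst p)"
      have s: "fst p \<in> fibre G ?x" "snd p \<in> fibre G ?x" "gsrc G (snd p) = ?x"
        using that by (auto simp: composable_def fibre_def)
      have "matrix_coeff (\<lambda>x. operator_adjoint G x (T x)) p = fibre_inner G ?x (T ?x (delta (fst p))) (delta (snd p))"
        using s by (simp add: matrix_coeff_def operator_adjoint_def fibre_l2_delta)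
      also have "\<dots> = cnj (fibre_inner G ?x (delta (snd p)) (T ?x (delta (fst p))))" by (rule cnj_fibre_inner[symmetric])
      finally show ?thesis using s by (simp add: matrix_coeff_def)
    qed
    ultimately show ?thesis by (subst continuous_on_cong[OF refl]) auto
  qed
  show "small_off_compact G (\<lambda>x. operator_adjoint G x (T x))"
    unfolding small_off_compact_def
  proof (intro allI impI)
    fix \<epsilon> :: real assume e: "\<epsilon> > 0"
    obtain K where K: "compact K" "\<And>x A B v. \<lbrakk>x \<in> units G; fibre_separated G K x A B; v \<in> fibre_l2 G x\<rbrakk> \<Longrightarrow>
        fibre_norm G x (mult_comp (indicator A) (T x) (indicator B) v) \<le> \<epsilon> * fibre_norm G x v"
      using small_off_compactD[OF gluableD(5)[OF T] e] by metis
    have *: "fibre_norm G x (mult_comp (indicator A) (operator_adjoint G x (T x)) (indicator B) v) \<le> \<epsilon> * fibre_norm G x v"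
      if x: "x \<in> units G" and s: "fibre_separated G K x A B" and v: "v \<in> fibre_l2 G x" for x A B v
      by (rule adjoint_mult_comp_norm[OF Tx[OF x] v less_imp_le[OF e] K(2)[OF x fibre_separated_sym[OF s]]])
    show "\<exists>K. compact K \<and> (\<forall>x\<in>units G. \<forall>A B. fibre_separated G K x A B \<longrightarrow> (\<forall>v\<in>fibre_l2 G x.
        fibre_norm G x (mult_comp (indicator A) (operator_adjoint G x (T x)) (indicator B) v) \<le> \<epsilon> * fibre_norm G x v))"
      by (intro exI[of _ K] conjI K(1) ballI allI impI) (rule *)
  qed
qed

section \<open>Gluing the fibre operators\<close>

definition glue :: "('g \<Rightarrow> 'g operator) \<Rightarrow> ('g \<Rightarrow> complex) \<Rightarrow> 'g \<Rightarrow> complex" where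
  "glue T \<xi> = (\<lambda>\<gamma>. T (gsrc G \<gamma>) (fibre_restrict G (gsrc G \<gamma>) \<xi>) \<gamma>)"

lemma glue_fibre: "\<gamma> \<in> fibre G x \<Longrightarrow> glue T \<xi> \<gamma> = T x (fibre_restrict G x \<xi>) \<gamma>"
  by (simp add: glue_def fibre_def)

lemma fibre_restrict_glue:
  assumes "T x \<in> fibre_operators G x" "square_summable G x \<xi>"
  shows "fibre_restrict G x (glue T \<xi>) = T x (fibre_restrict G x \<xi>)"
  using fibre_l2D(2)[OF fibre_operatorsD(1)[OF assms(1) fibre_restrict_l2[OF assms(2)]]]
  by (auto simp: fun_eq_iff fibre_restrict_def[of G x "glue T \<xi>"] glue_fibre)

lemma fibre_restrict_add: "fibre_restrict G x (\<lambda>\<gamma>. \<xi> \<gamma> + \<eta> \<gamma>) = (\<lambda>\<gamma>. fibre_restrict G x \<xi> \<gamma> + fibre_restrict G x \<eta> \<gamma>)"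
  by (auto simp: fibre_restrict_def)

lemma glue_add:
  assumes T: "gluable T C" and \<xi>: "\<And>x. square_summable G x \<xi>" and \<eta>: "\<And>x. square_summable G x \<eta>"
  shows "glue T (\<lambda>\<gamma>. \<xi> \<gamma> + \<eta> \<gamma>) = (\<lambda>\<gamma>. glue T \<xi> \<gamma> + glue T \<eta> \<gamma>)"
  unfolding glue_def fibre_restrict_add
  by (simp add: fibre_operatorsD(2)[OF gluableD(1)[OF T]] fibre_restrict_l2 \<xi> \<eta>)

text \<open>More than injectivity of the source on U: the section t enters the formula for
  \<open>glue T \<xi>\<close>, so its continuity and the relative openness of its domain both
  matter.\<close>

definition is_bisection :: "'g set \<Rightarrow> ('g \<Rightarrow> 'g) \<Rightarrow> bool" where
  "is_bisection U t \<longleftrightarrow> open U \<and> openin (top_of_set (units G)) (gsrc G ` U) \<and>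
     continuous_on (gsrc G ` U) t \<and> (\<forall>\<beta>\<in>U. t (gsrc G \<beta>) = \<beta>)"

lemma open_src_vimage:
  assumes "is_bisection U t"
  shows "open (gsrc G -` gsrc G ` U)"
proof -
  obtain W where W: "open W" "gsrc G ` U = units G \<inter> W"
    using assms unfolding is_bisection_def openin_open by blast
  have "gsrc G -` gsrc G ` U = gsrc G -` W" unfolding W(2) by auto
  then show ?thesis using open_vimage[OF W(1) continuous_src] by simp
qed

lemma glue_continuous_on_bisection:
  assumes T: "gluable T C" and U: "is_bisection U t" and \<xi>: "\<xi> \<in> cont_compact_supp" "supp \<xi> \<subseteq> U"
  shows "continuous_on UNIV (glue T \<xi>)"
proof -
  \<comment> \<open>The product formula is available only over the source image of U. Continuity
    across the boundary comes from a second set, where the value is 0; it is open because the source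
    image of the compact support is closed.\<close>
  let ?O1 = "gsrc G -` gsrc G ` U" and ?O2 = "- (gsrc G -` gsrc G ` supp \<xi>)"
  have tU: "t (gsrc G \<beta>) = \<beta>" if "\<beta> \<in> U" for \<beta> using U that by (simp add: is_bisection_def)
  have zero: "\<xi> \<gamma> = 0" if "\<gamma> \<notin> supp \<xi>" for \<gamma> by (rule not_in_supp[OF that])
  have val1: "glue T \<xi> \<gamma> = \<xi> (t (gsrc G \<gamma>)) * matrix_coeff T (\<gamma>, t (gsrc G \<gamma>))" if \<gamma>: "\<gamma> \<in> ?O1" for \<gamma>
  proof -
    let ?x = "gsrc G \<gamma>"
    obtain \<beta> where \<beta>: "\<beta> \<in> U" "gsrc G \<beta> = ?x" using \<gamma> unfolding vimage_eq image_iff by metis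
    have "t ?x = \<beta>" using tU[OF \<beta>(1)] \<beta>(2) by simp
    have "fibre_restrict G ?x \<xi> = (\<lambda>\<gamma>'. \<xi> \<beta> * delta \<beta> \<gamma>')"
    proof
      fix \<gamma>'
      have "\<gamma>' = \<beta>" if "\<gamma>' \<in> fibre G ?x" "\<xi> \<gamma>' \<noteq> 0"
      proof -
        have "\<gamma>' \<in> U" using zero that(2) \<xi>(2) by blast
        then show ?thesis using tU[of \<gamma>'] that(1) \<open>t ?x = \<beta>\<close> by (simp add: fibre_def)
      qed
      then show "fibre_restrict G ?x \<xi> \<gamma>' = \<xi> \<beta> * delta \<beta> \<gamma>'"
        using \<beta>(2) by (cases "\<gamma>' = \<beta>") (auto simp: fibre_restrict_def delta_def fibre_def)
    qed
    moreover have "delta \<beta> \<in> fibre_l2 G ?x" using \<beta>(2) by (intro fibre_l2_delta) (simp add: fibre_def)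
    ultimately show ?thesis
      using \<open>t ?x = \<beta>\<close> by (simp add: glue_def matrix_coeff_def fibre_operatorsD(3)[OF gluableD(1)[OF T]])
  qed
  have val2: "glue T \<xi> \<gamma> = 0" if "\<gamma> \<in> ?O2" for \<gamma>
  proof -
    have "fibre_restrict G (gsrc G \<gamma>) \<xi> = (\<lambda>\<gamma>'. 0)"
    proof
      fix \<gamma>'
      have "\<xi> \<gamma>' = 0" if src: "gsrc G \<gamma>' = gsrc G \<gamma>"
      proof (rule zero, rule notI)
        assume "\<gamma>' \<in> supp \<xi>"
        then have "gsrc G \<gamma> \<in> gsrc G ` supp \<xi>" unfolding src[symmetric] by (rule imageI)
        with \<open>\<gamma> \<in> ?O2\<close> show False by simp
      qed
      then show "fibre_restrict G (gsrc G \<gamma>) \<xi> \<gamma>' = 0" by (simp add: fibre_restrict_def fibre_def)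
    qed
    then show ?thesis by (simp add: glue_def operator_zero[OF gluableD(1)[OF T]])
  qed
  have o1: "open ?O1" by (rule open_src_vimage[OF U])
  have "compact (gsrc G ` supp \<xi>)"
    using \<xi>(1) continuous_on_subset[OF continuous_src] by (intro compact_continuous_image) (auto simp: cont_compact_supp_def)
  then have o2: "open ?O2"
    using closed_vimage[OF compact_imp_closed continuous_src] by (auto simp: open_Compl)
  have c1: "continuous_on ?O1 (glue T \<xi>)"
  proof -
    have t: "continuous_on ?O1 (\<lambda>\<gamma>. t (gsrc G \<gamma>))"
      using U continuous_on_subset[OF continuous_src]
      by (intro continuous_on_compose2[of "gsrc G ` U" t ?O1 "gsrc G"]) (auto simp: is_bisection_def)
    have x: "continuous_on ?O1 (\<lambda>\<gamma>. \<xi> (t (gsrc G \<gamma>)))"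
      using \<xi>(1) by (intro continuous_on_compose2[OF _ t, of UNIV]) (auto simp: cont_compact_supp_def)
    have m: "continuous_on ?O1 (\<lambda>\<gamma>. matrix_coeff T (\<gamma>, t (gsrc G \<gamma>)))"
    proof (rule continuous_on_compose2[OF gluableD(4)[OF T]])
      show "continuous_on ?O1 (\<lambda>\<gamma>. (\<gamma>, t (gsrc G \<gamma>)))" by (intro continuous_on_Pair continuous_on_id t)
      show "(\<lambda>\<gamma>. (\<gamma>, t (gsrc G \<gamma>))) ` ?O1 \<subseteq> composable"
        using tU by (auto simp: composable_def)
    qed
    from continuous_on_mult[OF x m] show ?thesis
      by (subst continuous_on_cong[OF refl val1])
  qed
  have c2: "continuous_on ?O2 (glue T \<xi>)"
    by (subst continuous_on_cong[OF refl val2]) auto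
  have "gsrc G ` supp \<xi> \<subseteq> gsrc G ` U" using \<xi>(2) by blast
  then have "?O1 \<union> ?O2 = UNIV" by blast
  with continuous_on_open_Un[OF o1 o2 c1 c2] show ?thesis by simp
qed

lemma cont_compact_square_summable: "u \<in> cont_compact_supp \<Longrightarrow> square_summable G x u"
  by (rule L2_square_summable[OF cont_compact_supp_L2])

text \<open>Bisections are peeled off one at a time in place of a partition of unity: h is 1 near
  the part of the support that the other bisections miss, so \<open>\<xi>1\<close> lives on one
  bisection and \<open>\<xi>2\<close> on the rest.\<close>

lemma glue_continuous_cover:
  assumes T: "gluable T C" and "finite D" "\<And>d. d \<in> D \<Longrightarrow> is_bisection (U d) (t d)"
    "\<xi> \<in> cont_compact_supp" "supp \<xi> \<subseteq> (\<Union>d\<in>D. U d)"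
  shows "continuous_on UNIV (glue T \<xi>)"
  using assms(2-5)
proof (induction D arbitrary: \<xi>)
  case empty
  then have "\<xi> = (\<lambda>\<gamma>. 0)" using not_in_supp[of _ \<xi>] by auto
  moreover have "glue T (\<lambda>\<gamma>. 0) = (\<lambda>\<gamma>. 0)"
    using glue_add[OF T square_summable_zero square_summable_zero] by (auto simp: fun_eq_iff)
  ultimately show ?case by simp
next
  case (insert d D)
  let ?V = "\<Union>d\<in>D. U d"
  have V: "open ?V" using insert.prems(1) by (auto simp: is_bisection_def)
  have cpt: "compact (supp \<xi> - ?V)"
    using insert.prems(2) V by (auto simp: cont_compact_supp_def intro: compact_diff)
  have Ud: "open (U d)" using insert.prems(1) by (simp add: is_bisection_def)
  obtain h W where h: "h \<in> cont_compact_supp" "supp h \<subseteq> U d" "open W" "supp \<xi> - ?V \<subseteq> W" "\<And>\<gamma>. \<gamma> \<in> W \<Longrightarrow> h \<gamma> = 1"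
    by (rule bump_function[OF cpt Ud]) (use insert.prems(3) in auto)
  have hc: "continuous_on UNIV h" using h(1) by (simp add: cont_compact_supp_def)
  define \<xi>1 \<xi>2 where "\<xi>1 = (\<lambda>\<gamma>. h \<gamma> * \<xi> \<gamma>)" and "\<xi>2 = (\<lambda>\<gamma>. (1 - h \<gamma>) * \<xi> \<gamma>)"
  have 1: "\<xi>1 \<in> cont_compact_supp" unfolding \<xi>1_def by (rule cont_compact_supp_mult[OF insert.prems(2) hc])
  have 2: "\<xi>2 \<in> cont_compact_supp" unfolding \<xi>2_def
    by (intro cont_compact_supp_mult[OF insert.prems(2)] continuous_on_diff hc continuous_on_const)
  have "supp \<xi>1 \<subseteq> supp h"
    by (rule supp_subsetI) (auto simp: \<xi>1_def intro: ccontr dest: not_in_supp[of _ h])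
  then have c1: "continuous_on UNIV (glue T \<xi>1)"
    using h(2) insert.prems(1) by (intro glue_continuous_on_bisection[OF T _ 1, of "U d" "t d"]) auto
  \<comment> \<open>The support is a closure; since h is 1 on the open set W, and not just on the
    compact remainder, it stays inside the other bisections.\<close>
  have "supp \<xi>2 \<subseteq> supp \<xi> \<inter> - W"
  proof (rule supp_subsetI)
    show "closed (supp \<xi> \<inter> - W)" using h(3) by (intro closed_Int) auto
    show "\<gamma> \<in> supp \<xi> \<inter> - W" if "\<xi>2 \<gamma> \<noteq> 0" for \<gamma>
      using that not_in_supp[of \<gamma> \<xi>] h(5)[of \<gamma>] by (auto simp: \<xi>2_def)
  qed
  then have "supp \<xi>2 \<subseteq> ?V" using h(4) by blast
  then have c2: "continuous_on UNIV (glue T \<xi>2)" using insert.IH[OF _ 2] insert.prems(1) by simp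
  have "\<xi> = (\<lambda>\<gamma>. \<xi>1 \<gamma> + \<xi>2 \<gamma>)" by (auto simp: \<xi>1_def \<xi>2_def algebra_simps)
  then have "glue T \<xi> = (\<lambda>\<gamma>. glue T \<xi>1 \<gamma> + glue T \<xi>2 \<gamma>)"
    using glue_add[OF T cont_compact_square_summable[OF 1] cont_compact_square_summable[OF 2]] by simp
  with continuous_on_add[OF c1 c2] show ?case by simp
qed

lemma glue_continuous:
  assumes T: "gluable T C" and \<xi>: "\<xi> \<in> cont_compact_supp"
  shows "continuous_on UNIV (glue T \<xi>)"
proof -
  have "\<exists>U t. \<gamma> \<in> U \<and> is_bisection U t" for \<gamma>
    unfolding is_bisection_def using src_local_section[of \<gamma>] by metis
  then obtain U t where U: "\<And>\<gamma>. \<gamma> \<in> U \<gamma>" "\<And>\<gamma>. is_bisection (U \<gamma>) (t \<gamma>)" by metis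
  obtain D where D: "D \<subseteq> supp \<xi>" "finite D" "supp \<xi> \<subseteq> (\<Union>d\<in>D. U d)"
  proof (rule compactE_image[of "supp \<xi>" "supp \<xi>" U])
    show "compact (supp \<xi>)" using \<xi> by (simp add: cont_compact_supp_def)
    show "open (U \<gamma>)" for \<gamma> using U(2)[of \<gamma>] by (simp add: is_bisection_def)
  qed (use U(1) in auto)
  show ?thesis by (rule glue_continuous_cover[OF T D(2) U(2) \<xi> D(3)])
qed

text \<open>Off the compact set \<open>(K \<union> K\<inverse>) \<cdot> supp \<xi>\<close> the function \<open>glue T \<xi>\<close> is small, so cutting it off there
  yields an approximation in \<open>C\<^sub>c\<close>.\<close>

lemma glue_cont_compact_L2:
  assumes T: "gluable T C" and \<xi>: "\<xi> \<in> cont_compact_supp"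
  shows "glue T \<xi> \<in> L2 G"
proof (rule L2_closed)
  fix \<epsilon> :: real assume e: "\<epsilon> > 0"
  obtain M where M: "\<And>x. square_summable G x \<xi>" "\<And>x. fibre_norm G x \<xi> \<le> M"
    by (rule cont_compact_fibre_norm[OF \<xi>]) blast
  have M0: "0 \<le> M" using order_trans[OF fibre_norm_nonneg M(2)] .
  define \<delta> where "\<delta> = \<epsilon> / (M + 1)"
  have \<delta>: "\<delta> > 0" "\<delta> * M \<le> \<epsilon>" using e M0 by (auto simp: \<delta>_def field_simps)
  obtain K where K: "compact K" "\<And>x A B v. \<lbrakk>x \<in> units G; fibre_separated G K x A B; v \<in> fibre_l2 G x\<rbrakk> \<Longrightarrow>
      fibre_norm G x (mult_comp (indicator A) (T x) (indicator B) v) \<le> \<delta> * fibre_norm G x v"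
    using small_off_compactD[OF gluableD(5)[OF T] \<delta>(1)] by metis
  define L where "L = set_mul G (K \<union> ginv G ` K) (supp \<xi>)"
  have "compact (ginv G ` K)"
    using K(1) continuous_on_subset[OF continuous_inv] by (intro compact_continuous_image) auto
  then have L: "compact L"
    unfolding L_def using K(1) \<xi> by (intro compact_set_mul compact_Un) (auto simp: cont_compact_supp_def)
  obtain h W where h: "h \<in> cont_compact_supp" "\<And>\<gamma>. cmod (1 - h \<gamma>) \<le> 1" "L \<subseteq> W" "\<And>\<gamma>. \<gamma> \<in> W \<Longrightarrow> h \<gamma> = 1"
    by (rule bump_function[OF L open_UNIV]) auto
  define \<eta> where "\<eta> = (\<lambda>\<gamma>. glue T \<xi> \<gamma> * h \<gamma>)"
  have \<eta>: "\<eta> \<in> cont_compact_supp"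
    unfolding \<eta>_def by (rule cont_compact_supp_mult[OF h(1) glue_continuous[OF T \<xi>]])
  have "square_summable G x (\<lambda>\<gamma>. glue T \<xi> \<gamma> - \<eta> \<gamma>) \<and> fibre_norm G x (\<lambda>\<gamma>. glue T \<xi> \<gamma> - \<eta> \<gamma>) \<le> \<epsilon>" for x
  proof (cases "x \<in> units G")
    case False
    then show ?thesis using e by (simp add: square_summable_def fibre_norm_def fibre_not_unit)
  next
    case True
    define A B where "A = fibre G x - L" and "B = supp \<xi> \<inter> fibre G x"
    have mono: "set_mul G K B \<subseteq> L" "set_mul G (ginv G ` K) B \<subseteq> L"
      unfolding L_def B_def set_mul_def by blast+
    have sep: "fibre_separated G K x A B"
      unfolding fibre_separated_def set_mul_inverse_disjoint[of K A B]
      using mono by (auto simp: A_def B_def)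
    let ?v = "fibre_restrict G x \<xi>"
    have v: "?v \<in> fibre_l2 G x" by (rule fibre_restrict_l2[OF M(1)])
    have Bv: "(\<lambda>\<gamma>. indicator B \<gamma> * ?v \<gamma>) = ?v"
      using not_in_supp[of _ \<xi>] by (auto simp: B_def indicator_def fibre_restrict_def fun_eq_iff)
    let ?w = "mult_comp (indicator A) (T x) (indicator B) ?v"
    have w: "square_summable G x ?w"
      unfolding mult_comp_def Bv
      by (rule indicator_mult(1)[OF fibre_l2D(1)[OF fibre_operatorsD(1)[OF gluableD(1)[OF T True] v]]])
    \<comment> \<open>Nothing is lost on L, where h is 1. Points where the cut-off is only partial
      lie outside L, hence in A, and there the bound on \<open>1 - h\<close> applies.\<close>
    have le: "cmod (glue T \<xi> \<gamma> - \<eta> \<gamma>) \<le> cmod (?w \<gamma>)" if \<gamma>: "\<gamma> \<in> fibre G x" for \<gamma>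
    proof (cases "\<gamma> \<in> L")
      case True
      then have "h \<gamma> = 1" using h(3,4) by blast
      then show ?thesis by (simp add: \<eta>_def)
    next
      case False
      have "glue T \<xi> \<gamma> - \<eta> \<gamma> = (1 - h \<gamma>) * T x ?v \<gamma>" by (simp add: \<eta>_def glue_fibre[OF \<gamma>] algebra_simps)
      moreover have "?w \<gamma> = T x ?v \<gamma>" using False \<gamma> unfolding mult_comp_def Bv by (simp add: A_def)
      ultimately show ?thesis using h(2)[of \<gamma>] by (simp add: norm_mult mult_left_le_one_le)
    qed
    have "fibre_norm G x (\<lambda>\<gamma>. glue T \<xi> \<gamma> - \<eta> \<gamma>) \<le> fibre_norm G x ?w" by (rule fibre_norm_mono(2)[OF w le])
    also have "\<dots> \<le> \<delta> * fibre_norm G x ?v" by (rule K(2)[OF True sep v])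
    also have "\<dots> \<le> \<delta> * M" using M(2) \<delta>(1) by (intro mult_left_mono) auto
    finally show ?thesis using \<delta>(2) fibre_norm_mono(1)[OF w le] by auto
  qed
  then have "fibrewise_close G \<epsilon> (glue T \<xi>) \<eta>" by (simp add: fibrewise_close_def)
  then show "\<exists>\<eta>\<in>L2 G. fibrewise_close G \<epsilon> (glue T \<xi>) \<eta>" using cont_compact_supp_L2[OF \<eta>] by blast
qed

text \<open>The uniform bound C makes \<open>glue T\<close> Lipschitz for the fibrewise distance, so
  the case of \<open>C\<^sub>c\<close> extends by density and completeness.\<close>

lemma glue_L2:
  assumes T: "gluable T C" and \<xi>: "\<xi> \<in> L2 G"
  shows "glue T \<xi> \<in> L2 G"
proof (rule L2_closed)
  fix \<epsilon> :: real assume e: "\<epsilon> > 0"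
  note C = gluableD(3)[OF T]
  define \<delta> where "\<delta> = \<epsilon> / (C + 1)"
  have \<delta>: "\<delta> > 0" "C * \<delta> \<le> \<epsilon>" using e C by (auto simp: \<delta>_def field_simps)
  obtain u where u: "u \<in> cont_compact_supp" "fibrewise_close G \<delta> \<xi> u"
    using \<xi> \<delta>(1) unfolding L2_iff by blast
  let ?d = "\<lambda>\<gamma>. \<xi> \<gamma> - u \<gamma>"
  have d: "square_summable G x ?d" "fibre_norm G x ?d \<le> \<delta>" for x
    using u(2) unfolding fibrewise_close_def by blast+
  have eq: "glue T \<xi> \<gamma> - glue T u \<gamma> = glue T ?d \<gamma>" for \<gamma>
    using fun_cong[OF glue_add[OF T d(1) cont_compact_square_summable[OF u(1)]], of \<gamma>] by simp
  have "square_summable G x (glue T ?d) \<and> fibre_norm G x (glue T ?d) \<le> \<epsilon>" for x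
  proof (cases "x \<in> units G")
    case False
    then show ?thesis using e by (simp add: square_summable_def fibre_norm_def fibre_not_unit)
  next
    case True
    let ?v = "fibre_restrict G x ?d"
    have v: "?v \<in> fibre_l2 G x" by (rule fibre_restrict_l2[OF d(1)])
    have "fibre_norm G x (glue T ?d) = fibre_norm G x (T x ?v)" by (rule fibre_norm_cong[OF glue_fibre])
    also have "\<dots> \<le> C * fibre_norm G x ?v" by (rule gluableD(2)[OF T True v])
    also have "\<dots> \<le> C * \<delta>" using d(2) C by (intro mult_left_mono) auto
    finally have le: "fibre_norm G x (glue T ?d) \<le> \<epsilon>" using \<delta>(2) by simp
    have "square_summable G x (glue T ?d) \<longleftrightarrow> square_summable G x (T x ?v)" by (rule square_summable_cong[OF glue_fibre])
    with le show ?thesis using fibre_l2D(1)[OF fibre_operatorsD(1)[OF gluableD(1)[OF T True] v]] by simp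
  qed
  then have "fibrewise_close G \<epsilon> (glue T \<xi>) (glue T u)" by (simp add: fibrewise_close_def eq)
  then show "\<exists>\<eta>\<in>L2 G. fibrewise_close G \<epsilon> (glue T \<xi>) \<eta>"
    using glue_cont_compact_L2[OF T u(1)] by blast
qed

lemma gluable_global_operator:
  assumes T: "gluable T C"
  obtains S A where "S \<in> extensional (L2 G)" "adjoint_pair G S A" "\<And>x. x \<in> units G \<Longrightarrow> is_slice x S (T x)"
proof -
  let ?T' = "\<lambda>x. operator_adjoint G x (T x)"
  note T' = gluable_adjoint[OF T]
  define S where "S = restrict (glue T) (L2 G)"
  have S: "S \<xi> = glue T \<xi>" if "\<xi> \<in> L2 G" for \<xi> using that by (simp add: S_def)
  have "fibre_inner G x (S \<eta>) \<xi> = fibre_inner G x \<eta> (glue ?T' \<xi>)" if \<eta>: "\<eta> \<in> L2 G" and \<xi>: "\<xi> \<in> L2 G" for \<eta> \<xi> x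
  proof (cases "x \<in> units G")
    case False
    then show ?thesis by (simp add: fibre_inner_def fibre_not_unit)
  next
    case True
    let ?r = "fibre_restrict G x"
    have "fibre_inner G x (S \<eta>) \<xi> = fibre_inner G x (?r (glue T \<eta>)) (?r \<xi>)"
      by (simp add: S[OF \<eta>] fibre_inner_restrict_left fibre_inner_restrict_right)
    also have "\<dots> = fibre_inner G x (T x (?r \<eta>)) (?r \<xi>)"
      by (simp only: fibre_restrict_glue[where T = T and x = x, OF gluableD(1)[OF T True] L2_square_summable[OF \<eta>]])
    also have "\<dots> = fibre_inner G x (?r \<eta>) (?T' x (?r \<xi>))"
      by (rule operator_adjoint_inner[OF gluableD(1)[OF T True] L2_restrict[OF \<eta>] L2_restrict[OF \<xi>]])
    also have "\<dots> = fibre_inner G x (?r \<eta>) (?r (glue ?T' \<xi>))"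
      by (simp only: fibre_restrict_glue[where T = ?T' and x = x, OF gluableD(1)[OF T' True] L2_square_summable[OF \<xi>]])
    finally show ?thesis by (simp add: fibre_inner_restrict_left fibre_inner_restrict_right)
  qed
  then have P: "adjoint_pair G S (glue ?T')"
    unfolding adjoint_pair_def using glue_L2[OF T] glue_L2[OF T'] S by simp
  show thesis
  proof (rule that[OF _ P])
    show "S \<in> extensional (L2 G)" by (simp add: S_def)
    show "is_slice x S (T x)" if "x \<in> units G" for x
      unfolding is_slice_def
      using gluableD(1)[OF T that] fibre_restrict_glue[where T = T and x = x, OF gluableD(1)[OF T that] L2_square_summable] S by simp
  qed
qed

section \<open>Locality of the glued operator\<close>

lemma supports_fibre_separated:
  assumes "separated G K f g"
  shows "fibre_separated G K x (supp (apply_bcontfun g) \<inter> fibre G x) (supp (apply_bcontfun f) \<inter> fibre G x)"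
  using assms unfolding separated_def fibre_separated_def set_mul_def by blast

text \<open>Each of f and g is unchanged by the indicator of its support, so on a fibre the global
  product factors through the compression of the slice to the two supports.\<close>

lemma mult_comp_fibre:
  fixes f g :: "'g \<Rightarrow>\<^sub>C complex"
  assumes sl: "is_slice x S R" and \<xi>: "\<xi> \<in> L2 G" and \<gamma>: "\<gamma> \<in> fibre G x"
  defines "v \<equiv> fibre_restrict G x (\<lambda>\<gamma>. apply_bcontfun f \<gamma> * \<xi> \<gamma>)"
  shows "mult_comp (apply_bcontfun g) S (apply_bcontfun f) \<xi> \<gamma>
    = apply_bcontfun g \<gamma> * mult_comp (indicator (supp (apply_bcontfun g) \<inter> fibre G x)) R (indicator (supp (apply_bcontfun f) \<inter> fibre G x)) v \<gamma>"
proof -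
  have "(\<lambda>\<gamma>. indicator (supp (apply_bcontfun f) \<inter> fibre G x) \<gamma> * v \<gamma>) = v"
    using not_in_supp[of _ "apply_bcontfun f"] by (auto simp: v_def indicator_def fibre_restrict_def fun_eq_iff)
  moreover have "R v = fibre_restrict G x (S (\<lambda>\<gamma>. apply_bcontfun f \<gamma> * \<xi> \<gamma>))"
    using sl bcontfun_mult_L2[OF \<xi>] unfolding is_slice_def v_def by blast
  ultimately show ?thesis
    using not_in_supp[of \<gamma> "apply_bcontfun g"] \<gamma>
    by (auto simp: mult_comp_def indicator_def fibre_restrict_def[of G x "S _"])
qed

lemma slices_quasi_local:
  assumes P: "adjoint_pair G S A" and sl: "\<And>x. x \<in> units G \<Longrightarrow> is_slice x S (T x)" and q: "small_off_compact G T"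
  shows "quasi_local G S"
  unfolding quasi_local_def
proof (intro allI impI)
  fix \<epsilon> :: real assume e: "\<epsilon> > 0"
  \<comment> \<open>Half of \<epsilon> leaves room for the strict inequality when neither f nor g is
    0.\<close>
  then have e2: "\<epsilon> / 2 > 0" by simp
  obtain K where K: "compact K" "\<And>x A B v. \<lbrakk>x \<in> units G; fibre_separated G K x A B; v \<in> fibre_l2 G x\<rbrakk> \<Longrightarrow>
      fibre_norm G x (mult_comp (indicator A) (T x) (indicator B) v) \<le> \<epsilon> / 2 * fibre_norm G x v"
    using small_off_compactD[OF q e2] by metis
  have le: "module_op_norm G (mult_comp (apply_bcontfun g) S (apply_bcontfun f)) \<le> \<epsilon> / 2 * norm g * norm f"
    if fg: "separated G K f g" for f g
    unfolding module_op_norm_def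
  proof (rule op_norm_le[of "\<lambda>\<gamma>. 0"])
    show "(\<lambda>\<gamma>. 0) \<in> L2 G" by (rule cont_compact_supp_L2[OF cont_compact_supp_zero])
    show "module_norm G (\<lambda>\<gamma>. 0) \<le> 1" by (rule module_norm_le) simp
    fix \<xi> assume \<xi>: "\<xi> \<in> L2 G" "module_norm G \<xi> \<le> 1"
    show "module_norm G (mult_comp (apply_bcontfun g) S (apply_bcontfun f) \<xi>) \<le> \<epsilon> / 2 * norm g * norm f"
    proof (rule module_norm_le)
      fix x assume x: "x \<in> units G"
      let ?A = "supp (apply_bcontfun g) \<inter> fibre G x" and ?B = "supp (apply_bcontfun f) \<inter> fibre G x"
      let ?f\<xi> = "\<lambda>\<gamma>. apply_bcontfun f \<gamma> * \<xi> \<gamma>"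
      let ?v = "fibre_restrict G x ?f\<xi>"
      let ?w = "mult_comp (indicator ?A) (T x) (indicator ?B) ?v"
      have v: "?v \<in> fibre_l2 G x" by (rule L2_restrict[OF bcontfun_mult_L2[OF \<xi>(1)]])
      have Tx: "T x \<in> fibre_operators G x" using sl[OF x] by (simp add: is_slice_def)
      have w: "square_summable G x ?w"
        unfolding mult_comp_def
        by (rule indicator_mult(1)[OF fibre_l2D(1)[OF fibre_operatorsD(1)[OF Tx indicator_fibre_l2[OF v]]]])
      have "fibre_norm G x (mult_comp (apply_bcontfun g) S (apply_bcontfun f) \<xi>) = fibre_norm G x (\<lambda>\<gamma>. apply_bcontfun g \<gamma> * ?w \<gamma>)"
        by (rule fibre_norm_cong) (rule mult_comp_fibre[OF sl[OF x] \<xi>(1)])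
      also have "\<dots> \<le> norm g * fibre_norm G x ?w"
        by (rule square_summable_mult(2)[OF w norm_bounded]) simp
      also have "\<dots> \<le> norm g * (\<epsilon> / 2 * fibre_norm G x ?v)"
        by (intro mult_left_mono K(2)[OF x supports_fibre_separated[OF fg] v]) simp
      also have "\<dots> \<le> norm g * (\<epsilon> / 2 * (norm f * 1))"
      proof (intro mult_left_mono)
        have "fibre_norm G x ?v \<le> norm f * fibre_norm G x \<xi>"
          unfolding fibre_norm_restrict
          by (rule square_summable_mult(2)[OF L2_square_summable[OF \<xi>(1)] norm_bounded]) simp
        also have "\<dots> \<le> norm f * 1"
          using order_trans[OF L2_fibre_norm_le[OF \<xi>(1)] \<xi>(2)] by (intro mult_left_mono) auto
        finally show "fibre_norm G x ?v \<le> norm f * 1" .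
      qed (use e in auto)
      finally show "fibre_norm G x (mult_comp (apply_bcontfun g) S (apply_bcontfun f) \<xi>) \<le> \<epsilon> / 2 * norm g * norm f"
        by (simp add: mult_ac)
    qed
  qed
  have *: "if f = 0 \<or> g = 0
      then module_op_norm G (mult_comp (apply_bcontfun g) S (apply_bcontfun f)) \<le> \<epsilon> * norm g * norm f
      else module_op_norm G (mult_comp (apply_bcontfun g) S (apply_bcontfun f)) < \<epsilon> * norm g * norm f"
    if fg: "separated G K f g" for f g
  proof (cases "f = 0 \<or> g = 0")
    case True
    have "\<epsilon> / 2 * norm g * norm f \<le> \<epsilon> * norm g * norm f" using e by (intro mult_right_mono) auto
    then show ?thesis unfolding if_P[OF True] by (rule order_trans[OF le[OF fg]])
  next
    case False
    then have "\<epsilon> / 2 * norm g * norm f < \<epsilon> * norm g * norm f" using e by simp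
    then show ?thesis unfolding if_not_P[OF False] by (rule le_less_trans[OF le[OF fg]])
  qed
  show "\<exists>K. compact K \<and> (\<forall>f g. separated G K f g \<longrightarrow>
      (if f = 0 \<or> g = 0
       then module_op_norm G (mult_comp (apply_bcontfun g) S (apply_bcontfun f)) \<le> \<epsilon> * norm g * norm f
       else module_op_norm G (mult_comp (apply_bcontfun g) S (apply_bcontfun f)) < \<epsilon> * norm g * norm f))"
    by (intro exI[of _ K] conjI K(1) allI impI) (rule *)
qed

lemma slices_compactly_supported:
  assumes sl: "\<And>x. x \<in> units G \<Longrightarrow> is_slice x S (T x)" and K: "compact K"
    and Kz: "\<And>x A B v. \<lbrakk>x \<in> units G; fibre_separated G K x A B; v \<in> fibre_l2 G x\<rbrakk> \<Longrightarrow>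
        mult_comp (indicator A) (T x) (indicator B) v = (\<lambda>\<gamma>. 0)"
  shows "compactly_supported G S"
  unfolding compactly_supported_def
proof (intro exI[of _ K] conjI K allI impI ballI ext)
  fix f g \<xi> \<gamma> assume fg: "separated G K f g" and \<xi>: "\<xi> \<in> L2 G"
  let ?x = "gsrc G \<gamma>"
  have v: "fibre_restrict G ?x (\<lambda>\<gamma>. apply_bcontfun f \<gamma> * \<xi> \<gamma>) \<in> fibre_l2 G ?x"
    by (rule L2_restrict[OF bcontfun_mult_L2[OF \<xi>]])
  show "mult_comp (apply_bcontfun g) S (apply_bcontfun f) \<xi> \<gamma> = 0"
    using mult_comp_fibre[OF sl[OF src_in_units] \<xi> in_fibre_src, of g f \<gamma>]
      Kz[OF src_in_units supports_fibre_separated[OF fg] v] by simp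
qed

lemma adjointable_slices_iff:
  "S \<in> adjointable G \<and> (\<forall>x\<in>units G. slice G x S = T x) \<longleftrightarrow>
    S \<in> extensional (L2 G) \<and> (\<exists>A. adjoint_pair G S A) \<and> (\<forall>x\<in>units G. is_slice x S (T x))"
  using slice_eq_iff[OF is_slice_exists] unfolding adjointable_iff by blast

lemma continuous_family_global_operator:
  assumes T: "T \<in> bounded_operator_families G" and c: "continuous_section G T" and q: "small_off_compact G T"
  obtains S A where "S \<in> adjointable G" "\<forall>x\<in>units G. slice G x S = T x" "adjoint_pair G S A"
    "\<And>x. x \<in> units G \<Longrightarrow> is_slice x S (T x)"
proof -
  obtain C where C: "\<And>x. x \<in> units G \<Longrightarrow> T x \<in> fibre_operators G x \<and> fibre_op_norm G x (T x) \<le> C"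
    using T unfolding bounded_operator_families_def by blast
  have Tx: "\<And>x. x \<in> units G \<Longrightarrow> T x \<in> fibre_operators G x" using C by blast
  have "gluable T \<bar>C\<bar>"
    unfolding gluable_def using C q continuous_section_iff[OF Tx] c by force
  then obtain S A where S: "S \<in> extensional (L2 G)" "adjoint_pair G S A" "\<And>x. x \<in> units G \<Longrightarrow> is_slice x S (T x)"
    by (rule gluable_global_operator) blast
  then have "S \<in> adjointable G \<and> (\<forall>x\<in>units G. slice G x S = T x)"
    unfolding adjointable_slices_iff by blast
  with S show thesis using that by blast
qed

end

theorem corollary4p6:
  fixes G :: "'g::t2_space groupoid_data"
    and T :: "'g \<Rightarrow> 'g operator"
  assumes "lc_etale_groupoid G"
    and "T \<in> bounded_operator_families G"
  shows "((\<exists>S\<in>adjointable G. quasi_local G S \<and> (\<forall>x\<in>units G. slice G x S = T x))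
            \<longleftrightarrow> continuous_section G T \<and> compactly_uniformly_quasi_local G T)
       \<and> ((\<exists>S\<in>adjointable G. compactly_supported G S \<and> (\<forall>x\<in>units G. slice G x S = T x))
            \<longleftrightarrow> continuous_section G T \<and>
                (\<exists>K. compact K \<and>
                   (\<forall>x\<in>units G. \<forall>A B. fibre_separated G K x A B \<longrightarrow>
                      (\<forall>v\<in>fibre_l2 G x. mult_comp (indicator A) (T x) (indicator B) v = (\<lambda>\<gamma>. 0)))))"
proof -
  interpret lc_etale_groupoid G by (rule assms(1))
  note T = assms(2)
  have Tx: "\<And>x. x \<in> units G \<Longrightarrow> T x \<in> fibre_operators G x"
    using T by (simp add: bounded_operator_families_def)
  \<comment> \<open>Shared by both equivalences: the section is continuous for every adjointable
    operator with these slices.\<close>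
  have slices: "\<exists>A. adjoint_pair G S A" "\<And>x. x \<in> units G \<Longrightarrow> is_slice x S (T x)" "continuous_section G T"
    if "S \<in> adjointable G" "\<forall>x\<in>units G. slice G x S = T x" for S
  proof -
    show P: "\<exists>A. adjoint_pair G S A" and sl: "\<And>x. x \<in> units G \<Longrightarrow> is_slice x S (T x)"
      using that adjointable_slices_iff[of S T] by blast+
    show "continuous_section G T"
      using P slices_matrix_coeff_continuous[OF _ sl] continuous_section_iff[OF Tx] by blast
  qed
  show ?thesis
  proof (intro conjI iffI)
    assume "\<exists>S\<in>adjointable G. quasi_local G S \<and> (\<forall>x\<in>units G. slice G x S = T x)"
    then obtain S where S: "S \<in> adjointable G" "quasi_local G S" "\<forall>x\<in>units G. slice G x S = T x" by blast
    show "continuous_section G T" by (rule slices(3)[OF S(1,3)])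
    obtain A where "adjoint_pair G S A" using slices(1)[OF S(1,3)] by blast
    then show "compactly_uniformly_quasi_local G T"
      by (rule quasi_local_slices[OF _ T slices(2)[OF S(1,3)] S(2)])
  next
    assume a: "continuous_section G T \<and> compactly_uniformly_quasi_local G T"
    then have q: "small_off_compact G T" using quasi_local_small_off_compact[OF Tx] by blast
    obtain S A where S: "S \<in> adjointable G" "\<forall>x\<in>units G. slice G x S = T x" "adjoint_pair G S A"
      "\<And>x. x \<in> units G \<Longrightarrow> is_slice x S (T x)"
      by (rule continuous_family_global_operator[OF T _ q]) (use a in blast)+
    have "quasi_local G S" by (rule slices_quasi_local[OF S(3,4) q])
    with S(1,2) show "\<exists>S\<in>adjointable G. quasi_local G S \<and> (\<forall>x\<in>units G. slice G x S = T x)" by blast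
  next
    assume "\<exists>S\<in>adjointable G. compactly_supported G S \<and> (\<forall>x\<in>units G. slice G x S = T x)"
    then obtain S where S: "S \<in> adjointable G" "compactly_supported G S" "\<forall>x\<in>units G. slice G x S = T x" by blast
    show "continuous_section G T" by (rule slices(3)[OF S(1,3)])
    show "\<exists>K. compact K \<and> (\<forall>x\<in>units G. \<forall>A B. fibre_separated G K x A B \<longrightarrow>
        (\<forall>v\<in>fibre_l2 G x. mult_comp (indicator A) (T x) (indicator B) v = (\<lambda>\<gamma>. 0)))"
      by (rule compactly_supported_slices[OF slices(2)[OF S(1,3)] S(2)])
  next
    assume a: "continuous_section G T \<and> (\<exists>K. compact K \<and> (\<forall>x\<in>units G. \<forall>A B. fibre_separated G K x A B \<longrightarrow>
        (\<forall>v\<in>fibre_l2 G x. mult_comp (indicator A) (T x) (indicator B) v = (\<lambda>\<gamma>. 0))))"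
    then obtain K where K: "compact K" "\<And>x A B v. \<lbrakk>x \<in> units G; fibre_separated G K x A B; v \<in> fibre_l2 G x\<rbrakk> \<Longrightarrow>
        mult_comp (indicator A) (T x) (indicator B) v = (\<lambda>\<gamma>. 0)" by blast
    \<comment> \<open>One K serves every \<epsilon>, because the compressions vanish.\<close>
    have q: "small_off_compact G T"
      unfolding small_off_compact_def using K by (intro allI impI exI[of _ K]) simp
    obtain S A where S: "S \<in> adjointable G" "\<forall>x\<in>units G. slice G x S = T x" "adjoint_pair G S A"
      "\<And>x. x \<in> units G \<Longrightarrow> is_slice x S (T x)"
      by (rule continuous_family_global_operator[OF T _ q]) (use a in blast)+
    have "compactly_supported G S" by (rule slices_compactly_supported[OF S(4) K])
    with S(1,2) show "\<exists>S\<in>adjointable G. compactly_supported G S \<and> (\<forall>x\<in>units G. slice G x S = T x)" by blast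
  qed
qed

end
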